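(* Let $p$ be a prime number, assume that $\mathbb{F}_p\subseteq R$ and that $R$ is noetherian as $R^G$-module, and let $P$ be a Sylow $p$-subgroup of $G$. Assume that $R$ and $R^G$ are Cohen-Macaulay. Let $H$ denote the subgroup of $G$ that is generated by all $p'$-elements of $G$ and all bireflections in $P$. Then $R^G=R_H^G$.
   Context: $G$ is a finite group and $R$ is a commutative ring on which $G$ acts by ring automorphisms; $R^G$ is the subring of $G$-invariants. A $p'$-element is an element of order not divisible by $p$. For a subgroup $H\le G$, $I_R(H)$ is the ideal of $R$ generated by all elements $h(r)-r$ with $h\in H$, $r\in R$. An element $g\in G$ is called a bireflection on $R$ if $\operatorname{height} I_R(\langle g\rangle)\le 2$. The height of an ideal is the infimum of the heights of the prime ideals containing it, and $\inf\emptyset=\infty$ (so the unit ideal has height $\infty$). $R_H^G$ denotes the image of the relative trace map $\operatorname{tr}_{G/H}\colon R^H\to R^G$, $r\mapsto\sum_{g\in G/H}g(r)$ ($g$ running over a transversal of the cosets $gH$); it is an ideal of $R^G$. *)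

theory Defs
  imports
    "HOL-Algebra.Algebra"
    "HOL-Number_Theory.Residues"
    "HOL-Library.Extended_Nat"
begin

definition prime_height :: "('a, 'b) ring_scheme \<Rightarrow> 'a set \<Rightarrow> enat" where
  "prime_height R P =
     (SUP n \<in> {n. \<exists>C :: nat \<Rightarrow> 'a set.
        (\<forall>i\<le>n. primeideal (C i) R) \<and> (\<forall>i<n. C i \<subset> C (Suc i)) \<and> C n = P}. enat n)"

text \<open>In \<^typ>\<open>enat\<close> the infimum of the empty set is \<open>\<infinity>\<close>, so the unit ideal has height \<open>\<infinity>\<close>.\<close>

definition height :: "('a, 'b) ring_scheme \<Rightarrow> 'a set \<Rightarrow> enat" where
  "height R I = (INF P \<in> {P. primeideal P R \<and> I \<subseteq> P}. prime_height R P)"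

text \<open>The supremum of the empty set is \<open>0\<close>, so the zero ring gets dimension \<open>0\<close>; below the
  dimension is only taken of local rings.\<close>

definition krull_dim :: "('a, 'b) ring_scheme \<Rightarrow> enat" where
  "krull_dim R = (SUP P \<in> {P. primeideal P R}. prime_height R P)"

definition regular_sequence :: "('a, 'b) ring_scheme \<Rightarrow> 'a list \<Rightarrow> bool" where
  "regular_sequence R xs \<longleftrightarrow>
     set xs \<subseteq> carrier R \<and>
     (\<forall>i<length xs. \<forall>r\<in>carrier R.
        xs ! i \<otimes>\<^bsub>R\<^esub> r \<in> genideal R (set (take i xs)) \<longrightarrow> r \<in> genideal R (set (take i xs))) \<and>
     genideal R (set xs) \<noteq> carrier R"

definition depth :: "('a, 'b) ring_scheme \<Rightarrow> 'a set \<Rightarrow> enat" where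
  "depth R I = (SUP xs \<in> {xs. regular_sequence R xs \<and> set xs \<subseteq> I}. enat (length xs))"

text \<open>The fraction \<open>a / s\<close>, as an equivalence class of pairs. The factor \<open>u\<close> is needed because the
  elements outside of \<open>P\<close> may be zero divisors.\<close>

definition frac_at :: "('a, 'b) ring_scheme \<Rightarrow> 'a set \<Rightarrow> 'a \<Rightarrow> 'a \<Rightarrow> ('a \<times> 'a) set" where
  "frac_at R P a s =
     {(b, t). b \<in> carrier R \<and> t \<in> carrier R - P \<and>
        (\<exists>u\<in>carrier R - P. u \<otimes>\<^bsub>R\<^esub> (t \<otimes>\<^bsub>R\<^esub> a) = u \<otimes>\<^bsub>R\<^esub> (s \<otimes>\<^bsub>R\<^esub> b))}"

text \<open>The operations take the union over all representatives; the sets united all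
  coincide (see \<open>localization_add_frac\<close> and \<open>localization_mult_frac\<close>).\<close>

definition localization :: "('a, 'b) ring_scheme \<Rightarrow> 'a set \<Rightarrow> ('a \<times> 'a) set ring" where
  "localization R P =
     \<lparr>carrier = {frac_at R P a s | a s. a \<in> carrier R \<and> s \<in> carrier R - P},
      monoid.mult = (\<lambda>A B. \<Union>(a, s)\<in>A. \<Union>(b, t)\<in>B. frac_at R P (a \<otimes>\<^bsub>R\<^esub> b) (s \<otimes>\<^bsub>R\<^esub> t)),
      monoid.one = frac_at R P \<one>\<^bsub>R\<^esub> \<one>\<^bsub>R\<^esub>,
      ring.zero = frac_at R P \<zero>\<^bsub>R\<^esub> \<one>\<^bsub>R\<^esub>,
      ring.add = (\<lambda>A B. \<Union>(a, s)\<in>A. \<Union>(b, t)\<in>B.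
               frac_at R P (t \<otimes>\<^bsub>R\<^esub> a \<oplus>\<^bsub>R\<^esub> s \<otimes>\<^bsub>R\<^esub> b) (s \<otimes>\<^bsub>R\<^esub> t))\<rparr>"

definition local_ring :: "('a, 'b) ring_scheme \<Rightarrow> bool" where
  "local_ring A \<longleftrightarrow> cring A \<and> (\<exists>!M. maximalideal M A)"

definition cohen_macaulay_local :: "('a, 'b) ring_scheme \<Rightarrow> bool" where
  "cohen_macaulay_local A \<longleftrightarrow>
     local_ring A \<and> noetherian_ring A \<and>
     (\<forall>M. maximalideal M A \<longrightarrow> depth A M = krull_dim A)"

definition cohen_macaulay :: "('a, 'b) ring_scheme \<Rightarrow> bool" where
  "cohen_macaulay R \<longleftrightarrow>
     cring R \<and> noetherian_ring R \<and>
     (\<forall>P. primeideal P R \<longrightarrow> cohen_macaulay_local (localization R P))"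

definition noetherian_module ::
    "('a, 'b) ring_scheme \<Rightarrow> ('a, 'c, 'd) module_scheme \<Rightarrow> bool" where
  "noetherian_module A M \<longleftrightarrow>
     module A M \<and>
     (\<forall>N. submodule N A M \<longrightarrow>
        (\<exists>S. finite S \<and> S \<subseteq> N \<and> N = \<Inter>{L. submodule L A M \<and> S \<subseteq> L}))"

text \<open>A ring \<open>R\<close> as a module over itself or any of its subrings.\<close>

definition ring_as_module :: "('a, 'b) ring_scheme \<Rightarrow> ('a, 'a) module" where
  "ring_as_module R =
     \<lparr>carrier = carrier R, monoid.mult = monoid.mult R, monoid.one = \<one>\<^bsub>R\<^esub>,
      ring.zero = \<zero>\<^bsub>R\<^esub>, ring.add = ring.add R, module.smult = monoid.mult R\<rparr>"

locale ring_action = group_action G "carrier R" \<phi> + ring: cring R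
  for G :: "('g, 'm) monoid_scheme" and R :: "('a, 'n) ring_scheme" and \<phi> :: "'g \<Rightarrow> 'a \<Rightarrow> 'a" +
  assumes action_ring_hom: "g \<in> carrier G \<Longrightarrow> \<phi> g \<in> ring_hom R R"

definition fixed_points ::
    "('a, 'n) ring_scheme \<Rightarrow> ('g \<Rightarrow> 'a \<Rightarrow> 'a) \<Rightarrow> 'g set \<Rightarrow> 'a set" where
  "fixed_points R \<phi> H = {r \<in> carrier R. \<forall>h\<in>H. \<phi> h r = r}"

definition fixed_ring ::
    "('a, 'n) ring_scheme \<Rightarrow> ('g \<Rightarrow> 'a \<Rightarrow> 'a) \<Rightarrow> 'g set \<Rightarrow> ('a, 'n) ring_scheme" where
  "fixed_ring R \<phi> H = R\<lparr>carrier := fixed_points R \<phi> H\<rparr>"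

definition moving_ideal ::
    "('a, 'n) ring_scheme \<Rightarrow> ('g \<Rightarrow> 'a \<Rightarrow> 'a) \<Rightarrow> 'g set \<Rightarrow> 'a set" where
  "moving_ideal R \<phi> H = genideal R {\<phi> h r \<ominus>\<^bsub>R\<^esub> r | h r. h \<in> H \<and> r \<in> carrier R}"

definition bireflection ::
    "('g, 'm) monoid_scheme \<Rightarrow> ('a, 'n) ring_scheme \<Rightarrow> ('g \<Rightarrow> 'a \<Rightarrow> 'a) \<Rightarrow> 'g \<Rightarrow> bool" where
  "bireflection G R \<phi> g \<longleftrightarrow>
     g \<in> carrier G \<and> height R (moving_ideal R \<phi> (generate G {g})) \<le> 2"

text \<open>A coset \<open>C = gH\<close> contributes \<open>g(r)\<close>, which for \<open>r \<in> R\<^sup>H\<close> does not depend on the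
  representative chosen.\<close>

definition relative_trace ::
    "('g, 'm) monoid_scheme \<Rightarrow> ('a, 'n) ring_scheme \<Rightarrow> ('g \<Rightarrow> 'a \<Rightarrow> 'a) \<Rightarrow> 'g set \<Rightarrow> 'a \<Rightarrow> 'a" where
  "relative_trace G R \<phi> H r = (\<Oplus>\<^bsub>R\<^esub>C\<in>lcosets\<^bsub>G\<^esub> H. \<phi> (SOME g. g \<in> C) r)"

definition trace_image ::
    "('g, 'm) monoid_scheme \<Rightarrow> ('a, 'n) ring_scheme \<Rightarrow> ('g \<Rightarrow> 'a \<Rightarrow> 'a) \<Rightarrow> 'g set \<Rightarrow> 'a set" where
  "trace_image G R \<phi> H = relative_trace G R \<phi> H ` fixed_points R \<phi> H"

definition p_regular_elements :: "nat \<Rightarrow> ('g, 'm) monoid_scheme \<Rightarrow> 'g set" where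
  "p_regular_elements p G = {g \<in> carrier G. \<not> p dvd group.ord G g}"

definition sylow_subgroup :: "nat \<Rightarrow> 'g set \<Rightarrow> ('g, 'm) monoid_scheme \<Rightarrow> bool" where
  "sylow_subgroup p P G \<longleftrightarrow> subgroup P G \<and> card P = p ^ multiplicity p (order G)"

context primeideal
begin

abbreviation "S \<equiv> carrier R - I"

lemma S_mult [simp]: "s \<in> S \<Longrightarrow> t \<in> S \<Longrightarrow> s \<otimes> t \<in> S"
  using I_prime by auto

lemma S_one [simp]: "\<one> \<in> S"
  using I_notcarr one_imp_carrier by auto

lemma frac_at_self:
  assumes "a \<in> carrier R" "s \<in> S" shows "(a, s) \<in> frac_at R I a s"
  using assms S_one by (fastforce simp: frac_at_def)

lemma frac_at_subset:
  assumes "a \<in> carrier R" "s \<in> S" "b \<in> carrier R" "t \<in> S" "u \<in> S"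
    "u \<otimes> (t \<otimes> a) = u \<otimes> (s \<otimes> b)"
  shows "frac_at R I a s \<subseteq> frac_at R I b t"
proof clarify
  fix c v assume "(c, v) \<in> frac_at R I a s"
  then obtain w where c: "c \<in> carrier R" "v \<in> S" "w \<in> S" "w \<otimes> (v \<otimes> a) = w \<otimes> (s \<otimes> c)"
    by (auto simp: frac_at_def)
  have in_carr: "s \<in> carrier R" "t \<in> carrier R" "u \<in> carrier R" "v \<in> carrier R" "w \<in> carrier R"
    using assms c by auto
  have "((u \<otimes> w) \<otimes> s) \<otimes> (v \<otimes> b) = (w \<otimes> v) \<otimes> (u \<otimes> (s \<otimes> b))"
    using in_carr assms(1,3) c(1) by (simp add: m_ac)
  also have "\<dots> = (w \<otimes> v) \<otimes> (u \<otimes> (t \<otimes> a))"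
    using assms(6) by simp
  also have "\<dots> = (u \<otimes> t) \<otimes> (w \<otimes> (v \<otimes> a))"
    using in_carr assms(1,3) c(1) by (simp add: m_ac)
  also have "\<dots> = (u \<otimes> t) \<otimes> (w \<otimes> (s \<otimes> c))"
    using c(4) by simp
  also have "\<dots> = ((u \<otimes> w) \<otimes> s) \<otimes> (t \<otimes> c)"
    using in_carr assms(1,3) c(1) by (simp add: m_ac)
  finally have "((u \<otimes> w) \<otimes> s) \<otimes> (v \<otimes> b) = ((u \<otimes> w) \<otimes> s) \<otimes> (t \<otimes> c)" .
  moreover have "(u \<otimes> w) \<otimes> s \<in> S" using assms c by (intro S_mult)
  ultimately show "(c, v) \<in> frac_at R I b t"
    using c unfolding frac_at_def by blast
qed

lemma frac_at_eq_iff: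
  assumes "a \<in> carrier R" "s \<in> S" "b \<in> carrier R" "t \<in> S"
  shows "frac_at R I a s = frac_at R I b t \<longleftrightarrow> (\<exists>u\<in>S. u \<otimes> (t \<otimes> a) = u \<otimes> (s \<otimes> b))"
proof
  assume "frac_at R I a s = frac_at R I b t"
  then have "(b, t) \<in> frac_at R I a s" using frac_at_self assms by simp
  then show "\<exists>u\<in>S. u \<otimes> (t \<otimes> a) = u \<otimes> (s \<otimes> b)" by (auto simp: frac_at_def)
next
  assume "\<exists>u\<in>S. u \<otimes> (t \<otimes> a) = u \<otimes> (s \<otimes> b)"
  then obtain u where "u \<in> S" "u \<otimes> (t \<otimes> a) = u \<otimes> (s \<otimes> b)" by blast
  then show "frac_at R I a s = frac_at R I b t"
    using assms frac_at_subset[of a s b t u] frac_at_subset[of b t a s u] by (intro equalityI) auto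
qed

lemma frac_at_eqI:
  assumes "a \<in> carrier R" "s \<in> S" "b \<in> carrier R" "t \<in> S" "t \<otimes> a = s \<otimes> b"
  shows "frac_at R I a s = frac_at R I b t"
  using frac_at_eq_iff[OF assms(1-4)] assms(5) S_one by metis

lemma frac_at_memD:
  assumes "(a', s') \<in> frac_at R I a s"
  obtains u where "a' \<in> carrier R" "s' \<in> S" "u \<in> S" "u \<otimes> (s' \<otimes> a) = u \<otimes> (s \<otimes> a')"
  using assms unfolding frac_at_def by auto

lemma UN_representatives_eq:
  assumes "(a, s) \<in> A" "(b, t) \<in> B"
    and "\<And>a s b t. (a, s) \<in> A \<Longrightarrow> (b, t) \<in> B \<Longrightarrow> F a s b t = C"
  shows "(\<Union>(a, s)\<in>A. \<Union>(b, t)\<in>B. F a s b t) = C"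
  using assms by blast

lemma localization_mult_frac:
  assumes "a \<in> carrier R" "s \<in> S" "b \<in> carrier R" "t \<in> S"
  shows "frac_at R I a s \<otimes>\<^bsub>localization R I\<^esub> frac_at R I b t = frac_at R I (a \<otimes> b) (s \<otimes> t)"
proof -
  have "frac_at R I (a' \<otimes> b') (s' \<otimes> t') = frac_at R I (a \<otimes> b) (s \<otimes> t)"
    if A: "(a', s') \<in> frac_at R I a s" and B: "(b', t') \<in> frac_at R I b t" for a' s' b' t'
  proof -
    obtain u where u: "a' \<in> carrier R" "s' \<in> S" "u \<in> S" "u \<otimes> (s' \<otimes> a) = u \<otimes> (s \<otimes> a')"
      using A by (rule frac_at_memD)
    obtain v where v: "b' \<in> carrier R" "t' \<in> S" "v \<in> S" "v \<otimes> (t' \<otimes> b) = v \<otimes> (t \<otimes> b')"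
      using B by (rule frac_at_memD)
    have in_carr: "s \<in> carrier R" "t \<in> carrier R" "u \<in> carrier R" "v \<in> carrier R"
      "s' \<in> carrier R" "t' \<in> carrier R"
      using assms u v by auto
    have "(u \<otimes> v) \<otimes> ((s \<otimes> t) \<otimes> (a' \<otimes> b')) = (u \<otimes> (s \<otimes> a')) \<otimes> (v \<otimes> (t \<otimes> b'))"
      using in_carr assms u(1) v(1) by (simp add: m_ac)
    also have "\<dots> = (u \<otimes> (s' \<otimes> a)) \<otimes> (v \<otimes> (t' \<otimes> b))"
      using u v by simp
    also have "\<dots> = (u \<otimes> v) \<otimes> ((s' \<otimes> t') \<otimes> (a \<otimes> b))"
      using in_carr assms u(1) v(1) by (simp add: m_ac)
    finally have eq: "(u \<otimes> v) \<otimes> ((s \<otimes> t) \<otimes> (a' \<otimes> b')) = (u \<otimes> v) \<otimes> ((s' \<otimes> t') \<otimes> (a \<otimes> b))" .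
    have "u \<otimes> v \<in> S" using u(3) v(3) by (rule S_mult)
    then have "\<exists>u\<in>S. u \<otimes> ((s \<otimes> t) \<otimes> (a' \<otimes> b')) = u \<otimes> ((s' \<otimes> t') \<otimes> (a \<otimes> b))"
      using eq by blast
    then show ?thesis
      using assms u v in_carr
      by (subst frac_at_eq_iff) (simp_all only: S_mult m_closed a_closed)
  qed
  then show ?thesis
    unfolding localization_def ring.simps monoid.simps
    by (rule UN_representatives_eq[OF frac_at_self frac_at_self, OF assms])
qed

lemma localization_add_frac:
  assumes "a \<in> carrier R" "s \<in> S" "b \<in> carrier R" "t \<in> S"
  shows "frac_at R I a s \<oplus>\<^bsub>localization R I\<^esub> frac_at R I b t =
    frac_at R I (t \<otimes> a \<oplus> s \<otimes> b) (s \<otimes> t)"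
proof -
  have "frac_at R I (t' \<otimes> a' \<oplus> s' \<otimes> b') (s' \<otimes> t') = frac_at R I (t \<otimes> a \<oplus> s \<otimes> b) (s \<otimes> t)"
    if A: "(a', s') \<in> frac_at R I a s" and B: "(b', t') \<in> frac_at R I b t" for a' s' b' t'
  proof -
    obtain u where u: "a' \<in> carrier R" "s' \<in> S" "u \<in> S" "u \<otimes> (s' \<otimes> a) = u \<otimes> (s \<otimes> a')"
      using A by (rule frac_at_memD)
    obtain v where v: "b' \<in> carrier R" "t' \<in> S" "v \<in> S" "v \<otimes> (t' \<otimes> b) = v \<otimes> (t \<otimes> b')"
      using B by (rule frac_at_memD)
    have in_carr: "s \<in> carrier R" "t \<in> carrier R" "u \<in> carrier R" "v \<in> carrier R"
      "s' \<in> carrier R" "t' \<in> carrier R"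
      using assms u v by auto
    have "(u \<otimes> v) \<otimes> ((s \<otimes> t) \<otimes> (t' \<otimes> a' \<oplus> s' \<otimes> b')) =
        (v \<otimes> (t \<otimes> t')) \<otimes> (u \<otimes> (s \<otimes> a')) \<oplus> (u \<otimes> (s \<otimes> s')) \<otimes> (v \<otimes> (t \<otimes> b'))"
      using in_carr assms u(1) v(1) by (simp add: m_ac r_distr)
    also have "\<dots> = (v \<otimes> (t \<otimes> t')) \<otimes> (u \<otimes> (s' \<otimes> a)) \<oplus> (u \<otimes> (s \<otimes> s')) \<otimes> (v \<otimes> (t' \<otimes> b))"
      using u v by simp
    also have "\<dots> = (u \<otimes> v) \<otimes> ((s' \<otimes> t') \<otimes> (t \<otimes> a \<oplus> s \<otimes> b))"
      using in_carr assms u(1) v(1) by (simp add: m_ac r_distr)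
    finally have eq: "(u \<otimes> v) \<otimes> ((s \<otimes> t) \<otimes> (t' \<otimes> a' \<oplus> s' \<otimes> b')) =
      (u \<otimes> v) \<otimes> ((s' \<otimes> t') \<otimes> (t \<otimes> a \<oplus> s \<otimes> b))" .
    have "u \<otimes> v \<in> S" using u(3) v(3) by (rule S_mult)
    then have "\<exists>u\<in>S. u \<otimes> ((s \<otimes> t) \<otimes> (t' \<otimes> a' \<oplus> s' \<otimes> b')) = u \<otimes> ((s' \<otimes> t') \<otimes> (t \<otimes> a \<oplus> s \<otimes> b))"
      using eq by blast
    then show ?thesis
      using assms u v in_carr
      by (subst frac_at_eq_iff) (simp_all only: S_mult m_closed a_closed)
  qed
  then show ?thesis
    unfolding localization_def ring.simps monoid.simps
    by (rule UN_representatives_eq[OF frac_at_self frac_at_self, OF assms])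
qed

lemma localization_carrierE:
  assumes "x \<in> carrier (localization R I)"
  obtains a s where "a \<in> carrier R" "s \<in> S" "x = frac_at R I a s"
  using assms unfolding localization_def by auto

lemma localization_frac_closed:
  "a \<in> carrier R \<Longrightarrow> s \<in> S \<Longrightarrow> frac_at R I a s \<in> carrier (localization R I)"
  unfolding localization_def by auto

lemma localization_one: "\<one>\<^bsub>localization R I\<^esub> = frac_at R I \<one> \<one>"
  and localization_zero: "\<zero>\<^bsub>localization R I\<^esub> = frac_at R I \<zero> \<one>"
  unfolding localization_def by simp_all

lemmas localization_simps =
  localization_mult_frac localization_add_frac localization_one localization_zero
  localization_frac_closed

theorem localization_cring: "cring (localization R I)"
proof (intro cringI abelian_groupI comm_monoidI)
  let ?L = "localization R I"
  note S_mult [intro] S_one [intro]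
  show "\<zero>\<^bsub>?L\<^esub> \<in> carrier ?L" "\<one>\<^bsub>?L\<^esub> \<in> carrier ?L"
    using S_one by (simp_all only: localization_simps zero_closed one_closed)
  fix x assume "x \<in> carrier ?L"
  then obtain a s where x: "a \<in> carrier R" "s \<in> S" "x = frac_at R I a s"
    by (rule localization_carrierE)
  then have s: "s \<in> carrier R" by simp
  show "\<zero>\<^bsub>?L\<^esub> \<oplus>\<^bsub>?L\<^esub> x = x" "\<one>\<^bsub>?L\<^esub> \<otimes>\<^bsub>?L\<^esub> x = x"
    using x s S_one by (simp_all add: localization_simps del: Diff_iff)
  have "frac_at R I (\<ominus> a) s \<oplus>\<^bsub>?L\<^esub> x = frac_at R I (s \<otimes> \<ominus> a \<oplus> s \<otimes> a) (s \<otimes> s)"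
    using x by (simp add: localization_simps del: Diff_iff)
  also have "\<dots> = \<zero>\<^bsub>?L\<^esub>"
    unfolding localization_zero
    using x s by (intro frac_at_eqI S_mult S_one) (simp_all add: r_minus l_neg)
  finally show "\<exists>y\<in>carrier ?L. y \<oplus>\<^bsub>?L\<^esub> x = \<zero>\<^bsub>?L\<^esub>"
    using x by (intro bexI[where x = "frac_at R I (\<ominus> a) s"])
      (simp_all add: localization_simps del: Diff_iff)
  fix y assume "y \<in> carrier ?L"
  then obtain b t where y: "b \<in> carrier R" "t \<in> S" "y = frac_at R I b t"
    by (rule localization_carrierE)
  then have t: "t \<in> carrier R" by simp
  show "x \<oplus>\<^bsub>?L\<^esub> y \<in> carrier ?L" "x \<otimes>\<^bsub>?L\<^esub> y \<in> carrier ?L"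
    using x y s t by (simp_all add: localization_simps del: Diff_iff)
  show "x \<oplus>\<^bsub>?L\<^esub> y = y \<oplus>\<^bsub>?L\<^esub> x" "x \<otimes>\<^bsub>?L\<^esub> y = y \<otimes>\<^bsub>?L\<^esub> x"
    using x y s t by (simp_all add: localization_simps m_comm a_comm del: Diff_iff)
  fix z assume "z \<in> carrier ?L"
  then obtain c u where z: "c \<in> carrier R" "u \<in> S" "z = frac_at R I c u"
    by (rule localization_carrierE)
  then have u: "u \<in> carrier R" by simp
  show "(x \<oplus>\<^bsub>?L\<^esub> y) \<oplus>\<^bsub>?L\<^esub> z = x \<oplus>\<^bsub>?L\<^esub> (y \<oplus>\<^bsub>?L\<^esub> z)"
    "(x \<otimes>\<^bsub>?L\<^esub> y) \<otimes>\<^bsub>?L\<^esub> z = x \<otimes>\<^bsub>?L\<^esub> (y \<otimes>\<^bsub>?L\<^esub> z)"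
    using x y z s t u
    by (simp_all add: localization_simps r_distr m_ac a_assoc del: Diff_iff)
  have "(x \<oplus>\<^bsub>?L\<^esub> y) \<otimes>\<^bsub>?L\<^esub> z = frac_at R I ((t \<otimes> a \<oplus> s \<otimes> b) \<otimes> c) ((s \<otimes> t) \<otimes> u)"
    using x y z s t u by (simp add: localization_simps del: Diff_iff)
  also have "\<dots> = frac_at R I ((t \<otimes> u) \<otimes> (a \<otimes> c) \<oplus> (s \<otimes> u) \<otimes> (b \<otimes> c)) ((s \<otimes> u) \<otimes> (t \<otimes> u))"
    using x y z s t u
    by (intro frac_at_eqI S_mult) (simp_all add: l_distr r_distr m_ac)
  also have "\<dots> = x \<otimes>\<^bsub>?L\<^esub> z \<oplus>\<^bsub>?L\<^esub> y \<otimes>\<^bsub>?L\<^esub> z"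
    using x y z s t u by (simp add: localization_simps del: Diff_iff)
  finally show "(x \<oplus>\<^bsub>?L\<^esub> y) \<otimes>\<^bsub>?L\<^esub> z = x \<otimes>\<^bsub>?L\<^esub> z \<oplus>\<^bsub>?L\<^esub> y \<otimes>\<^bsub>?L\<^esub> z" .
qed

end

end

theory Submission
  imports Defs
begin

text \<open>
  Let \<open>I\<close> be the image of the trace from \<open>R\<^sup>H\<close> to \<open>R\<^sup>G\<close>, and suppose that \<open>I\<close> is proper. If a prime ideal
  \<open>Q\<close> of \<open>R\<close> contains \<open>I\<close>, then its inertia group is not contained in \<open>H\<close>. As \<open>H\<close> contains all
  \<open>p'\<close>-elements, some \<open>p\<close>-element outside of \<open>H\<close> acts trivially modulo \<open>Q\<close>; it is conjugate into \<open>P\<close> and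
  no bireflection, so \<open>Q\<close> has height at least \<open>3\<close>. By lying over and incomparability, the same holds for
  the prime ideals of \<open>R\<^sup>G\<close> that contain \<open>I\<close>. The Cohen-Macaulay property now yields
  \<open>a\<^sub>1, a\<^sub>2, a\<^sub>3 \<in> I\<close> such that \<open>a\<^sub>1, a\<^sub>2\<close> is regular on \<open>R\<close> and \<open>a\<^sub>1, a\<^sub>2, a\<^sub>3\<close> is regular on \<open>R\<^sup>G\<close>.

  Fix \<open>Q\<close> with inertia group \<open>T\<close>, and let \<open>N\<close> be a minimal subgroup containing \<open>H\<close> and \<open>T\<close> for which
  \<open>a\<^sub>3\<close> is still a nonzerodivisor on \<open>R\<^sup>N / (a\<^sub>1, a\<^sub>2)\<close>. Since \<open>N/H\<close> is a nontrivial \<open>p\<close>-group, there is a nonzero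
  homomorphism \<open>f : N \<rightarrow> \<int>/p\<close> vanishing on \<open>H\<close>. Its class in \<open>H\<^sup>1(N, R)\<close> is annihilated by the \<open>a\<^sub>i\<close>, and
  their regularity implies that it is zero: there is \<open>w\<close> in \<open>R\<close> with \<open>n(w) - w = f(n)\<close> for \<open>n \<in> N\<close>. Hence \<open>f\<close>
  vanishes on \<open>T\<close>, and \<open>R\<^sup>K\<close>, for \<open>K\<close> the kernel of \<open>f\<close>, is an Artin-Schreier extension of \<open>R\<^sup>N\<close>
  that inherits the regularity of \<open>a\<^sub>3\<close>. This contradicts the minimality of \<open>N\<close>.
\<close>

subsection \<open>Regular sequences\<close>

text \<open>Why three elements are needed: if \<open>u\<^sub>i\<close> trivializes
  \<open>a\<^sub>i f\<close>, then the \<open>a\<^sub>i u\<^sub>j - a\<^sub>j u\<^sub>i\<close> are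
  invariants, and three of them satisfy a Koszul relation that places
  \<open>a\<^sub>3 (a\<^sub>1 u\<^sub>2 - a\<^sub>2 u\<^sub>1)\<close> in the ideal
  \<open>(a\<^sub>1, a\<^sub>2)\<close> of \<open>R\<^sup>N\<close>. Two classes give no such
  relation, which is why the primes over the trace ideal must have height greater than 2. Why there
  is a descent: Cohen-Macaulayness is known for \<open>R\<close> and \<open>R\<^sup>G\<close> but
  not for the rings \<open>R\<^sup>N\<close> in between. So only one instance of regularity is
  carried downwards, that of the fixed \<open>a\<^sub>3\<close> modulo the fixed
  \<open>a\<^sub>1, a\<^sub>2\<close>. The inertia group stays inside each kernel without lying in
  \<open>H\<close>, so the descent can never end. The Cohen-Macaulay property itself enters only
  through unmixedness: a maximal associated prime of the ideal generated by at most two elements of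
  a regular sequence has height at most two.\<close>

context cring begin

lemma mem_Idl_singleton:
  assumes "a \<in> carrier R"
  shows "x \<in> Idl {a} \<longleftrightarrow> (\<exists>r\<in>carrier R. x = a \<otimes> r)"
proof -
  have "x \<in> PIdl a \<longleftrightarrow> (\<exists>r\<in>carrier R. x = r \<otimes> a)" by (auto simp: cgenideal_def)
  then show ?thesis
    unfolding cgenideal_eq_genideal[OF assms] by (metis assms m_comm)
qed

lemma Idl_pair:
  assumes "a \<in> carrier R" "b \<in> carrier R"
  shows "Idl {a, b} = Idl {a} <+> Idl {b}"
proof -
  have 1: "{a} \<subseteq> Idl {a}" "{b} \<subseteq> Idl {b}" "{a, b} \<subseteq> Idl {a, b}"
      using assms genideal_self[of "{a, b}"] by (auto intro: genideal_self')
  have i: "ideal (Idl {a}) R" "ideal (Idl {b}) R" "ideal (Idl {a, b}) R" 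
      using assms by (auto intro!: genideal_ideal)
  have 2: "Idl {a} \<subseteq> carrier R" "Idl {b} \<subseteq> carrier R"
    using i(1,2)[THEN ideal.Icarr] by blast+
  have "Idl (Idl {a} \<union> Idl {b}) = Idl {a, b}"
  proof (rule equalityI)
    show "Idl (Idl {a} \<union> Idl {b}) \<subseteq> Idl {a, b}"
      using 1 by (intro genideal_minimal Un_least i) blast+
    have "Idl {a} \<union> Idl {b} \<subseteq> Idl (Idl {a} \<union> Idl {b})"
      using 2 by (intro genideal_self) blast
    then show "Idl {a, b} \<subseteq> Idl (Idl {a} \<union> Idl {b})"
      using 1(1,2) 2 by (intro genideal_minimal[OF genideal_ideal] Un_least) auto
  qed
  then show ?thesis using union_genideal[OF i(1,2)] by simp
qed

lemma mem_Idl_pair: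
  assumes "a \<in> carrier R" "b \<in> carrier R"
  shows "x \<in> Idl {a, b} \<longleftrightarrow> (\<exists>r\<in>carrier R. \<exists>s\<in>carrier R. x = a \<otimes> r \<oplus> b \<otimes> s)"
proof -
  show ?thesis
  proof
    assume "x \<in> Idl {a, b}"
    then obtain u v where "u \<in> Idl {a}" "v \<in> Idl {b}" "x = u \<oplus> v"
      unfolding Idl_pair[OF assms] by (auto simp: set_add_defs)
    then show "\<exists>r\<in>carrier R. \<exists>s\<in>carrier R. x = a \<otimes> r \<oplus> b \<otimes> s"
      using assms by (metis mem_Idl_singleton)
  next
    assume "\<exists>r\<in>carrier R. \<exists>s\<in>carrier R. x = a \<otimes> r \<oplus> b \<otimes> s"
    then obtain r s where rs: "r \<in> carrier R" "s \<in> carrier R" "x = a \<otimes> r \<oplus> b \<otimes> s" by blast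
    then have "a \<otimes> r \<in> Idl {a}" "b \<otimes> s \<in> Idl {b}"
      using rs mem_Idl_singleton[OF assms(1)] mem_Idl_singleton[OF assms(2)] by auto
    then show "x \<in> Idl {a, b}"
      unfolding Idl_pair[OF assms] rs(3) by (auto simp: set_add_defs)
  qed
qed

text \<open>This is \<open>regular_sequence\<close> without properness of the generated ideal. In
  this form the notion passes to every localization and can be extended one element at a
  time.\<close>

definition weakly_regular :: "'a list \<Rightarrow> bool" where
  "weakly_regular xs \<longleftrightarrow> set xs \<subseteq> carrier R \<and>
     (\<forall>i<length xs. \<forall>r\<in>carrier R.
        xs ! i \<otimes> r \<in> Idl (set (take i xs)) \<longrightarrow> r \<in> Idl (set (take i xs)))"

lemma Idl_empty: "Idl {} = {\<zero>}"
proof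
  show "Idl {} \<subseteq> {\<zero>}" by (rule genideal_minimal[OF zeroideal]) blast
  have "ideal (Idl {}) R" by (rule genideal_ideal) blast
  then show "{\<zero>} \<subseteq> Idl {}" by (simp add: additive_subgroup.zero_closed ideal.axioms(1))
qed
lemma weakly_regular_nth:
  assumes "weakly_regular xs" "i < length xs" "r \<in> carrier R"
    "xs ! i \<otimes> r \<in> Idl (set (take i xs))"
  shows "r \<in> Idl (set (take i xs))"
  using assms unfolding weakly_regular_def by blast

lemma weakly_regularD:
  assumes "weakly_regular (a # xs)"
  shows "a \<in> carrier R" "\<And>r. r \<in> carrier R \<Longrightarrow> a \<otimes> r = \<zero> \<Longrightarrow> r = \<zero>"
  using weakly_regular_nth[OF assms, of 0] assms by (simp_all add: weakly_regular_def Idl_empty)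

lemma weakly_regularD2:
  assumes "weakly_regular (a # b # xs)"
  shows "b \<in> carrier R"
    "\<And>r s. r \<in> carrier R \<Longrightarrow> s \<in> carrier R \<Longrightarrow> b \<otimes> r = a \<otimes> s \<Longrightarrow> \<exists>t\<in>carrier R. r = a \<otimes> t"
proof -
  have a: "a \<in> carrier R" using weakly_regularD[OF assms] by simp
  show "b \<in> carrier R" using assms by (simp add: weakly_regular_def)
  show "\<exists>t\<in>carrier R. r = a \<otimes> t"
    if "r \<in> carrier R" "s \<in> carrier R" "b \<otimes> r = a \<otimes> s" for r s
    using weakly_regular_nth[OF assms, of 1 r] that unfolding mem_Idl_singleton[OF a, symmetric]
    by (auto simp: mem_Idl_singleton[OF a])
qed

lemma weakly_regularD3:
  assumes "weakly_regular (a # b # c # xs)"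
  shows "c \<in> carrier R"
    "\<And>r s t. r \<in> carrier R \<Longrightarrow> s \<in> carrier R \<Longrightarrow> t \<in> carrier R \<Longrightarrow> c \<otimes> r = a \<otimes> s \<oplus> b \<otimes> t \<Longrightarrow>
      \<exists>s\<in>carrier R. \<exists>t\<in>carrier R. r = a \<otimes> s \<oplus> b \<otimes> t"
proof -
  have a: "a \<in> carrier R" "b \<in> carrier R"
    using weakly_regularD(1)[OF assms] weakly_regularD2(1)[OF assms] by simp_all
  show "c \<in> carrier R" using assms by (simp add: weakly_regular_def)
  show "\<exists>s\<in>carrier R. \<exists>t\<in>carrier R. r = a \<otimes> s \<oplus> b \<otimes> t"
    if "r \<in> carrier R" "s \<in> carrier R" "t \<in> carrier R" "c \<otimes> r = a \<otimes> s \<oplus> b \<otimes> t" for r s t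
    using weakly_regular_nth[OF assms, of 2 r] that
    unfolding mem_Idl_pair[OF a, symmetric] by (auto simp: mem_Idl_pair[OF a] numeral_2_eq_2)
qed

lemma weakly_regular_take:
  assumes "weakly_regular xs"
  shows "weakly_regular (take n xs)"
  using assms by (auto simp: weakly_regular_def min_def dest: in_set_takeD)

section \<open>Comparison of two regular sequences\<close>

lemma nzd_cancel:
  assumes "\<And>r. r \<in> carrier R \<Longrightarrow> a \<otimes> r = \<zero> \<Longrightarrow> r = \<zero>" "a \<in> carrier R"
    "x \<in> carrier R" "y \<in> carrier R" "a \<otimes> x = a \<otimes> y"
  shows "x = y"
proof -
  have "a \<otimes> (x \<ominus> y) = \<zero>"
    using assms(2-) by (simp add: minus_eq r_distr r_minus r_neg)
  then show ?thesis using assms by (metis minus_closed r_right_minus_eq)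
qed

lemma weakly_regular_cancel:
  assumes a: "weakly_regular (a # xs)" and c: "x \<in> carrier R" "y \<in> carrier R" and e: "a \<otimes> x = a \<otimes> y"
  shows "x = y"
  by (rule nzd_cancel[OF _ weakly_regularD(1)[OF a] c e]) (rule weakly_regularD(2)[OF a])

text \<open>From \<open>b1 x = a y1\<close> and \<open>b2 x = a y2\<close>, cancelling
  \<open>a\<close> gives \<open>b1 y2 = b2 y1\<close>. Hence \<open>b1\<close> divides
  \<open>y1\<close>, and it can be cancelled from \<open>b1 x = a y1\<close>.\<close>

lemma Rees_1:
  assumes a: "weakly_regular [a]" and b: "weakly_regular [b1, b2]" and x: "x \<in> carrier R"
    and *: "\<And>b. b \<in> {b1, b2} \<Longrightarrow> b \<otimes> x \<in> Idl {a}"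
  shows "x \<in> Idl {a}"
proof -
  note [simp] = weakly_regularD(1)[OF a] weakly_regularD(1)[OF b] weakly_regularD2(1)[OF b] x
  obtain y1 y2 where [simp]: "y1 \<in> carrier R" "y2 \<in> carrier R"
    and y: "b1 \<otimes> x = a \<otimes> y1" "b2 \<otimes> x = a \<otimes> y2"
    using *[of b1] *[of b2] by (auto simp: mem_Idl_singleton)
  have "a \<otimes> (b1 \<otimes> y2) = b1 \<otimes> (b2 \<otimes> x)"
    unfolding y(2) by (simp add: m_ac)
  also have "\<dots> = b2 \<otimes> (a \<otimes> y1)"
    unfolding y(1)[symmetric] by (simp add: m_ac)
  also have "\<dots> = a \<otimes> (b2 \<otimes> y1)" by (simp add: m_ac)
  finally have "b1 \<otimes> y2 = b2 \<otimes> y1"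
    by (rule weakly_regular_cancel[OF a, rotated 2]) simp_all
  then obtain z where [simp]: "z \<in> carrier R" and z: "y1 = b1 \<otimes> z"
    using weakly_regularD2(2)[OF b, of y1 y2] by auto
  have "b1 \<otimes> x = b1 \<otimes> (a \<otimes> z)"
    unfolding y z by (simp add: m_ac)
  then have "x = a \<otimes> z"
    by (rule weakly_regular_cancel[OF b, rotated 2]) simp_all
  then show ?thesis by (auto simp: mem_Idl_singleton)
qed

text \<open>The relations \<open>b\<^sub>i x = a\<^sub>1 y\<^sub>i + a\<^sub>2 z\<^sub>i\<close> yield a Koszul cocycle \<open>t\<^sub>i\<^sub>j\<close> of the \<open>b\<^sub>i\<close>.\<close>
lemma Rees_2_cocycle:
  assumes a: "weakly_regular [a1, a2]" 
    and c [simp]: "b1 \<in> carrier R" "b2 \<in> carrier R" "x \<in> carrier R"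
      "y1 \<in> carrier R" "y2 \<in> carrier R" "z1 \<in> carrier R" "z2 \<in> carrier R" 
    and e: "b1 \<otimes> x = a1 \<otimes> y1 \<oplus> a2 \<otimes> z1" "b2 \<otimes> x = a1 \<otimes> y2 \<oplus> a2 \<otimes> z2"
  obtains t where "t \<in> carrier R" "b2 \<otimes> z1 \<ominus> b1 \<otimes> z2 = a1 \<otimes> t" "b1 \<otimes> y2 \<ominus> b2 \<otimes> y1 = a2 \<otimes> t"
proof -
  note [simp] = weakly_regularD(1)[OF a] weakly_regularD2(1)[OF a]
  have 0: "b2 \<otimes> (a1 \<otimes> y1 \<oplus> a2 \<otimes> z1) = b1 \<otimes> (a1 \<otimes> y2 \<oplus> a2 \<otimes> z2)"
    unfolding e[symmetric] by (simp add: m_ac)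
  have "a2 \<otimes> (b2 \<otimes> z1 \<ominus> b1 \<otimes> z2) = b2 \<otimes> (a1 \<otimes> y1 \<oplus> a2 \<otimes> z1) \<ominus> b1 \<otimes> (a1 \<otimes> y2 \<oplus> a2 \<otimes> z2)
      \<oplus> a1 \<otimes> (b1 \<otimes> y2 \<ominus> b2 \<otimes> y1)"
    using c weakly_regularD(1)[OF a] weakly_regularD2(1)[OF a] by algebra
  also have "\<dots> = a1 \<otimes> (b1 \<otimes> y2 \<ominus> b2 \<otimes> y1)" unfolding 0 by (simp add: r_neg minus_eq)
  finally have 1: "a2 \<otimes> (b2 \<otimes> z1 \<ominus> b1 \<otimes> z2) = a1 \<otimes> (b1 \<otimes> y2 \<ominus> b2 \<otimes> y1)" .
  then obtain t where t: "t \<in> carrier R" "b2 \<otimes> z1 \<ominus> b1 \<otimes> z2 = a1 \<otimes> t"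
    using weakly_regularD2(2)[OF a, of "b2 \<otimes> z1 \<ominus> b1 \<otimes> z2" "b1 \<otimes> y2 \<ominus> b2 \<otimes> y1"] by auto
  have "a1 \<otimes> (b1 \<otimes> y2 \<ominus> b2 \<otimes> y1) = a1 \<otimes> (a2 \<otimes> t)"
    unfolding 1[symmetric] t(2) using t(1) by (simp add: m_ac)
  then have "b1 \<otimes> y2 \<ominus> b2 \<otimes> y1 = a2 \<otimes> t"
    by (rule weakly_regular_cancel[OF a, rotated 2]) (simp_all add: t(1))
  with t that show thesis by blast
qed

text \<open>The cocycle relation gives \<open>b3 t12 \<in> (b1, b2)\<close>, so
  \<open>t12 = b1 s + b2 t\<close> by regularity of \<open>b3\<close>. Correcting \<open>y1\<close>
  and \<open>z1\<close> by the coboundary that \<open>t\<close> defines makes both divisible by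
  \<open>b1\<close>, which then cancels from \<open>b1 x = a1 y1 + a2 z1\<close>.\<close>

lemma Rees_2:
  assumes a: "weakly_regular [a1, a2]" and b: "weakly_regular [b1, b2, b3]" and x: "x \<in> carrier R"
    and *: "\<And>b. b \<in> {b1, b2, b3} \<Longrightarrow> b \<otimes> x \<in> Idl {a1, a2}"
  shows "x \<in> Idl {a1, a2}"
proof -
  note c [simp] = weakly_regularD(1)[OF a] weakly_regularD2(1)[OF a] 
    weakly_regularD(1)[OF b] weakly_regularD2(1)[OF b] weakly_regularD3(1)[OF b] x
  obtain y1 z1 y2 z2 y3 z3 where c2 [simp]: "y1 \<in> carrier R" "y2 \<in> carrier R" "y3 \<in> carrier R"
    "z1 \<in> carrier R" "z2 \<in> carrier R" "z3 \<in> carrier R"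
    and y: "b1 \<otimes> x = a1 \<otimes> y1 \<oplus> a2 \<otimes> z1" "b2 \<otimes> x = a1 \<otimes> y2 \<oplus> a2 \<otimes> z2" "b3 \<otimes> x = a1 \<otimes> y3 \<oplus> a2 \<otimes> z3"
    using *[of b1, unfolded mem_Idl_pair[OF c(1,2)]] *[of b2, unfolded mem_Idl_pair[OF c(1,2)]]
      *[of b3, unfolded mem_Idl_pair[OF c(1,2)]] by fast
  obtain t12 where t12: "t12 \<in> carrier R" "b2 \<otimes> z1 \<ominus> b1 \<otimes> z2 = a1 \<otimes> t12" "b1 \<otimes> y2 \<ominus> b2 \<otimes> y1 = a2 \<otimes> t12"
    using Rees_2_cocycle[OF a _ _ _ _ _ _ _ y(1,2)] by auto
  obtain t13 where t13: "t13 \<in> carrier R" "b3 \<otimes> z1 \<ominus> b1 \<otimes> z3 = a1 \<otimes> t13"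
    using Rees_2_cocycle[OF a _ _ _ _ _ _ _ y(1,3)] by auto
  obtain t23 where t23: "t23 \<in> carrier R" "b3 \<otimes> z2 \<ominus> b2 \<otimes> z3 = a1 \<otimes> t23"
    using Rees_2_cocycle[OF a _ _ _ _ _ _ _ y(2,3)] by auto
  note c3 [simp] = t12(1) t13(1) t23(1)
  \<comment> \<open>The cocycle relation between \<open>t12\<close>, \<open>t13\<close> and
    \<open>t23\<close>, obtained after multiplication by \<open>a1\<close>.\<close>
  have "a1 \<otimes> (b3 \<otimes> t12) = b3 \<otimes> (b2 \<otimes> z1 \<ominus> b1 \<otimes> z2)"
    unfolding t12(2) by (simp add: m_ac)
  also have "\<dots> = b1 \<otimes> (\<ominus> (b3 \<otimes> z2 \<ominus> b2 \<otimes> z3)) \<oplus> b2 \<otimes> (b3 \<otimes> z1 \<ominus> b1 \<otimes> z3)"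
    using c c2 by algebra
  also have "\<dots> = a1 \<otimes> (b1 \<otimes> (\<ominus> t23) \<oplus> b2 \<otimes> t13)"
    unfolding t23(2) t13(2) using c c3 by algebra
  finally have "b3 \<otimes> t12 = b1 \<otimes> (\<ominus> t23) \<oplus> b2 \<otimes> t13"
    by (rule weakly_regular_cancel[OF a, rotated 2]) simp_all
  then obtain s t where c4 [simp]: "s \<in> carrier R" "t \<in> carrier R" and st: "t12 = b1 \<otimes> s \<oplus> b2 \<otimes> t"
    using weakly_regularD3(2)[OF b, of t12 "\<ominus> t23" t13] by auto
  have "b2 \<otimes> (z1 \<ominus> a1 \<otimes> t) = b2 \<otimes> z1 \<ominus> b1 \<otimes> z2 \<ominus> a1 \<otimes> t12 \<oplus> b1 \<otimes> (z2 \<oplus> a1 \<otimes> s)"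
    unfolding st using c c2 c4 by algebra
  then have "b2 \<otimes> (z1 \<ominus> a1 \<otimes> t) = b1 \<otimes> (z2 \<oplus> a1 \<otimes> s)"
    unfolding t12(2) by (simp add: minus_eq r_neg)
  then obtain v where v [simp]: "v \<in> carrier R" "z1 \<ominus> a1 \<otimes> t = b1 \<otimes> v"
    using weakly_regularD2(2)[OF b, of "z1 \<ominus> a1 \<otimes> t" "z2 \<oplus> a1 \<otimes> s"] by auto
  have "b2 \<otimes> (y1 \<oplus> a2 \<otimes> t) = a2 \<otimes> t12 \<ominus> (b1 \<otimes> y2 \<ominus> b2 \<otimes> y1) \<oplus> b1 \<otimes> (y2 \<ominus> a2 \<otimes> s)"
    unfolding st using c c2 c4 by algebra
  then have "b2 \<otimes> (y1 \<oplus> a2 \<otimes> t) = b1 \<otimes> (y2 \<ominus> a2 \<otimes> s)"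
    unfolding t12(3) by (simp add: minus_eq r_neg)
  then obtain w where w [simp]: "w \<in> carrier R" "y1 \<oplus> a2 \<otimes> t = b1 \<otimes> w"
    using weakly_regularD2(2)[OF b, of "y1 \<oplus> a2 \<otimes> t" "y2 \<ominus> a2 \<otimes> s"] by auto
  have "b1 \<otimes> x = a1 \<otimes> (y1 \<oplus> a2 \<otimes> t) \<oplus> a2 \<otimes> (z1 \<ominus> a1 \<otimes> t)"
    unfolding y(1) using c c2 c4 by algebra
  also have "\<dots> = b1 \<otimes> (a1 \<otimes> w \<oplus> a2 \<otimes> v)"
    unfolding v w using c v(1) w(1) by algebra
  finally have "x = a1 \<otimes> w \<oplus> a2 \<otimes> v"
    by (rule weakly_regular_cancel[OF b, rotated 2]) simp_all
  then show ?thesis unfolding mem_Idl_pair[OF c(1,2)] using v(1) w(1) by blast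
qed

text \<open>Rees' theorem on the common length of maximal regular sequences, in elementwise form.\<close>
lemma Rees:
  assumes as: "weakly_regular as" and bs: "weakly_regular bs" and len: "length bs = Suc (length as)"
    and "length as \<le> 2" and x: "x \<in> carrier R"
    and *: "\<And>b. b \<in> set bs \<Longrightarrow> b \<otimes> x \<in> Idl (set as)"
  shows "x \<in> Idl (set as)"
proof -
  consider "length as = 0" | "length as = 1" | "length as = 2" using assms(4) by linarith
  then show ?thesis
  proof cases
    case 1
    then obtain b where "as = []" "bs = [b]" using len by (auto simp: length_Suc_conv)
    then show ?thesis using bs x weakly_regularD(2)[of b "[]"] * by (auto simp: Idl_empty)
  next
    case 2
    then obtain a b1 b2 where "as = [a]" "bs = [b1, b2]"
      using len by (auto simp: length_Suc_conv)
    then show ?thesis using as bs x * Rees_1[of a b1 b2 x] by auto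
  next
    case 3
    then obtain a1 a2 b1 b2 b3 where "as = [a1, a2]" "bs = [b1, b2, b3]"
      using len by (auto simp: length_Suc_conv numeral_2_eq_2)
    then show ?thesis using as bs x * Rees_2[of a1 a2 b1 b2 b3 x] by auto
  qed
qed

end

subsection \<open>Localization and unmixedness\<close>

context primeideal
begin

abbreviation "L \<equiv> localization R I"

text \<open>For an ideal \<open>K\<close> this is its extension to the localization
  (\<open>genideal_loc_set\<close>). No sums of fractions are needed, because finitely many
  fractions have a common denominator.\<close>

definition loc_set :: "'a set \<Rightarrow> ('a \<times> 'a) set set" where
  "loc_set K = {frac_at R I k s | k s. k \<in> K \<and> s \<in> S}"

text \<open>Membership can be tested on any representative, at the price of the multiplier
  \<open>u\<close>: equal fractions have equal cross products only after multiplication by an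
  element outside of \<open>I\<close>.\<close>

lemma frac_mem_loc_set_iff:
  assumes K: "ideal K R" and a: "a \<in> carrier R" "s \<in> S"
  shows "frac_at R I a s \<in> loc_set K \<longleftrightarrow> (\<exists>u\<in>S. u \<otimes> a \<in> K)"
proof
  interpret K: ideal K R by fact
  assume "frac_at R I a s \<in> loc_set K"
  then obtain k t where k: "k \<in> K" "t \<in> S" "frac_at R I a s = frac_at R I k t"
    by (auto simp: loc_set_def)
  then obtain u where u: "u \<in> S" "u \<otimes> (t \<otimes> a) = u \<otimes> (s \<otimes> k)"
    using frac_at_eq_iff[OF a K.Icarr k(2)] by auto
  have "(u \<otimes> t) \<otimes> a = (u \<otimes> s) \<otimes> k"
    using u k a K.Icarr[OF k(1)] by (simp add: m_assoc)
  then have "(u \<otimes> t) \<otimes> a \<in> K" using u k a K.I_l_closed by simp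
  moreover have "u \<otimes> t \<in> S" using u k by (intro S_mult)
  ultimately show "\<exists>u\<in>S. u \<otimes> a \<in> K" by blast
next
  assume "\<exists>u\<in>S. u \<otimes> a \<in> K"
  then obtain u where u: "u \<in> S" "u \<otimes> a \<in> K" by blast
  have "frac_at R I a s = frac_at R I (u \<otimes> a) (u \<otimes> s)"
    using u a by (intro frac_at_eqI S_mult) (simp_all add: m_ac)
  then show "frac_at R I a s \<in> loc_set K"
    using u a S_mult[of u s] unfolding loc_set_def by blast
qed

lemma ideal_loc_set:
  assumes K: "ideal K R"
  shows "ideal (loc_set K) L"
proof -
  interpret K: ideal K R by fact
  interpret L: cring L by (rule localization_cring)
  have sub: "loc_set K \<subseteq> carrier L"
    using K.Icarr by (auto simp: loc_set_def intro!: localization_frac_closed)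
  have mult: "x \<otimes>\<^bsub>L\<^esub> k \<in> loc_set K" if x: "x \<in> carrier L" and k: "k \<in> loc_set K" for x k
  proof -
    obtain a s where x: "a \<in> carrier R" "s \<in> S" "x = frac_at R I a s"
      using x by (rule localization_carrierE)
    obtain b t where k: "b \<in> K" "t \<in> S" "k = frac_at R I b t"
      using k by (auto simp: loc_set_def)
    then have "b \<in> carrier R" by (simp add: K.Icarr)
    then have "x \<otimes>\<^bsub>L\<^esub> k = frac_at R I (a \<otimes> b) (s \<otimes> t)"
      unfolding x k using localization_mult_frac x k by blast
    moreover have "a \<otimes> b \<in> K" using k x K.I_l_closed by simp
    moreover have "s \<otimes> t \<in> S" using x k by (intro S_mult)
    ultimately show ?thesis unfolding loc_set_def by blast
  qed
  show ?thesis
  proof (rule idealI)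
    show "subgroup (loc_set K) (add_monoid L)"
    proof (rule L.add.subgroupI)
      show "loc_set K \<subseteq> carrier L" by (rule sub)
      have "frac_at R I \<zero> \<one> \<in> loc_set K"
        using K.zero_closed S_one unfolding loc_set_def by blast
      then show "loc_set K \<noteq> {}" by blast
    next
      fix k assume k: "k \<in> loc_set K"
      then have "\<ominus>\<^bsub>L\<^esub> k = (\<ominus>\<^bsub>L\<^esub> \<one>\<^bsub>L\<^esub>) \<otimes>\<^bsub>L\<^esub> k"
        using sub by (simp add: L.l_minus subsetD)
      also have "\<dots> \<in> loc_set K" using k by (intro mult) auto
      finally show "\<ominus>\<^bsub>L\<^esub> k \<in> loc_set K" .
    next
      fix k l assume "k \<in> loc_set K" "l \<in> loc_set K"
      then obtain a s b t where k: "a \<in> K" "s \<in> S" "k = frac_at R I a s"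
        and l: "b \<in> K" "t \<in> S" "l = frac_at R I b t"
        by (auto simp: loc_set_def)
      have "k \<oplus>\<^bsub>L\<^esub> l = frac_at R I (t \<otimes> a \<oplus> s \<otimes> b) (s \<otimes> t)"
        unfolding k l using localization_add_frac[of a s b t] k l K.Icarr by blast
      moreover have "t \<otimes> a \<oplus> s \<otimes> b \<in> K"
        using k l by (intro K.a_closed K.I_l_closed) auto
      moreover have "s \<otimes> t \<in> S" using k l by (intro S_mult)
      ultimately show "k \<oplus>\<^bsub>L\<^esub> l \<in> loc_set K" unfolding loc_set_def by blast
    qed
    show "x \<otimes>\<^bsub>L\<^esub> k \<in> loc_set K" if "k \<in> loc_set K" "x \<in> carrier L" for k x
      using that by (intro mult)
    show "k \<otimes>\<^bsub>L\<^esub> x \<in> loc_set K" if "k \<in> loc_set K" "x \<in> carrier L" for k x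
      using that(1) mult[OF that(2,1)] L.m_comm[of k x] that(2) sub by auto
  qed (rule L.ring_axioms)
qed

text \<open>For the inclusion from right to left, the generated ideal is pulled back along
  \<open>a \<mapsto> a/1\<close>. The preimage is an ideal of \<open>R\<close> containing
  \<open>B\<close>, hence contains \<open>Idl B\<close>, and
  \<open>k/s = (1/s)(k/1)\<close>.\<close>

lemma genideal_loc_set:
  assumes K: "B \<subseteq> carrier R"
  shows "genideal L ((\<lambda>a. frac_at R I a \<one>) ` B) = loc_set (Idl B)"
proof -
  interpret L: cring L by (rule localization_cring)
  let ?f = "\<lambda>a. frac_at R I a \<one>"
  let ?J = "genideal L (?f ` B)"
  have i: "ideal (Idl B) R" using K by (rule genideal_ideal)
  have fX: "?f ` B \<subseteq> carrier L" using K by (auto intro!: localization_frac_closed S_one)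
  interpret J: ideal ?J L using fX by (rule L.genideal_ideal)
  show ?thesis
  proof
    have "?f x \<in> loc_set (Idl B)" if "x \<in> B" for x
      using genideal_self[OF K] that S_one unfolding loc_set_def by blast
    then show "?J \<subseteq> loc_set (Idl B)"
      by (intro L.genideal_minimal ideal_loc_set i) auto
    let ?K = "{a \<in> carrier R. ?f a \<in> ?J}"
    have add: "?f (a \<oplus> b) = ?f a \<oplus>\<^bsub>L\<^esub> ?f b" if "a \<in> carrier R" "b \<in> carrier R" for a b
      using localization_add_frac[of a \<one> b \<one>] that S_one by simp
    have mult: "?f (a \<otimes> b) = ?f a \<otimes>\<^bsub>L\<^esub> ?f b" if "a \<in> carrier R" "b \<in> carrier R" for a b
      using localization_mult_frac[of a \<one> b \<one>] that S_one by simp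
    have lcl: "?f (x \<otimes> a) \<in> ?J" if "a \<in> ?K" "x \<in> carrier R" for a x
      using that mult J.I_l_closed S_one localization_frac_closed by auto
    have "ideal ?K R"
    proof (rule idealI)
      show "subgroup ?K (add_monoid R)"
      proof (rule add.subgroupI)
        have "?f \<zero> = \<zero>\<^bsub>L\<^esub>" by (simp add: localization_zero)
        then show "?K \<noteq> {}" using J.zero_closed by force
        show "\<ominus> a \<in> ?K" if "a \<in> ?K" for a
          using lcl[OF that, of "\<ominus> \<one>"] that by (simp add: l_minus)
        show "a \<oplus> b \<in> ?K" if "a \<in> ?K" "b \<in> ?K" for a b
          using that add J.a_closed by auto
      qed auto
      show "x \<otimes> a \<in> ?K" if "a \<in> ?K" "x \<in> carrier R" for a x
        using lcl[OF that] that by simp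
      show "a \<otimes> x \<in> ?K" if "a \<in> ?K" "x \<in> carrier R" for a x
        using lcl[OF that] that m_comm[of a x] by simp
    qed (rule ring_axioms)
    moreover have "B \<subseteq> ?K" using K L.genideal_self[OF fX] by auto
    ultimately have sub: "Idl B \<subseteq> ?K" by (rule genideal_minimal)
    show "loc_set (Idl B) \<subseteq> ?J"
    proof
      fix x assume "x \<in> loc_set (Idl B)"
      then obtain k s where k: "k \<in> Idl B" "s \<in> S" "x = frac_at R I k s"
        by (auto simp: loc_set_def)
      then have k': "k \<in> carrier R" "?f k \<in> ?J" using sub by auto
      have "frac_at R I \<one> s \<otimes>\<^bsub>L\<^esub> ?f k = frac_at R I (\<one> \<otimes> k) (s \<otimes> \<one>)"
        using k k' S_one by (intro localization_mult_frac) auto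
      then have "x = frac_at R I \<one> s \<otimes>\<^bsub>L\<^esub> ?f k" using k k' by simp
      then show "x \<in> ?J" using J.I_l_closed[OF k'(2)] localization_frac_closed k by simp
    qed
  qed
qed

text \<open>Flatness of the localization in elementwise form: the multiplier \<open>u\<close> is
  moved onto the numerator \<open>a\<close>, where regularity over \<open>R\<close> applies. The
  images may generate the unit ideal, so only weak regularity is claimed.\<close>

lemma weakly_regular_localization:
  assumes "weakly_regular xs"
  shows "cring.weakly_regular L (map (\<lambda>a. frac_at R I a \<one>) xs)"
proof -
  interpret L: cring L by (rule localization_cring)
  let ?f = "\<lambda>a. frac_at R I a \<one>"
  have xs: "set xs \<subseteq> carrier R" using assms by (simp add: weakly_regular_def)
  have "r \<in> genideal L (set (take i (map ?f xs)))"
    if i: "i < length xs" and r: "r \<in> carrier L"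
      and m: "map ?f xs ! i \<otimes>\<^bsub>L\<^esub> r \<in> genideal L (set (take i (map ?f xs)))" for i r
  proof -
    have X: "set (take i xs) \<subseteq> carrier R" using xs by (meson set_take_subset subset_trans)
    then have id: "ideal (Idl (set (take i xs))) R" by (rule genideal_ideal)
    have eq: "genideal L (set (take i (map ?f xs))) = loc_set (Idl (set (take i xs)))"
      using genideal_loc_set[OF X] by (simp add: take_map)
    obtain a s where a: "a \<in> carrier R" "s \<in> S" "r = frac_at R I a s"
      using r by (rule localization_carrierE)
    have x: "xs ! i \<in> carrier R" using xs i by auto
    then have "map ?f xs ! i \<otimes>\<^bsub>L\<^esub> r = frac_at R I (xs ! i \<otimes> a) (\<one> \<otimes> s)"
      using localization_mult_frac[OF x S_one a(1,2)] a i by simp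
    moreover have "\<one> \<otimes> s \<in> S" using a by simp
    ultimately obtain u where u: "u \<in> S" "u \<otimes> (xs ! i \<otimes> a) \<in> Idl (set (take i xs))"
      using m a x unfolding eq by (auto simp: frac_mem_loc_set_iff[OF id] simp del: l_one)
    have "u \<otimes> (xs ! i \<otimes> a) = xs ! i \<otimes> (u \<otimes> a)" using u a x by (simp add: m_ac)
    then have "u \<otimes> a \<in> Idl (set (take i xs))"
      using weakly_regular_nth[OF assms i] u a by auto
    then show ?thesis unfolding eq a(3) frac_mem_loc_set_iff[OF id a(1,2)] using u(1) by blast
  qed
  moreover have "set (map ?f xs) \<subseteq> carrier L"
    using xs by (auto intro!: localization_frac_closed S_one)
  ultimately show ?thesis unfolding L.weakly_regular_def by simp
qed

text \<open>The multiplier \<open>u\<close> of \<open>frac_mem_loc_set_iff\<close> disappears here: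
  \<open>u\<close> lies outside of \<open>I\<close>, hence outside of the prime
  \<open>K\<close>.\<close>

lemma primeideal_loc_set:
  assumes K: "primeideal K R" and KI: "K \<subseteq> I"
  shows "primeideal (loc_set K) L"
    and "\<And>a s. a \<in> carrier R \<Longrightarrow> s \<in> S \<Longrightarrow> frac_at R I a s \<in> loc_set K \<longleftrightarrow> a \<in> K"
proof -
  interpret K: primeideal K R by fact
  interpret L: cring L by (rule localization_cring)
  show iff: "frac_at R I a s \<in> loc_set K \<longleftrightarrow> a \<in> K" if "a \<in> carrier R" "s \<in> S" for a s
  proof -
    have "a \<in> K" if "u \<in> S" "u \<otimes> a \<in> K" for u
      using K.I_prime[of u a] that \<open>a \<in> carrier R\<close> KI by auto
    moreover have "\<one> \<otimes> a \<in> K" if "a \<in> K" using that K.Icarr by simp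
    ultimately show ?thesis
      unfolding frac_mem_loc_set_iff[OF K.is_ideal that] using S_one by blast
  qed
  show "primeideal (loc_set K) L"
  proof (rule primeidealI)
    show "ideal (loc_set K) L" by (intro ideal_loc_set K.is_ideal)
    show "cring L" by (rule localization_cring)
    have "frac_at R I \<one> \<one> \<in> carrier L" "frac_at R I \<one> \<one> \<notin> loc_set K"
      using iff[OF _ S_one, of \<one>] K.I_notcarr K.one_imp_carrier localization_frac_closed[OF _ S_one, of \<one>] by auto
    then show "carrier L \<noteq> loc_set K" by blast
  next
    fix x y assume x: "x \<in> carrier L" and y: "y \<in> carrier L" and xy: "x \<otimes>\<^bsub>L\<^esub> y \<in> loc_set K"
    obtain a s where x: "a \<in> carrier R" "s \<in> S" "x = frac_at R I a s"
      using x by (rule localization_carrierE)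
    obtain b t where y: "b \<in> carrier R" "t \<in> S" "y = frac_at R I b t"
      using y by (rule localization_carrierE)
    have "s \<otimes> t \<in> S" using x y by (intro S_mult)
    moreover have "x \<otimes>\<^bsub>L\<^esub> y = frac_at R I (a \<otimes> b) (s \<otimes> t)"
      unfolding x(3) y(3) by (rule localization_mult_frac[OF x(1,2) y(1,2)])
    ultimately have "a \<otimes> b \<in> K" using xy iff x y by simp
    then have "a \<in> K \<or> b \<in> K" using K.I_prime x y by blast
    then show "x \<in> loc_set K \<or> y \<in> loc_set K"
      using iff[OF x(1,2)] iff[OF y(1,2)] x(3) y(3) by blast
  qed
qed

text \<open>A fraction whose numerator lies outside of \<open>I\<close> is a unit.\<close>

lemma proper_ideal_localization:
  assumes M: "ideal M L" "M \<noteq> carrier L"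
  shows "M \<subseteq> loc_set I"
proof
  interpret M: ideal M L by fact
  fix x assume x: "x \<in> M"
  then have "x \<in> carrier L" by (rule M.Icarr)
  then obtain a s where a: "a \<in> carrier R" "s \<in> S" "x = frac_at R I a s"
    by (rule localization_carrierE)
  have "a \<in> I"
  proof (rule ccontr)
    assume "a \<notin> I"
    then have aS: "a \<in> S" using a by simp
    have "frac_at R I s a \<otimes>\<^bsub>L\<^esub> x = frac_at R I (s \<otimes> a) (a \<otimes> s)"
      unfolding a(3) using a aS by (intro localization_mult_frac) auto
    also have "\<dots> = \<one>\<^bsub>L\<^esub>"
      unfolding localization_one using a aS by (intro frac_at_eqI S_mult S_one) (auto simp: m_comm)
    finally have "\<one>\<^bsub>L\<^esub> \<in> M"
      using M.I_l_closed[OF x, of "frac_at R I s a"] localization_frac_closed aS a by simp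
    then show False using M.one_imp_carrier M(2) by simp
  qed
  then show "x \<in> loc_set I" using a unfolding loc_set_def by blast
qed

text \<open>A strict chain of primes that ends in \<open>I\<close> extends to a strict chain,
  because numerators detect membership. The inequality turns a large height into a large depth for
  Cohen-Macaulay rings.\<close>

lemma prime_height_le_krull_dim_localization: "prime_height R I \<le> krull_dim L"
  unfolding prime_height_def
proof (rule SUP_least)
  fix n
  assume "n \<in> {n. \<exists>C. (\<forall>i\<le>n. primeideal (C i) R) \<and> (\<forall>i<n. C i \<subset> C (Suc i)) \<and> C n = I}"
  then obtain C where C: "\<forall>i\<le>n. primeideal (C i) R" "\<forall>i<n. C i \<subset> C (Suc i)" "C n = I"
    by blast
  have mono: "C i \<subseteq> C j" if "i \<le> j" "j \<le> n" for i j
    using that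
  proof (induction j rule: dec_induct)
    case (step k)
    then show ?case using C(2) by (meson Suc_leD Suc_le_lessD psubsetE subset_trans)
  qed simp
  have CI: "C i \<subseteq> I" if "i \<le> n" for i using mono[OF that] C(3) by simp
  have "loc_set (C i) \<subset> loc_set (C (Suc i))" if i: "i < n" for i
  proof -
    obtain a where a: "a \<in> C (Suc i)" "a \<notin> C i" using C(2) i by blast
    interpret Cs: primeideal "C (Suc i)" R using C(1) i by simp
    have "a \<in> carrier R" using a Cs.Icarr by blast
    then have "frac_at R I a \<one> \<in> loc_set (C (Suc i))" "frac_at R I a \<one> \<notin> loc_set (C i)"
      using primeideal_loc_set(2)[of "C i" a \<one>] primeideal_loc_set(2)[of "C (Suc i)" a \<one>]
        a i C(1) CI S_one by auto
    moreover have "loc_set (C i) \<subseteq> loc_set (C (Suc i))"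
      using C(2) i unfolding loc_set_def by blast
    ultimately show ?thesis by blast
  qed
  moreover have "primeideal (loc_set (C i)) L" if "i \<le> n" for i
    using primeideal_loc_set(1) C(1) CI that by blast
  ultimately have "enat n \<le> prime_height L (loc_set (C n))"
    unfolding prime_height_def by (intro SUP_upper) (auto intro!: exI[of _ "\<lambda>i. loc_set (C i)"])
  also have "\<dots> \<le> krull_dim L"
    unfolding krull_dim_def using primeideal_loc_set(1)[of "C n"] C by (intro SUP_upper) auto
  finally show "enat n \<le> krull_dim L" .
qed

end

text \<open>If \<open>p\<close> had larger height, the Cohen-Macaulay local ring at \<open>p\<close>
  would have a regular sequence longer than \<open>as\<close> inside its maximal ideal. As
  \<open>p\<close> carries \<open>x\<close> into the ideal of \<open>as\<close>, Rees' theorem puts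
  \<open>x/1\<close> into the extended ideal. So an element outside of \<open>p\<close> carries
  \<open>x\<close> into the ideal too, against the description of \<open>p\<close> as a colon
  ideal.\<close>

lemma (in cring) cohen_macaulay_unmixed:
  assumes CM: "cohen_macaulay R" and p: "primeideal p R" and as: "weakly_regular as"
    and len: "length as \<le> 2" and x: "x \<in> carrier R" "x \<notin> Idl (set as)"
    and px: "\<And>r. r \<in> p \<longleftrightarrow> r \<in> carrier R \<and> r \<otimes> x \<in> Idl (set as)"
  shows "prime_height R p \<le> enat (length as)"
proof (rule ccontr)
  interpret p: primeideal p R by fact
  interpret L: cring p.L by (rule p.localization_cring)
  assume "\<not> prime_height R p \<le> enat (length as)"
  then have h: "enat (length as) < krull_dim p.L"
    using p.prime_height_le_krull_dim_localization by (meson not_le order_less_le_trans)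
  have "cohen_macaulay_local p.L" using CM p by (simp add: cohen_macaulay_def)
  then obtain M where M: "maximalideal M p.L" "depth p.L M = krull_dim p.L"
    unfolding cohen_macaulay_local_def local_ring_def by blast
  interpret M: maximalideal M p.L by fact
  have "\<exists>xs. regular_sequence p.L xs \<and> set xs \<subseteq> M \<and> length as < length xs"
    using h unfolding M(2)[symmetric] depth_def less_SUP_iff by auto
  then obtain xs where xs: "regular_sequence p.L xs" "set xs \<subseteq> M" "length as < length xs" by blast
  \<comment> \<open>Rees' theorem compares sequences whose lengths differ by exactly one, so the
    longer sequence is truncated.\<close>
  define bs where "bs = take (Suc (length as)) xs"
  have bs: "L.weakly_regular bs" "length bs = Suc (length as)" "set bs \<subseteq> M"
  proof -
    have "L.weakly_regular xs" using xs(1) by (simp add: regular_sequence_def L.weakly_regular_def)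
    then show "L.weakly_regular bs" unfolding bs_def by (rule L.weakly_regular_take)
    show "length bs = Suc (length as)" using xs(3) by (simp add: bs_def)
    show "set bs \<subseteq> M" using xs(2) set_take_subset unfolding bs_def by (metis subset_trans)
  qed
  let ?f = "\<lambda>a. frac_at R p a \<one>"
  have asc: "set as \<subseteq> carrier R" using as by (simp add: weakly_regular_def)
  have eq: "genideal p.L (set (map ?f as)) = p.loc_set (Idl (set as))"
    using p.genideal_loc_set[OF asc] by simp
  have id: "ideal (Idl (set as)) R" using asc by (rule genideal_ideal)
  have Mp: "M \<subseteq> p.loc_set p" by (rule p.proper_ideal_localization) (use M.is_ideal M.I_notcarr in auto)
  have "?f x \<in> genideal p.L (set (map ?f as))"
  proof (rule L.Rees)
    show "L.weakly_regular (map ?f as)" by (rule p.weakly_regular_localization[OF as])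
    show "L.weakly_regular bs" "length bs = Suc (length (map ?f as))" using bs by simp_all
    show "length (map ?f as) \<le> 2" using len by simp
    show "?f x \<in> carrier p.L" using x p.S_one by (intro p.localization_frac_closed)
    fix b assume "b \<in> set bs"
    then obtain a s where b: "a \<in> p" "s \<in> p.S" "b = frac_at R p a s"
      using bs(3) Mp unfolding p.loc_set_def by blast
    then have a: "a \<in> carrier R" "a \<otimes> x \<in> Idl (set as)" using px by auto
    have "b \<otimes>\<^bsub>p.L\<^esub> ?f x = frac_at R p (a \<otimes> x) (s \<otimes> \<one>)"
      unfolding b(3) using a b x p.S_one by (intro p.localization_mult_frac) auto
    moreover have "s \<otimes> \<one> \<in> p.S" using b by simp
    ultimately show "b \<otimes>\<^bsub>p.L\<^esub> ?f x \<in> genideal p.L (set (map ?f as))"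
      unfolding eq p.loc_set_def using a(2) by blast
  qed
  then obtain u where "u \<in> p.S" "u \<otimes> x \<in> Idl (set as)"
    unfolding eq p.frac_mem_loc_set_iff[OF id x(1) p.S_one] by blast
  then show False using px by auto
qed

subsection \<open>Maximal associated primes and prime avoidance\<close>

lemma (in noetherian_ring) exists_maximal_ideal_in_family:
  assumes "\<And>J. J \<in> \<F> \<Longrightarrow> ideal J R" and "J0 \<in> \<F>"
  obtains J where "J \<in> \<F>" "J0 \<subseteq> J" "\<And>J'. J' \<in> \<F> \<Longrightarrow> J \<subseteq> J' \<Longrightarrow> J' = J"
proof -
  let ?F = "{J \<in> \<F>. J0 \<subseteq> J}"
  have "\<exists>M\<in>?F. \<forall>J'\<in>?F. M \<subseteq> J' \<longrightarrow> J' = M"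
  proof (rule subset_Zorn_nonempty)
    show "?F \<noteq> {}" using assms(2) by blast
    fix \<C> assume C: "\<C> \<noteq> {}" "subset.chain ?F \<C>"
    then have "subset.chain {I. ideal I R} \<C>"
      using assms(1) unfolding pred_on.chain_def by auto
    then have "\<Union>\<C> \<in> \<C>" by (rule ideal_chain_is_trivial[OF C(1)])
    then show "\<Union>\<C> \<in> ?F" using C(2) unfolding pred_on.chain_def by auto
  qed
  then obtain M where "M \<in> ?F" and max: "\<forall>J'\<in>?F. M \<subseteq> J' \<longrightarrow> J' = M" ..
  then have M: "M \<in> \<F>" "J0 \<subseteq> M" by simp_all
  show thesis
    by (rule that[OF M]) (use max M(2) in auto)
qed

section \<open>Prime avoidance, colon ideals and maximal annihilators\<close>

context cring
begin

lemma primeideal_avoids_Inter: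
  assumes P: "primeideal P R" and "finite \<F>"
    and "\<And>J. J \<in> \<F> \<Longrightarrow> ideal J R" "\<And>J. J \<in> \<F> \<Longrightarrow> \<not> J \<subseteq> P"
  shows "\<exists>x\<in>carrier R. (\<forall>J\<in>\<F>. x \<in> J) \<and> x \<notin> P"
  using assms(2-)
proof (induction \<F> rule: finite_induct)
  case empty
  interpret P: primeideal P R by fact
  show ?case using P.I_notcarr P.Icarr by blast
next
  case (insert J \<F>)
  interpret P: primeideal P R by fact
  interpret J: ideal J R using insert.prems by blast
  obtain x where x: "x \<in> carrier R" "\<forall>J\<in>\<F>. x \<in> J" "x \<notin> P"
    using insert.IH insert.prems by blast
  obtain y where y: "y \<in> J" "y \<notin> P" using insert.prems(2)[of J] by blast
  have yc: "y \<in> carrier R" using y by (simp add: J.Icarr)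
  have "y \<otimes> x \<notin> P" using P.I_prime[OF yc x(1)] x y by blast
  moreover have "y \<otimes> x \<in> J" using J.I_r_closed[OF y(1) x(1)] .
  moreover have "y \<otimes> x \<in> J'" if "J' \<in> \<F>" for J'
    using ideal.I_l_closed[OF insert.prems(1)[of J'], of x y] that x yc by blast
  ultimately show ?case using x(1) yc by blast
qed

lemma prime_avoidance:
  assumes I: "ideal I R" and "finite \<F>"
    and "\<And>P. P \<in> \<F> \<Longrightarrow> primeideal P R" "\<And>P. P \<in> \<F> \<Longrightarrow> \<not> I \<subseteq> P"
  obtains a where "a \<in> I" "\<And>P. P \<in> \<F> \<Longrightarrow> a \<notin> P"
proof -
  interpret I: ideal I R by fact
  have "\<exists>a\<in>I. \<forall>P\<in>\<F>. a \<notin> P"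
    using assms(2-)
  proof (induction "card \<F>" arbitrary: \<F> rule: less_induct)
    case less
    note prime = less.prems(2)
    show ?case
    proof (cases "\<exists>P\<in>\<F>. \<exists>Q\<in>\<F>. P \<subset> Q")
      case True
      then obtain P Q where PQ: "P \<in> \<F>" "Q \<in> \<F>" "P \<subset> Q" by blast
      have "card (\<F> - {P}) < card \<F>" using PQ(1) less.prems(1) by (rule card_Diff1_less[rotated])
      then obtain a where "a \<in> I" "\<forall>P\<in>\<F> - {P}. a \<notin> P"
        using less.hyps[of "\<F> - {P}"] less.prems by auto
      then show ?thesis using PQ by (intro bexI[of _ a]) blast+
    next
      case antichain: False
      show ?thesis
      proof (cases "\<F> = {}")
        case True
        then show ?thesis using I.zero_closed by blast
      next
        case False
        then obtain Q where Q: "Q \<in> \<F>" by blast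
        interpret Q: primeideal Q R using Q prime by blast
        have "card (\<F> - {Q}) < card \<F>" using Q less.prems(1) by (rule card_Diff1_less[rotated])
        then obtain a where a: "a \<in> I" "\<forall>P\<in>\<F> - {Q}. a \<notin> P"
          using less.hyps[of "\<F> - {Q}"] less.prems by auto
        have ac: "a \<in> carrier R" using a by (simp add: I.Icarr)
        show ?thesis
        proof (cases "a \<in> Q")
          case False
          then show ?thesis using a by blast
        next
          case True
          obtain b where b: "b \<in> carrier R" "\<forall>J\<in>insert I (\<F> - {Q}). b \<in> J" "b \<notin> Q"
          proof -
            have "\<exists>x\<in>carrier R. (\<forall>J\<in>insert I (\<F> - {Q}). x \<in> J) \<and> x \<notin> Q"
            proof (rule primeideal_avoids_Inter)
              show "primeideal Q R" by (rule Q.primeideal)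
              show "finite (insert I (\<F> - {Q}))" using less.prems(1) by simp
              show "ideal J R" if "J \<in> insert I (\<F> - {Q})" for J
                using that I prime primeideal.axioms(1) by blast
              show "\<not> J \<subseteq> Q" if "J \<in> insert I (\<F> - {Q})" for J
                using that less.prems(3)[OF Q] antichain Q by blast
            qed
            then show thesis using that by blast
          qed
          have "a \<oplus> b \<in> I" using a b by (intro I.a_closed) auto
          moreover have "a \<oplus> b \<notin> Q"
          proof
            assume "a \<oplus> b \<in> Q"
            then have "(a \<oplus> b) \<ominus> a \<in> Q" using True by (rule Q.a_closed[OF _ Q.a_inv_closed, folded minus_eq])
            moreover have "(a \<oplus> b) \<ominus> a = b" using ac b(1) by algebra
            ultimately show False using b by simp
          qed
          moreover have "a \<oplus> b \<notin> P" if P: "P \<in> \<F> - {Q}" for P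
          proof
            interpret P: primeideal P R using P prime by blast
            assume "a \<oplus> b \<in> P"
            moreover have "b \<in> P" using b P by blast
            ultimately have "(a \<oplus> b) \<ominus> b \<in> P" by (rule P.a_closed[OF _ P.a_inv_closed, folded minus_eq])
            moreover have "(a \<oplus> b) \<ominus> b = a" using ac b(1) by algebra
            ultimately show False using a P by simp
          qed
          ultimately show ?thesis by blast
        qed
      qed
    qed
  qed
  then show thesis using that by blast
qed

text \<open>The colon ideal \<open>(K : x)\<close>, that is, the annihilator of \<open>x\<close> in
  \<open>R/K\<close>.\<close>

definition quotient_ideal :: "'a set \<Rightarrow> 'a \<Rightarrow> 'a set" where
  "quotient_ideal K x = {r \<in> carrier R. r \<otimes> x \<in> K}"

lemma ideal_quotient_ideal:
  assumes "ideal K R" "x \<in> carrier R"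
  shows "ideal (quotient_ideal K x) R"
proof -
  interpret K: ideal K R by fact
  show ?thesis
  proof (rule idealI)
    show "subgroup (quotient_ideal K x) (add_monoid R)"
    proof (rule add.subgroupI)
      show "quotient_ideal K x \<subseteq> carrier R" by (auto simp: quotient_ideal_def)
      have "\<zero> \<in> quotient_ideal K x" using assms by (simp add: quotient_ideal_def)
      then show "quotient_ideal K x \<noteq> {}" by blast
      show "\<ominus> a \<in> quotient_ideal K x" if "a \<in> quotient_ideal K x" for a
        using that assms by (simp add: quotient_ideal_def l_minus)
      show "a \<oplus> b \<in> quotient_ideal K x" if "a \<in> quotient_ideal K x" "b \<in> quotient_ideal K x" for a b
        using that assms by (simp add: quotient_ideal_def l_distr)
    qed
    show 1: "b \<otimes> a \<in> quotient_ideal K x" if "a \<in> quotient_ideal K x" "b \<in> carrier R" for a b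
      using that assms by (simp add: quotient_ideal_def m_assoc K.I_l_closed)
    show "a \<otimes> b \<in> quotient_ideal K x" if "a \<in> quotient_ideal K x" "b \<in> carrier R" for a b
      using 1[OF that] m_comm[of a b] that by (simp add: quotient_ideal_def)
  qed (rule ring_axioms)
qed

text \<open>The maximal ones among the annihilators of nonzero elements of \<open>R/K\<close>. In a
  noetherian ring these associated primes already cover the zero divisors on \<open>R/K\<close>,
  which is all that prime avoidance asks for.\<close>

definition assoc_max :: "'a set \<Rightarrow> 'a set set" where
  "assoc_max K = {P. \<exists>x\<in>carrier R - K. P = quotient_ideal K x \<and>
     (\<forall>y\<in>carrier R - K. P \<subseteq> quotient_ideal K y \<longrightarrow> quotient_ideal K y = P)}"

text \<open>If \<open>b \<notin> P = (K : x)\<close>, then \<open>b x \<notin> K\<close> and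
  \<open>(K : b x)\<close> contains \<open>P\<close>, so the two coincide by maximality; but
  \<open>a \<in> (K : b x)\<close> as soon as \<open>a b \<in> P\<close>.\<close>

lemma primeideal_assoc_max:
  assumes K: "ideal K R" and P: "P \<in> assoc_max K"
  shows "primeideal P R"
proof -
  interpret K: ideal K R by fact
  obtain x where x: "x \<in> carrier R" "x \<notin> K" and P: "P = quotient_ideal K x"
    and max: "\<And>y. y \<in> carrier R - K \<Longrightarrow> P \<subseteq> quotient_ideal K y \<Longrightarrow> quotient_ideal K y = P"
    using P by (auto simp: assoc_max_def)
  show ?thesis
  proof (rule primeidealI)
    show "ideal P R" unfolding P by (rule ideal_quotient_ideal[OF K x(1)])
    show "cring R" by (rule is_cring)
    have "\<one> \<notin> P" using x by (simp add: P quotient_ideal_def)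
    then show "carrier R \<noteq> P" by auto
    fix a b assume ab: "a \<in> carrier R" "b \<in> carrier R" "a \<otimes> b \<in> P"
    show "a \<in> P \<or> b \<in> P"
    proof (rule disjCI)
      assume b: "b \<notin> P"
      then have "b \<otimes> x \<in> carrier R - K" using x ab by (simp add: P quotient_ideal_def)
      moreover have "P \<subseteq> quotient_ideal K (b \<otimes> x)"
      proof
        fix r assume "r \<in> P"
        then have r: "r \<in> carrier R" "r \<otimes> x \<in> K" by (auto simp: P quotient_ideal_def)
        have "r \<otimes> (b \<otimes> x) = b \<otimes> (r \<otimes> x)" using r ab x by (simp add: m_ac)
        then show "r \<in> quotient_ideal K (b \<otimes> x)"
          using r ab K.I_l_closed by (simp add: quotient_ideal_def)
      qed
      ultimately have "quotient_ideal K (b \<otimes> x) = P" by (rule max)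
      moreover have "a \<in> quotient_ideal K (b \<otimes> x)"
        using ab x by (simp add: P quotient_ideal_def m_assoc)
      ultimately show "a \<in> P" by simp
    qed
  qed
qed

lemma assoc_max_covers:
  assumes "noetherian_ring R" and K: "ideal K R"
    and x: "x \<in> carrier R" "x \<notin> K" and a: "a \<in> carrier R" "a \<otimes> x \<in> K"
  obtains P where "P \<in> assoc_max K" "a \<in> P"
proof -
  interpret N: noetherian_ring R by fact
  let ?F = "quotient_ideal K ` (carrier R - K)"
  obtain P where P: "P \<in> ?F" "quotient_ideal K x \<subseteq> P"
      "\<And>J'. J' \<in> ?F \<Longrightarrow> P \<subseteq> J' \<Longrightarrow> J' = P"
    by (rule N.exists_maximal_ideal_in_family[of ?F "quotient_ideal K x"])
      (use x ideal_quotient_ideal[OF K] in auto)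
  have "a \<in> P" using P(2) a by (auto simp: quotient_ideal_def)
  moreover have "P \<in> assoc_max K" using P(1,3) unfolding assoc_max_def by blast
  ultimately show thesis by (rule that[rotated])
qed

text \<open>Choose \<open>x\<^sub>P\<close> with \<open>P = (K : x\<^sub>P)\<close>. If \<open>K\<close> and finitely many \<open>x\<^sub>Q\<close> generate an ideal containing
  all \<open>x\<^sub>P\<close>, then the intersection of these \<open>Q\<close> is contained in every \<open>P\<close>.\<close>
lemma finite_assoc_max:
  assumes "noetherian_ring R" and K: "ideal K R"
  shows "finite (assoc_max K)"
proof -
  interpret N: noetherian_ring R by fact
  interpret K: ideal K R by fact
  have "\<forall>P\<in>assoc_max K. \<exists>x. x \<in> carrier R - K \<and> P = quotient_ideal K x"
    unfolding assoc_max_def by blast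
  then obtain x where x: "\<And>P. P \<in> assoc_max K \<Longrightarrow> x P \<in> carrier R - K"
      "\<And>P. P \<in> assoc_max K \<Longrightarrow> P = quotient_ideal K (x P)"
    by metis
  have Kc: "K \<subseteq> carrier R" using K.Icarr by blast
  define gen where "gen F = Idl (K \<union> x ` F)" for F
  have c: "K \<union> x ` F \<subseteq> carrier R" if "F \<subseteq> assoc_max K" for F using that x(1) Kc by auto
  let ?F = "gen ` {F. finite F \<and> F \<subseteq> assoc_max K}"
  have 1: "\<And>J. J \<in> ?F \<Longrightarrow> ideal J R" using c unfolding gen_def by (auto intro!: genideal_ideal)
  have 2: "gen {} \<in> ?F" by auto
  obtain M where M: "M \<in> ?F" "\<And>J'. J' \<in> ?F \<Longrightarrow> M \<subseteq> J' \<Longrightarrow> J' = M"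
    by (rule N.exists_maximal_ideal_in_family[OF 1 2]) auto
  then obtain F where F: "finite F" "F \<subseteq> assoc_max K" "M = gen F" by blast
  have "P \<in> F" if P: "P \<in> assoc_max K" for P
  proof (rule ccontr)
    assume PF: "P \<notin> F"
    have "\<exists>r\<in>carrier R. (\<forall>Q\<in>F. r \<in> Q) \<and> r \<notin> P"
    proof (rule primeideal_avoids_Inter)
      show "primeideal P R" using primeideal_assoc_max[OF K P] .
      show "finite F" by fact
      show "ideal Q R" if "Q \<in> F" for Q
        using primeideal_assoc_max[OF K] that F(2) primeideal.axioms(1) by blast
      show "\<not> Q \<subseteq> P" if Q: "Q \<in> F" for Q
      proof
        assume "Q \<subseteq> P"
        moreover have "Q \<in> assoc_max K" using Q F(2) by blast
        \<comment> \<open>An inclusion between maximal annihilators is an equality.\<close>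
        ultimately have "P = Q" using x[OF P] unfolding assoc_max_def by blast
        then show False using PF Q by simp
      qed
    qed
    then obtain r where r: "r \<in> carrier R" "\<And>Q. Q \<in> F \<Longrightarrow> r \<in> Q" "r \<notin> P" by blast
    have "gen F \<subseteq> gen (insert P F)"
      using genideal_self[OF c, of "insert P F"] F P unfolding gen_def
      by (intro genideal_minimal genideal_ideal c) auto
    then have "gen (insert P F) = gen F"
      using M(2)[of "gen (insert P F)"] F P by auto
    moreover have "x P \<in> gen (insert P F)"
      using genideal_self[OF c, of "insert P F"] F P unfolding gen_def by auto
    moreover have "gen F \<subseteq> quotient_ideal K r"
      unfolding gen_def
    proof (intro genideal_minimal ideal_quotient_ideal[OF K r(1)] Un_least)
      show "K \<subseteq> quotient_ideal K r" using r Kc by (auto simp: quotient_ideal_def K.I_r_closed)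
      have "x Q \<otimes> r \<in> K" if "Q \<in> F" for Q
      proof -
        have Q: "Q \<in> assoc_max K" using that F(2) by blast
        have "r \<in> quotient_ideal K (x Q)" using r(2)[OF that] x(2)[OF Q] by simp
        then show ?thesis using x(1)[OF Q] r(1) m_comm[of r "x Q"] by (simp add: quotient_ideal_def)
      qed
      then show "x ` F \<subseteq> quotient_ideal K r" using x(1) F(2) by (auto simp: quotient_ideal_def)
    qed
    ultimately have "x P \<otimes> r \<in> K" by (auto simp: quotient_ideal_def)
    then have "r \<in> quotient_ideal K (x P)"
      using x(1)[OF P] r(1) m_comm[of r "x P"] by (simp add: quotient_ideal_def)
    then show False unfolding x(2)[OF P, symmetric] using r(3) by contradiction
  qed
  then have "assoc_max K \<subseteq> F" by (rule subsetI)
  then show ?thesis by (rule finite_subset[OF _ F(1)])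
qed

end

subsection \<open>Finite groups\<close>

context group
begin

lemma group_actionI:
  assumes closed: "\<And>g x. g \<in> carrier G \<Longrightarrow> x \<in> E \<Longrightarrow> act g x \<in> E"
    and mult: "\<And>g h x. g \<in> carrier G \<Longrightarrow> h \<in> carrier G \<Longrightarrow> x \<in> E \<Longrightarrow> act (g \<otimes> h) x = act g (act h x)"
    and one: "\<And>x. x \<in> E \<Longrightarrow> act \<one> x = x"
  shows "group_action G E (\<lambda>g. restrict (act g) E)"
proof -
  have bij: "bij_betw (act g) E E" if g: "g \<in> carrier G" for g
  proof (rule bij_betw_byWitness[where f' = "act (inv g)"])
    show "\<forall>x\<in>E. act (inv g) (act g x) = x" using mult[of "inv g" g] g one by auto
    show "\<forall>x\<in>E. act g (act (inv g) x) = x" using mult[of g "inv g"] g one by auto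
    show "act g ` E \<subseteq> E" using closed g by auto
    show "act (inv g) ` E \<subseteq> E" using closed g by auto
  qed
  have Bij: "restrict (act g) E \<in> Bij E" if "g \<in> carrier G" for g
    using bij[OF that] by (simp add: Bij_def bij_betw_restrict_eq)
  have "(\<lambda>g. restrict (act g) E) \<in> hom G (BijGroup E)"
  proof (rule homI)
    show "restrict (act g) E \<in> carrier (BijGroup E)" if "g \<in> carrier G" for g
      using Bij[OF that] by (simp add: BijGroup_def)
    show "restrict (act (g \<otimes> h)) E = restrict (act g) E \<otimes>\<^bsub>BijGroup E\<^esub> restrict (act h) E"
      if "g \<in> carrier G" "h \<in> carrier G" for g h
      using Bij that mult closed by (auto simp: BijGroup_def compose_def)
  qed
  then show ?thesis
    unfolding group_action_def group_hom_def group_hom_axioms_def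
    using group_BijGroup is_group by blast
qed

lemma card_subgroup_dvd:
  assumes "subgroup K G" "subgroup S G" "K \<subseteq> S"
  shows "card K dvd card S"
proof -
  interpret S: group "G\<lparr>carrier := S\<rparr>" by (rule subgroup_imp_group[OF assms(2)])
  have "card (rcosets\<^bsub>G\<lparr>carrier := S\<rparr>\<^esub> K) * card K = card S"
    using S.lagrange[OF subgroup_incl[OF assms]] by (simp add: order_def)
  then show ?thesis unfolding dvd_def by (simp add: mult.commute exI[of _ "card (rcosets\<^bsub>G\<lparr>carrier := S\<rparr>\<^esub> K)"])
qed

text \<open>The stabilizer of each point contains \<open>K\<close>, whose index is a power of
  \<open>p\<close>; hence an orbit with more than one point has length divisible by
  \<open>p\<close>. For trivial \<open>K\<close> this is the usual counting for
  \<open>p\<close>-groups.\<close>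

lemma prime_dvd_card_nonfixed:
  assumes "finite (carrier G)" "finite E" and p: "Factorial_Ring.prime (p::nat)"
    and K: "subgroup K G" "order G = p ^ n * card K"
    and closed: "\<And>g x. g \<in> carrier G \<Longrightarrow> x \<in> E \<Longrightarrow> act g x \<in> E"
    and mult: "\<And>g h x. g \<in> carrier G \<Longrightarrow> h \<in> carrier G \<Longrightarrow> x \<in> E \<Longrightarrow> act (g \<otimes> h) x = act g (act h x)"
    and triv: "\<And>k x. k \<in> K \<Longrightarrow> x \<in> E \<Longrightarrow> act k x = x"
  shows "p dvd card (E - {x \<in> E. \<forall>g\<in>carrier G. act g x = x})"
proof -
  let ?\<phi> = "\<lambda>g. restrict (act g) E"
  interpret act: group_action G E ?\<phi>
    using closed mult triv[OF subgroup.one_closed[OF K(1)]] by (rule group_actionI)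
  let ?F = "{x \<in> E. \<forall>g\<in>carrier G. act g x = x}"
  have Kpos: "card K > 0"
    using K(1) assms(1) by (metis card_gt_0_iff finite_subset subgroup.subset subgroup_nonempty)
  have dvd: "p dvd card (orbit G ?\<phi> x)" if x: "x \<in> E - ?F" for x
  proof -
    let ?S = "stabilizer G ?\<phi> x"
    have xE: "x \<in> E" using x by simp
    have sub: "subgroup ?S G" by (rule act.stabilizer_subgroup[OF xE])
    have "K \<subseteq> ?S" using triv xE subgroup.subset[OF K(1)] by (auto simp: stabilizer_def)
    then have "card K dvd card ?S" by (rule card_subgroup_dvd[OF K(1) sub])
    then obtain c where c: "card ?S = card K * c" by blast
    have "card (orbit G ?\<phi> x) * (card K * c) = p ^ n * card K"
      using act.orbit_stabilizer_theorem[OF xE] unfolding K(2) c .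
    then have "card (orbit G ?\<phi> x) * c = p ^ n" using Kpos by (simp add: mult.assoc mult.left_commute)
    then have "card (orbit G ?\<phi> x) dvd p ^ n" by (metis dvd_triv_left)
    then obtain i where i: "card (orbit G ?\<phi> x) = p ^ i"
      using divides_primepow_nat[OF p] by blast
    have "i \<noteq> 0"
    proof
      assume "i = 0"
      then obtain y where y: "orbit G ?\<phi> x = {y}" using i by (auto simp: card_1_singleton_iff)
      have "act g x = x" if "g \<in> carrier G" for g
      proof -
        have "act g x \<in> orbit G ?\<phi> x" using that xE by (auto simp: orbit_def)
        then show ?thesis using act.orbit_refl[OF xE] unfolding y by simp
      qed
      then show False using x by blast
    qed
    then show ?thesis using i by (simp add: dvd_power)
  qed
  have orb: "orbit G ?\<phi> x \<subseteq> E - ?F" if x: "x \<in> E - ?F" for x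
  proof
    fix y assume y: "y \<in> orbit G ?\<phi> x"
    then obtain g where g: "g \<in> carrier G" "y = act g x" using x by (auto simp: orbit_def)
    have "y \<in> E" using g x closed by simp
    moreover have "x = y" if "\<forall>g\<in>carrier G. act g y = y"
    proof -
      have "x = act (inv g) y"
        using mult[of "inv g" g x] g x triv[OF subgroup.one_closed[OF K(1)]] by simp
      then show ?thesis using that g by simp
    qed
    ultimately show "y \<in> E - ?F" using x by auto
  qed
  let ?C = "(\<lambda>x. orbit G ?\<phi> x) ` (E - ?F)"
  have U: "\<Union>?C = E - ?F"
    using orb act.orbit_refl by blast
  have "p dvd card (\<Union>?C)"
  proof (rule dvd_partition)
    show "finite (\<Union>?C)" unfolding U using assms(2) by simp
    show "\<forall>c\<in>?C. p dvd card c" using dvd by blast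
    show "\<forall>c1\<in>?C. \<forall>c2\<in>?C. c1 \<noteq> c2 \<longrightarrow> c1 \<inter> c2 = {}"
      using act.disjoint_union unfolding orbits_def by blast
  qed
  then show ?thesis unfolding U .
qed

section \<open>Left cosets and homomorphisms to the integers modulo \<open>p\<close>\<close>

lemma lcosetsE:
  assumes "C \<in> lcosets H"
  obtains g where "g \<in> carrier G" "C = g <# H"
  using assms unfolding LCOSETS_def by blast

lemma lcosetsI: "g \<in> carrier G \<Longrightarrow> g <# H \<in> lcosets H"
  unfolding LCOSETS_def by blast

lemma lcosets_lmult_closed:
  assumes "H \<subseteq> carrier G" "C \<in> lcosets H" "g \<in> carrier G"
  shows "g <# C \<in> lcosets H"
  using assms by (auto elim!: lcosetsE simp: lcos_m_assoc intro!: lcosetsI)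

lemma lcosets_subset: "H \<subseteq> carrier G \<Longrightarrow> C \<in> lcosets H \<Longrightarrow> C \<subseteq> carrier G"
  by (elim lcosetsE) (simp add: l_coset_subset_G)

lemma finite_lcosets: "finite (carrier G) \<Longrightarrow> finite (lcosets H)"
  unfolding LCOSETS_def by auto

text \<open>\<open>G\<close> acts on the functions \<open>G/H \<rightarrow> \<int>/p\<close> modulo constants, normalised by \<open>F(H) = 0\<close>. The fixed
  points are the homomorphisms \<open>G/H \<rightarrow> \<int>/p\<close>, and their number is divisible by \<open>p\<close>.\<close>
lemma exists_hom_mod_p:
  assumes fin: "finite (carrier G)" and p: "Factorial_Ring.prime (p::nat)"
    and H: "H \<lhd> G" "order G = p ^ n * card H" "H \<noteq> carrier G"
  obtains f :: "'a \<Rightarrow> int" where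
    "\<And>g h. g \<in> carrier G \<Longrightarrow> h \<in> carrier G \<Longrightarrow> f (g \<otimes> h) = (f g + f h) mod int p"
    "\<And>h. h \<in> H \<Longrightarrow> f h = 0" "\<And>g. g \<in> carrier G \<Longrightarrow> f g \<in> {0..<int p}"
    "\<exists>g\<in>carrier G. f g \<noteq> 0"
proof -
  interpret H: normal H G by fact
  have p1: "1 < int p" using p prime_gt_1_nat by auto
  note Hs = H.subset
  let ?X = "lcosets H"
  have HX: "H \<in> ?X" using lcosetsI[OF one_closed, of H] lcos_mult_one[OF Hs] by simp
  let ?B = "\<lambda>C. if C = H then {0} else {0..<int p}"
  define E where "E = PiE ?X ?B"
  \<comment> \<open>Subtracting the value at \<open>inv g <# H\<close> restores the normalisation
    after the translation.\<close>
  define act where "act g F = restrict (\<lambda>C. (F (inv g <# C) - F (inv g <# H)) mod int p) ?X" for g F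
  have EX: "F C mod int p = F C" "F H = 0" if "F \<in> E" "C \<in> ?X" for F C
  proof -
    have "F C \<in> ?B C" "F H \<in> ?B H"
      using PiE_mem[OF that(1)[unfolded E_def]] that(2) HX by blast+
    then show "F C mod int p = F C" "F H = 0" by (simp_all split: if_splits)
  qed
  have X: "inv g <# C \<in> ?X" if "g \<in> carrier G" "C \<in> ?X" for g C
    using that by (intro lcosets_lmult_closed Hs) auto
  have closed: "act g F \<in> E" if "g \<in> carrier G" "F \<in> E" for g F
    unfolding E_def using p1 by (intro PiE_I) (auto simp: act_def)
  have mult: "act (g \<otimes> h) F = act g (act h F)" if g: "g \<in> carrier G" and h: "h \<in> carrier G" and "F \<in> E" for g h F
  proof -
    have i: "inv (g \<otimes> h) <# C = inv h <# (inv g <# C)" if "C \<in> ?X" for C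
      using g h lcosets_subset[OF Hs that] by (simp add: inv_mult_group lcos_m_assoc)
    show ?thesis
      unfolding act_def using X[OF g] i HX by (auto simp: mod_simps)
  qed
  \<comment> \<open>Here the normality of \<open>H\<close> is used: left translation by
    \<open>H\<close> is trivial on \<open>G/H\<close>.\<close>
  have trivX: "inv k <# C = C" if k: "k \<in> H" and C: "C \<in> ?X" for k C
  proof -
    obtain g where g: "g \<in> carrier G" "C = g <# H" using C by (rule lcosetsE)
    have kc: "k \<in> carrier G" using k Hs by blast
    have "inv k \<in> H" using k by simp
    then have "inv g \<otimes> inv k \<otimes> g \<in> H" using H.inv_op_closed1[OF g(1)] by simp
    then have "(inv g \<otimes> inv k \<otimes> g) <# H = H" by (intro coset_join3) (use g kc H.is_subgroup in auto)
    then have "g <# ((inv g \<otimes> inv k \<otimes> g) <# H) = C" using g by simp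
    moreover have "g <# ((inv g \<otimes> inv k \<otimes> g) <# H) = (g \<otimes> (inv g \<otimes> inv k \<otimes> g)) <# H"
      using g kc Hs by (intro lcos_m_assoc) auto
    moreover have "g \<otimes> (inv g \<otimes> inv k \<otimes> g) = inv k \<otimes> g" using g kc by (simp add: m_assoc[symmetric])
    moreover have "(inv k \<otimes> g) <# H = inv k <# C" unfolding g(2) using g kc Hs by (simp add: lcos_m_assoc)
    ultimately show ?thesis by simp
  qed
  have triv: "act k F = F" if k: "k \<in> H" and F: "F \<in> E" for k F
  proof (rule extensionalityI[where A = ?X])
    show "act k F \<in> extensional ?X" by (simp add: act_def)
    show "F \<in> extensional ?X" using F unfolding E_def PiE_def by blast
    show "act k F C = F C" if "C \<in> ?X" for C
      using trivX[OF k that] trivX[OF k HX] EX[OF F that] that by (simp add: act_def)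
  qed
  have finE: "finite E" unfolding E_def using fin by (intro finite_PiE) (auto simp: finite_lcosets)
  let ?Fix = "{x \<in> E. \<forall>g\<in>carrier G. act g x = x}"
  have "p dvd card (E - ?Fix)"
    using fin finE p H.is_subgroup H(2) closed mult triv by (rule prime_dvd_card_nonfixed)
  \<comment> \<open>There is a coset other than \<open>H\<close>, and it contributes a factor
    \<open>p\<close> to the product.\<close>
  moreover have "p dvd card E"
  proof -
    obtain g where g: "g \<in> carrier G" "g \<notin> H" using H(3) Hs by blast
    have "g \<in> g <# H" by (rule lcos_self[OF g(1) H.is_subgroup])
    then have "g <# H \<noteq> H" using g by auto
    then have "p dvd card (?B (g <# H))" by simp
    also have "\<dots> dvd (\<Prod>C\<in>?X. card (?B C))"
      using fin g by (intro dvd_prodI) (auto simp: finite_lcosets intro: lcosetsI)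
    also have "\<dots> = card E" unfolding E_def using fin by (intro card_PiE[symmetric]) (simp add: finite_lcosets)
    finally show ?thesis .
  qed
  moreover have "card E = card (E - ?Fix) + card ?Fix"
    using finE card_Diff_subset[of ?Fix E] card_mono[of E ?Fix] by auto
  ultimately have pF: "p dvd card ?Fix" by (simp only: dvd_add_right_iff)
  define Z where "Z = restrict (\<lambda>C. 0 :: int) ?X"
  have "Z \<in> ?Fix" using p1 X HX by (auto simp: Z_def E_def act_def)
  \<comment> \<open>A single fixed point is impossible, as \<open>p\<close> divides their
    number.\<close>
  moreover have "?Fix \<noteq> {Z}" 
  proof
    assume "?Fix = {Z}"
    then have "p dvd 1" using pF by simp
    then show False using p1 by simp
  qed
  ultimately obtain F where F: "F \<in> E" "\<And>g. g \<in> carrier G \<Longrightarrow> act g F = F" "F \<noteq> Z" by blast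
  \<comment> \<open>Invariance of \<open>F\<close> under \<open>inv g\<close>, rewritten; for
    \<open>C = h <# H\<close> it is the homomorphism property.\<close>
  have rel: "F (g <# C) = (F C + F (g <# H)) mod int p" if g: "g \<in> carrier G" and C: "C \<in> ?X" for g C
  proof -
    have "F C = act (inv g) F C" using F(2) g by simp
    also have "\<dots> = (F (g <# C) - F (g <# H)) mod int p" using g C by (simp add: act_def)
    finally have "(F C + F (g <# H)) mod int p = F (g <# C) mod int p" by (simp add: mod_simps)
    then show ?thesis using EX(1)[OF F(1) lcosets_lmult_closed[OF Hs C g]] by simp
  qed
  show thesis
  proof (rule that[of "\<lambda>g. F (g <# H)"])
    show "F ((g \<otimes> h) <# H) = (F (g <# H) + F (h <# H)) mod int p"
      if "g \<in> carrier G" "h \<in> carrier G" for g h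
      using rel[OF that(1) lcosetsI[OF that(2), of H]] that Hs by (simp add: lcos_m_assoc add.commute)
    show "F (h <# H) = 0" if "h \<in> H" for h
      using coset_join3[of h H] that H.is_subgroup Hs EX(2)[OF F(1) HX] by auto
    show "F (g <# H) \<in> {0..<int p}" if "g \<in> carrier G" for g
      using EX(1)[OF F(1) lcosetsI[OF that]] p1
      by (metis atLeastLessThan_iff less_trans pos_mod_bound pos_mod_sign zero_less_one)
    show "\<exists>g\<in>carrier G. F (g <# H) \<noteq> 0"
    proof (rule ccontr)
      assume 0: "\<not> ?thesis"
      have "F = Z"
      proof (rule extensionalityI[where A = ?X])
        show "F \<in> extensional ?X" using F(1) unfolding E_def PiE_def by blast
        show "Z \<in> extensional ?X" by (simp add: Z_def)
        show "F C = Z C" if "C \<in> ?X" for C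
          using that 0 by (auto simp: Z_def elim: lcosetsE)
      qed
      then show False using F(3) by simp
    qed
  qed
qed

text \<open>For a prime \<open>l\<close> different from \<open>p\<close>, the elements of a Sylow
  \<open>l\<close>-subgroup are killed by a number prime to \<open>p\<close> and so lie in
  \<open>H\<close>. Hence \<open>l\<close> does not divide the index. The hypothesis speaks of
  exponents instead of orders so that it passes easily to subgroups.\<close>

lemma index_prime_power:
  assumes fin: "finite (carrier G)" and p: "Factorial_Ring.prime (p::nat)" and H: "subgroup H G"
    and reg: "\<And>g n. g \<in> carrier G \<Longrightarrow> g [^] (n::nat) = \<one> \<Longrightarrow> \<not> p dvd n \<Longrightarrow> g \<in> H"
  obtains n where "order G = p ^ n * card H"
proof -
  interpret H: subgroup H G by fact
  define i where "i = card (rcosets H)"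
  have i: "i * card H = order G" unfolding i_def using lagrange[OF H] .
  have pos: "order G > 0" using fin by (simp add: order_gt_0_iff_finite)
  have l: "l = p" if l: "Factorial_Ring.prime l" "l dvd i" for l :: nat
  proof (rule ccontr)
    assume "l \<noteq> p"
    define a where "a = multiplicity l (order G)"
    obtain m where m: "order G = l ^ a * m"
      using multiplicity_dvd[of l "order G"] unfolding a_def by blast
    obtain L where L: "subgroup L G" "card L = l ^ a"
      using sylow_thm[OF l(1) is_group m fin] by blast
    interpret L: subgroup L G by fact
    have "L \<subseteq> H"
    proof
      fix g assume g: "g \<in> L"
      interpret LG: group "G\<lparr>carrier := L\<rparr>" by (rule subgroup_imp_group[OF L(1)])
      have "g [^]\<^bsub>G\<lparr>carrier := L\<rparr>\<^esub> order (G\<lparr>carrier := L\<rparr>) = \<one>"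
        using LG.pow_order_eq_1[of g] g by simp
      then have "g [^] (l ^ a) = \<one>"
        using nat_pow_consistent[of g _ L] L(2) by (simp add: order_def)
      moreover have "\<not> p dvd l ^ a"
        using \<open>l \<noteq> p\<close> l(1) p by (metis prime_dvd_power primes_dvd_imp_eq)
      ultimately show "g \<in> H" using reg g L.subset by blast
    qed
    have "card L dvd card H" by (rule card_subgroup_dvd[OF L(1) H \<open>L \<subseteq> H\<close>])
    then have "l * l ^ a dvd i * card H" using l(2) L(2) by (simp add: mult_dvd_mono)
    then have "l ^ Suc a dvd order G" using i by simp
    then have "Suc a \<le> a"
      unfolding a_def using l(1) pos by (metis multiplicity_geI not_prime_unit neq0_conv)
    then show False by simp
  qed
  have "i \<noteq> 0" using i pos by (metis mult_is_0 neq0_conv)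
  then obtain j where j: "i = p ^ multiplicity p i * j" "\<not> p dvd j"
    using p by (metis multiplicity_decompose' not_prime_unit)
  have "j = 1"
  proof (rule ccontr)
    assume "j \<noteq> 1"
    then obtain l where "Factorial_Ring.prime l" "l dvd j" using prime_factor_nat by blast
    then show False using l[of l] j by (metis dvd_mult)
  qed
  then have "order G = p ^ multiplicity p i * card H" using i j by simp
  then show thesis by (rule that)
qed

text \<open>The index of \<open>M\<close> is a power of \<open>p\<close> by the assumption on
  exponents and prime to \<open>p\<close> by the inclusion of a Sylow subgroup.\<close>

lemma subgroup_eq_carrier_if_regular_and_sylow:
  assumes fin: "finite (carrier G)" and p: "Factorial_Ring.prime (p::nat)" and M: "subgroup M G"
    and reg: "\<And>g n. g \<in> carrier G \<Longrightarrow> g [^] (n::nat) = \<one> \<Longrightarrow> \<not> p dvd n \<Longrightarrow> g \<in> M"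
    and P: "sylow_subgroup p P G" "P \<subseteq> M"
  shows "M = carrier G"
proof -
  obtain n where n: "order G = p ^ n * card M"
    by (rule index_prime_power[OF fin p M]) (use reg in auto)
  have pos: "order G > 0" using fin by (simp add: order_gt_0_iff_finite)
  have "card P dvd card M"
    using P by (intro card_subgroup_dvd[OF _ M]) (simp_all add: sylow_subgroup_def)
  then have "p ^ n * p ^ multiplicity p (order G) dvd order G"
    using P(1) unfolding sylow_subgroup_def by (subst n) (simp add: mult_dvd_mono)
  then have "n + multiplicity p (order G) \<le> multiplicity p (order G)"
    using p pos by (metis multiplicity_geI not_prime_unit neq0_conv power_add)
  then have "card M = card (carrier G)" using n by (simp add: order_def)
  then show ?thesis using card_subset_eq[OF fin] subgroup.subset[OF M] by blast
qed

text \<open>The cyclic \<open>p\<close>-group generated by \<open>g\<close> acts on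
  \<open>G/P\<close>, whose cardinality is prime to \<open>p\<close>, and therefore fixes some coset
  \<open>x P\<close>.\<close>

lemma conj_into_sylow:
  assumes fin: "finite (carrier G)" and p: "Factorial_Ring.prime (p::nat)"
    and P: "sylow_subgroup p P G" and g: "g \<in> carrier G" "g [^] (p ^ k :: nat) = \<one>"
  obtains x where "x \<in> carrier G" "inv x \<otimes> g \<otimes> x \<in> P"
proof -
  have Psub: "subgroup P G" and Pcard: "card P = p ^ multiplicity p (order G)"
    using P by (simp_all add: sylow_subgroup_def)
  interpret P: subgroup P G by fact
  define U where "U = generate G {g}"
  have U: "subgroup U G" unfolding U_def using g by (intro generate_is_subgroup) auto
  interpret U: subgroup U G by fact
  interpret UG: group "G\<lparr>carrier := U\<rparr>" by (rule subgroup_imp_group[OF U])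
  have "card U = ord g" unfolding U_def using g(1) by (rule generate_pow_card[symmetric])
  moreover have "ord g dvd p ^ k" using g by (simp add: pow_eq_id)
  ultimately obtain n where n: "card U = p ^ n" using divides_primepow_nat[OF p] by auto
  let ?X = "lcosets P"
  have pos: "order G > 0" using fin by (simp add: order_gt_0_iff_finite)
  let ?F = "{x \<in> ?X. \<forall>g\<in>carrier (G\<lparr>carrier := U\<rparr>). g <# x = x}"
  have "p dvd card (?X - ?F)"
  proof (rule UG.prime_dvd_card_nonfixed)
    show "finite (carrier (G\<lparr>carrier := U\<rparr>))" using fin U.subset finite_subset by auto
    show "finite ?X" using fin by (rule finite_lcosets)
    show "Factorial_Ring.prime p" by fact
    show "subgroup {\<one>\<^bsub>G\<lparr>carrier := U\<rparr>\<^esub>} (G\<lparr>carrier := U\<rparr>)" by (rule UG.triv_subgroup)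
    show "order (G\<lparr>carrier := U\<rparr>) = p ^ n * card {\<one>\<^bsub>G\<lparr>carrier := U\<rparr>\<^esub>}" using n by (simp add: order_def)
    show "g <# x \<in> ?X" if "g \<in> carrier (G\<lparr>carrier := U\<rparr>)" "x \<in> ?X" for g x
      using that U.subset by (intro lcosets_lmult_closed P.subset) auto
    show "(g \<otimes>\<^bsub>G\<lparr>carrier := U\<rparr>\<^esub> h) <# x = g <# (h <# x)"
      if "g \<in> carrier (G\<lparr>carrier := U\<rparr>)" "h \<in> carrier (G\<lparr>carrier := U\<rparr>)" "x \<in> ?X" for g h x
      using that U.subset lcosets_subset[OF P.subset] by (auto simp: lcos_m_assoc)
    show "k <# x = x" if "k \<in> {\<one>\<^bsub>G\<lparr>carrier := U\<rparr>\<^esub>}" "x \<in> ?X" for k x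
      using that lcosets_subset[OF P.subset] by (auto simp: lcos_mult_one)
  qed
  moreover have "\<not> p dvd card ?X"
  proof
    assume "p dvd card ?X"
    then have "p * p ^ multiplicity p (order G) dvd card ?X * card P" unfolding Pcard by (rule mult_dvd_mono) simp
    moreover have "card ?X * card P = order G" using l_lagrange[OF fin Psub] .
    ultimately have "p ^ Suc (multiplicity p (order G)) dvd order G" by simp
    then have "Suc (multiplicity p (order G)) \<le> multiplicity p (order G)"
      using p pos by (metis multiplicity_geI not_prime_unit neq0_conv)
    then show False by simp
  qed
  ultimately have "?F \<noteq> {}" by (metis Diff_empty)
  then obtain C where C: "C \<in> ?X" "\<forall>g\<in>U. g <# C = C" by auto
  obtain x where x: "x \<in> carrier G" "C = x <# P" using C(1) by (rule lcosetsE)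
  have "g \<in> U" unfolding U_def by (rule generate.incl) simp
  then have "g <# (x <# P) = x <# P" using C(2) x by blast
  then have "(g \<otimes> x) <# P = x <# P" using g x P.subset by (simp add: lcos_m_assoc)
  moreover have "g \<otimes> x \<in> (g \<otimes> x) <# P" using g x Psub by (intro lcos_self) auto
  ultimately obtain q where q: "q \<in> P" "g \<otimes> x = x \<otimes> q" by (auto simp: l_coset_def)
  have "inv x \<otimes> g \<otimes> x = inv x \<otimes> (g \<otimes> x)" using g x by (simp add: m_assoc)
  also have "\<dots> = q" unfolding q(2) using x q P.subset by (simp add: m_assoc[symmetric] subsetD)
  finally show thesis using that[OF x(1)] q(1) by simp
qed

text \<open>Take \<open>g\<close> in \<open>T\<close> outside of \<open>H\<close>, of order
  \<open>q m\<close> with \<open>q\<close> a power of \<open>p\<close> and \<open>m\<close> prime to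
  \<open>p\<close>. The power \<open>g^q\<close> lies in \<open>H\<close> by \<open>reg\<close>. If
  \<open>g^m\<close> did as well, then so would \<open>g\<close>, since \<open>q\<close> and
  \<open>m\<close> are coprime.\<close>

lemma exists_p_element_notin:
  assumes fin: "finite (carrier G)" and p: "Factorial_Ring.prime (p::nat)" and H: "subgroup H G"
    and T: "subgroup T G" "\<not> T \<subseteq> H"
    and reg: "\<And>g n. g \<in> carrier G \<Longrightarrow> g [^] (n::nat) = \<one> \<Longrightarrow> \<not> p dvd n \<Longrightarrow> g \<in> H"
  obtains g k where "g \<in> T" "g \<notin> H" "g [^] (p ^ k :: nat) = \<one>"
proof -
  interpret H: subgroup H G by fact
  interpret T: subgroup T G by fact
  have pw: "g [^] (n::nat) \<in> S" if "subgroup S G" "g \<in> S" for g n S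
  proof -
    interpret S: subgroup S G by fact
    show ?thesis by (induction n) (use that S.subset in auto)
  qed
  obtain g where g: "g \<in> T" "g \<notin> H" using T(2) by blast
  then have gc: "g \<in> carrier G" using T.subset by blast
  have "ord g \<noteq> 0" using ord_ge_1[OF fin gc] by simp
  then obtain m where m: "ord g = p ^ multiplicity p (ord g) * m" "\<not> p dvd m"
    using p by (metis multiplicity_decompose' not_prime_unit)
  define q where "q = p ^ multiplicity p (ord g)"
  have "coprime p m" using p m(2) by (simp add: prime_imp_coprime)
  then have "gcd q m = 1" by (simp add: q_def)
  moreover have "q \<noteq> 0" using p by (simp add: q_def prime_gt_0_nat)
  ultimately obtain x y where xy: "q * x = m * y + 1" using bezout_nat[of q m] by auto
  have gq: "g [^] (q * m) = \<one>" using pow_ord_eq_1[OF gc] m(1) q_def by simp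
  show thesis
  proof (rule that)
    show "g [^] m \<in> T" using pw[OF T(1) g(1)] .
    show "(g [^] m) [^] (p ^ multiplicity p (ord g)) = \<one>"
      using gq gc by (simp add: nat_pow_pow q_def mult.commute)
    show "g [^] m \<notin> H"
    proof
      assume "g [^] m \<in> H"
      then have 1: "g [^] (m * y) \<in> H" using pw[OF H] gc by (simp add: nat_pow_pow[symmetric])
      have "g [^] q \<in> H" using reg[of "g [^] q" m] gc gq m(2) by (simp add: nat_pow_pow)
      then have 2: "g [^] (q * x) \<in> H" using pw[OF H] gc by (simp add: nat_pow_pow[symmetric])
      have "g [^] (q * x) = g [^] (m * y) \<otimes> g" unfolding xy using gc by simp
      then have "g = inv (g [^] (m * y)) \<otimes> g [^] (q * x)" using gc by (simp add: m_assoc[symmetric])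
      also have "\<dots> \<in> H" using 1 2 by simp
      finally show False using g by simp
    qed
  qed
qed

end

subsection \<open>Frobenius, the prime field, and independence of characters\<close>

context cring
begin

lemma add_pow_one_mult:
  assumes "x \<in> carrier R"
  shows "[(n::nat)] \<cdot> x = [n] \<cdot> \<one> \<otimes> x"
  using add_pow_ldistr[of \<one> x n] assms by simp

lemma binomial:
  assumes [simp]: "x \<in> carrier R" "y \<in> carrier R"
  shows "(x \<oplus> y) [^] (n::nat) = (\<Oplus>k\<in>{..n}. [(n choose k)] \<cdot> (x [^] k \<otimes> y [^] (n - k)))"
proof (induction n)
  case 0
  then show ?case by simp
next
  case (Suc n)
  let ?f = "\<lambda>k. [(n choose k)] \<cdot> (x [^] Suc k \<otimes> y [^] (n - k))"
  let ?g = "\<lambda>k. [(n choose k)] \<cdot> (x [^] k \<otimes> y [^] (Suc n - k))"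
  let ?h = "\<lambda>k. [(Suc n choose k)] \<cdot> (x [^] k \<otimes> y [^] (Suc n - k))"
  have sp: "x [^] Suc k \<otimes> y [^] l = x \<otimes> (x [^] k \<otimes> y [^] l)" for k l :: nat
    by (simp add: m_ac)
  have sp2: "x [^] k \<otimes> y [^] Suc l = y \<otimes> (x [^] k \<otimes> y [^] l)" for k l :: nat
    by (simp add: m_ac)
  have f: "x \<otimes> ([(n choose k)] \<cdot> (x [^] k \<otimes> y [^] (n - k))) = ?f k" for k
    unfolding sp by (simp add: add_pow_rdistr)
  have g: "y \<otimes> ([(n choose k)] \<cdot> (x [^] k \<otimes> y [^] (n - k))) = ?g k" if "k \<le> n" for k
    unfolding Suc_diff_le[OF that] sp2 by (simp add: add_pow_rdistr)
  have "(x \<oplus> y) [^] Suc n = (x \<oplus> y) \<otimes> (\<Oplus>k\<in>{..n}. [(n choose k)] \<cdot> (x [^] k \<otimes> y [^] (n - k)))"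
    using Suc by (simp add: m_comm)
  also have "\<dots> = x \<otimes> (\<Oplus>k\<in>{..n}. [(n choose k)] \<cdot> (x [^] k \<otimes> y [^] (n - k)))
      \<oplus> y \<otimes> (\<Oplus>k\<in>{..n}. [(n choose k)] \<cdot> (x [^] k \<otimes> y [^] (n - k)))"
    by (intro l_distr finsum_closed) auto
  also have "x \<otimes> (\<Oplus>k\<in>{..n}. [(n choose k)] \<cdot> (x [^] k \<otimes> y [^] (n - k))) = (\<Oplus>k\<in>{..n}. ?f k)"
    by (subst finsum_rdistr) (auto simp: f simp del: nat_pow_Suc intro!: finsum_cong')
  also have "y \<otimes> (\<Oplus>k\<in>{..n}. [(n choose k)] \<cdot> (x [^] k \<otimes> y [^] (n - k))) = (\<Oplus>k\<in>{..n}. ?g k)"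
    by (subst finsum_rdistr) (auto simp: g simp del: nat_pow_Suc intro!: finsum_cong')
  also have "(\<Oplus>k\<in>{..n}. ?g k) = (\<Oplus>k\<in>{..Suc n}. ?g k)"
    by (subst finsum_Suc) (auto simp: binomial_eq_0 intro!: l_zero[symmetric] finsum_closed)
  also have "\<dots> = (\<Oplus>k\<in>{..n}. ?g (Suc k)) \<oplus> ?g 0"
    by (rule finsum_Suc2) auto
  also have "(\<Oplus>k\<in>{..n}. ?f k) \<oplus> ((\<Oplus>k\<in>{..n}. ?g (Suc k)) \<oplus> ?g 0)
      = (\<Oplus>k\<in>{..n}. ?f k \<oplus> ?g (Suc k)) \<oplus> ?g 0"
    by (subst finsum_addf) (auto simp: a_assoc intro!: a_assoc[symmetric] finsum_closed)
  also have "(\<Oplus>k\<in>{..n}. ?f k \<oplus> ?g (Suc k)) = (\<Oplus>k\<in>{..n}. ?h (Suc k))"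
    by (intro finsum_cong') (auto simp: add.nat_pow_mult simp del: nat_pow_Suc)
  also have "?g 0 = ?h 0" by simp
  also have "(\<Oplus>k\<in>{..n}. ?h (Suc k)) \<oplus> ?h 0 = (\<Oplus>k\<in>{..Suc n}. ?h k)"
    by (rule finsum_Suc2[symmetric]) auto
  finally show ?case .
qed

lemma freshmans_dream:
  assumes p: "Factorial_Ring.prime (p::nat)" and char: "[p] \<cdot> \<one> = \<zero>"
    and [simp]: "x \<in> carrier R" "y \<in> carrier R"
  shows "(x \<oplus> y) [^] p = x [^] p \<oplus> y [^] p"
proof -
  obtain n where n: "p = Suc n" using p by (metis not0_implies_Suc not_prime_0)
  let ?f = "\<lambda>k. [(p choose k)] \<cdot> (x [^] k \<otimes> y [^] (p - k))"
  have 0: "?f k = \<zero>" if "0 < k" "k < p" for k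
  proof -
    have "p dvd (p choose k)" by (rule dvd_choose_prime) (use that p in auto)
    then obtain c where c: "p choose k = p * c" by (rule dvdE)
    have "[(p choose k)] \<cdot> \<one> = [c] \<cdot> ([p] \<cdot> \<one>)"
      unfolding c by (simp add: add.nat_pow_pow mult.commute)
    also have "\<dots> = \<zero>" unfolding char by simp
    finally show ?thesis by (subst add_pow_one_mult) simp_all
  qed
  have "(x \<oplus> y) [^] p = (\<Oplus>k\<in>{..Suc n}. ?f k)" using binomial[of x y p] n by simp
  also have "\<dots> = (\<Oplus>k\<in>{..n}. ?f (Suc k)) \<oplus> ?f 0" by (rule finsum_Suc2) auto
  also have "(\<Oplus>k\<in>{..n}. ?f (Suc k)) = (\<Oplus>k\<in>{..n}. if k = n then x [^] p else \<zero>)"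
  proof (intro finsum_cong')
    show "?f (Suc k) = (if k = n then x [^] p else \<zero>)" if "k \<in> {..n}" for k
      using 0[of "Suc k"] n that by (cases "k = n") (simp_all del: binomial_Suc_Suc nat_pow_Suc)
  qed auto
  also have "\<dots> = x [^] p" using add.finprod_singleton[of n "{..n}" "\<lambda>_. x [^] p"] by (simp add: eq_commute)
  finally show ?thesis by simp
qed

lemma frobenius_add:
  assumes p: "Factorial_Ring.prime (p::nat)" and char: "[p] \<cdot> \<one> = \<zero>"
    and [simp]: "x \<in> carrier R" "y \<in> carrier R"
  shows "(x \<oplus> y) [^] (p ^ a) = x [^] (p ^ a) \<oplus> y [^] (p ^ a)"
proof (induction a)
  case (Suc a)
  have "(x \<oplus> y) [^] (p ^ Suc a) = ((x \<oplus> y) [^] (p ^ a)) [^] p"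
    by (simp add: nat_pow_pow mult.commute)
  also have "\<dots> = (x [^] (p ^ a)) [^] p \<oplus> (y [^] (p ^ a)) [^] p"
    unfolding Suc by (rule freshmans_dream[OF p char]) simp_all
  finally show ?case by (simp add: nat_pow_pow mult.commute)
qed simp

lemma frobenius_finsum:
  assumes p: "Factorial_Ring.prime (p::nat)" and char: "[p] \<cdot> \<one> = \<zero>"
    and "finite A" and f: "f \<in> A \<rightarrow> carrier R"
  shows "(\<Oplus>i\<in>A. f i) [^] (p ^ a) = (\<Oplus>i\<in>A. f i [^] (p ^ a))"
  using assms(3) f
proof (induction A rule: finite_induct)
  case empty
  then show ?case using prime_gt_0_nat[OF p] by (simp add: nat_pow_zero)
next
  case (insert i A)
  then have [simp]: "f i \<in> carrier R" "f \<in> A \<rightarrow> carrier R" by auto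
  have "(\<Oplus>i\<in>insert i A. f i) [^] (p ^ a) = (f i \<oplus> (\<Oplus>i\<in>A. f i)) [^] (p ^ a)"
    using insert by (subst finsum_insert) auto
  also have "\<dots> = f i [^] (p ^ a) \<oplus> (\<Oplus>i\<in>A. f i [^] (p ^ a))"
    by (subst frobenius_add[OF p char]) (use insert in \<open>auto intro!: finsum_closed\<close>)
  also have "\<dots> = (\<Oplus>i\<in>insert i A. f i [^] (p ^ a))"
    using insert funcset_mem[OF \<open>f \<in> A \<rightarrow> carrier R\<close>] by (subst finsum_insert) auto
  finally show ?case .
qed

section \<open>The prime field inside \<open>R\<close>\<close>

lemma of_int_zero: "[(0::int)] \<cdot> \<one> = \<zero>"
  by (simp add: add_pow_int_ge)

context
  fixes p :: nat
  assumes p: "Factorial_Ring.prime p" and char: "[p] \<cdot> \<one> = \<zero>"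
begin

lemma of_int_add: "[(a + b :: int)] \<cdot> \<one> = [a] \<cdot> \<one> \<oplus> [b] \<cdot> \<one>"
  by (simp add: add.int_pow_mult)

lemma of_int_closed: "[(a :: int)] \<cdot> \<one> \<in> carrier R"
  by (rule add.int_pow_closed) simp

lemma of_int_mult: "[(a * b :: int)] \<cdot> \<one> = [a] \<cdot> \<one> \<otimes> [b] \<cdot> \<one>"
  using add_pow_ldistr_int[of \<one> "[b] \<cdot> \<one>" a] of_int_closed
  by (simp add: add.int_pow_pow mult.commute)

lemma of_int_char: "[(int p)] \<cdot> \<one> = \<zero>"
  using char by (simp add: add_pow_int_ge)

lemma of_int_mod: "[(a mod int p)] \<cdot> \<one> = [a] \<cdot> \<one>"
proof -
  have "[a] \<cdot> \<one> = [(a div int p * int p + a mod int p)] \<cdot> \<one>" by simp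
  also have "\<dots> = [(a div int p)] \<cdot> \<one> \<otimes> \<zero> \<oplus> [(a mod int p)] \<cdot> \<one>"
    unfolding of_int_add of_int_mult of_int_char ..
  finally show ?thesis using of_int_closed by simp
qed

lemma of_int_pow: "[((a::int) ^ n)] \<cdot> \<one> = ([a] \<cdot> \<one>) [^] n"
proof (induction n)
  case 0
  then show ?case by (simp add: add.int_pow_1)
next
  case (Suc n)
  have "[(a ^ Suc n)] \<cdot> \<one> = [a] \<cdot> \<one> \<otimes> [(a ^ n)] \<cdot> \<one>" by (simp add: of_int_mult)
  then show ?case using Suc of_int_closed by (simp add: m_comm)
qed

lemma of_int_fermat:
  assumes "\<not> int p dvd a"
  shows "([a] \<cdot> \<one>) [^] (p - 1) = \<one>"
proof -
  have "[nat (a mod int p) ^ (p - 1) = 1] (mod p)"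
    using fermat_theorem[OF p, of "nat (a mod int p)"] assms p
    by (metis dvd_imp_mod_0 int_dvd_int_iff mod_0_imp_dvd mod_mod_trivial of_nat_0_less_iff pos_mod_sign prime_gt_0_nat int_nat_eq)
  then have "[(a mod int p) ^ (p - 1) = 1] (mod int p)"
    using prime_gt_0_nat[OF p] by (simp add: cong_int_iff[symmetric])
  then have "(a mod int p) ^ (p - 1) mod int p = 1 mod int p" by (simp add: cong_def)
  then have "a ^ (p - 1) mod int p = 1 mod int p" by (simp add: power_mod)
  then have "[(a ^ (p - 1))] \<cdot> \<one> = [(1::int)] \<cdot> \<one>"
    using of_int_mod[of "a ^ (p - 1)"] of_int_mod[of 1] by simp
  then show ?thesis by (simp add: of_int_pow add.int_pow_1)
qed

text \<open>A nonzero element of the prime field is a unit by Fermat's theorem.\<close>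

lemma of_int_notin_prime:
  assumes "primeideal Q R" "\<not> int p dvd a"
  shows "[a] \<cdot> \<one> \<notin> Q"
proof
  interpret Q: primeideal Q R by fact
  assume a: "[a] \<cdot> \<one> \<in> Q"
  obtain n where n: "p - 1 = Suc n" using prime_gt_1_nat[OF p] by (metis Suc_diff_Suc Suc_eq_plus1 diff_is_0_eq' nat_less_le not0_implies_Suc zero_less_diff)
  have "([a] \<cdot> \<one>) [^] (p - 1) = ([a] \<cdot> \<one>) [^] n \<otimes> [a] \<cdot> \<one>" unfolding n by simp
  also have "\<dots> \<in> Q" using a of_int_closed by (intro Q.I_l_closed) auto
  finally show False using of_int_fermat[OF assms(2)] Q.one_imp_carrier Q.I_notcarr by simp
qed

end

end

text \<open>Evaluating the relation at \<open>w y\<close> and subtracting \<open>\<chi> j w\<close>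
  times its value at \<open>y\<close> eliminates \<open>\<chi> j\<close>. By induction the
  coefficients \<open>c i (\<chi> i w - \<chi> j w)\<close> vanish, and \<open>w\<close> may be
  chosen to separate \<open>i\<close> from \<open>j\<close>. The last coefficient is read off at
  \<open>\<one>\<close>.\<close>

lemma Dedekind_independence:
  assumes R: "ring R" and D: "domain D" and "finite A"
    and hom: "\<And>i. i \<in> A \<Longrightarrow> \<chi> i \<in> ring_hom R D"
    and dist: "\<And>i j. i \<in> A \<Longrightarrow> j \<in> A \<Longrightarrow> i \<noteq> j \<Longrightarrow> \<exists>w\<in>carrier R. \<chi> i w \<noteq> \<chi> j w"
    and c: "\<And>i. i \<in> A \<Longrightarrow> c i \<in> carrier D"
    and zero: "\<And>z. z \<in> carrier R \<Longrightarrow> (\<Oplus>\<^bsub>D\<^esub>i\<in>A. c i \<otimes>\<^bsub>D\<^esub> \<chi> i z) = \<zero>\<^bsub>D\<^esub>"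
  shows "\<forall>i\<in>A. c i = \<zero>\<^bsub>D\<^esub>"
  using assms(3-)
proof (induction A arbitrary: c rule: finite_induct)
  case (insert j A)
  interpret R: ring R by fact
  interpret D: domain D by fact
  note hom = insert.prems(1)
  have cl: "\<chi> i z \<in> carrier D" if "i \<in> insert j A" "z \<in> carrier R" for i z
    using ring_hom_closed[OF hom] that by blast
  have cc: "c i \<in> carrier D" if "i \<in> insert j A" for i using insert.prems(3) that by blast
  have z: "c j \<otimes>\<^bsub>D\<^esub> \<chi> j z \<oplus>\<^bsub>D\<^esub> (\<Oplus>\<^bsub>D\<^esub>i\<in>A. c i \<otimes>\<^bsub>D\<^esub> \<chi> i z) = \<zero>\<^bsub>D\<^esub>" if "z \<in> carrier R" for z
    using insert.prems(4)[OF that] insert.hyps cl cc that by (subst (asm) D.finsum_insert) auto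
  have "\<forall>i\<in>A. c i \<otimes>\<^bsub>D\<^esub> (\<chi> i w \<ominus>\<^bsub>D\<^esub> \<chi> j w) = \<zero>\<^bsub>D\<^esub>" if w: "w \<in> carrier R" for w
  proof (rule insert.IH)
    show "\<chi> i \<in> ring_hom R D" if "i \<in> A" for i using hom that by blast
    show "\<exists>w\<in>carrier R. \<chi> i w \<noteq> \<chi> k w" if "i \<in> A" "k \<in> A" "i \<noteq> k" for i k
      using insert.prems(2) that by blast
    show "c i \<otimes>\<^bsub>D\<^esub> (\<chi> i w \<ominus>\<^bsub>D\<^esub> \<chi> j w) \<in> carrier D" if "i \<in> A" for i
      using that cl cc w by simp
    fix y assume y: "y \<in> carrier R"
    let ?s = "\<lambda>z. \<Oplus>\<^bsub>D\<^esub>i\<in>A. c i \<otimes>\<^bsub>D\<^esub> \<chi> i z"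
    have wy: "w \<otimes>\<^bsub>R\<^esub> y \<in> carrier R" using w y by simp
    have cy: "?s z \<in> carrier D" if "z \<in> carrier R" for z
      using cl cc that by (intro D.finsum_closed) auto
    have eq: "c i \<otimes>\<^bsub>D\<^esub> (\<chi> i w \<ominus>\<^bsub>D\<^esub> \<chi> j w) \<otimes>\<^bsub>D\<^esub> \<chi> i y
        = c i \<otimes>\<^bsub>D\<^esub> \<chi> i (w \<otimes>\<^bsub>R\<^esub> y) \<oplus>\<^bsub>D\<^esub> (\<ominus>\<^bsub>D\<^esub> \<chi> j w) \<otimes>\<^bsub>D\<^esub> (c i \<otimes>\<^bsub>D\<^esub> \<chi> i y)" if i: "i \<in> A" for i
    proof -
      have c: "c i \<in> carrier D" "\<chi> i w \<in> carrier D" "\<chi> j w \<in> carrier D" "\<chi> i y \<in> carrier D"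
        using cl cc w y i by auto
      have m: "\<chi> i (w \<otimes>\<^bsub>R\<^esub> y) = \<chi> i w \<otimes>\<^bsub>D\<^esub> \<chi> i y"
        using ring_hom_mult[OF hom] i w y by blast
      show ?thesis unfolding m using c by algebra
    qed
    have "(\<Oplus>\<^bsub>D\<^esub>i\<in>A. c i \<otimes>\<^bsub>D\<^esub> (\<chi> i w \<ominus>\<^bsub>D\<^esub> \<chi> j w) \<otimes>\<^bsub>D\<^esub> \<chi> i y)
        = (\<Oplus>\<^bsub>D\<^esub>i\<in>A. c i \<otimes>\<^bsub>D\<^esub> \<chi> i (w \<otimes>\<^bsub>R\<^esub> y) \<oplus>\<^bsub>D\<^esub> (\<ominus>\<^bsub>D\<^esub> \<chi> j w) \<otimes>\<^bsub>D\<^esub> (c i \<otimes>\<^bsub>D\<^esub> \<chi> i y))"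
      using cl cc w y by (intro D.finsum_cong') (auto simp: eq)
    also have "\<dots> = ?s (w \<otimes>\<^bsub>R\<^esub> y) \<oplus>\<^bsub>D\<^esub> (\<Oplus>\<^bsub>D\<^esub>i\<in>A. (\<ominus>\<^bsub>D\<^esub> \<chi> j w) \<otimes>\<^bsub>D\<^esub> (c i \<otimes>\<^bsub>D\<^esub> \<chi> i y))"
      using cl cc w y wy by (intro D.finsum_addf) auto
    also have "(\<Oplus>\<^bsub>D\<^esub>i\<in>A. (\<ominus>\<^bsub>D\<^esub> \<chi> j w) \<otimes>\<^bsub>D\<^esub> (c i \<otimes>\<^bsub>D\<^esub> \<chi> i y)) = (\<ominus>\<^bsub>D\<^esub> \<chi> j w) \<otimes>\<^bsub>D\<^esub> ?s y"
      using cl cc w y insert.hyps by (intro D.finsum_rdistr[symmetric]) auto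
    also have "?s (w \<otimes>\<^bsub>R\<^esub> y) = \<ominus>\<^bsub>D\<^esub> (c j \<otimes>\<^bsub>D\<^esub> \<chi> j (w \<otimes>\<^bsub>R\<^esub> y))"
      using z[OF wy] cl[of j] cc[of j] wy cy by (intro D.sum_zero_eq_neg) (auto simp: D.a_comm)
    also have "?s y = \<ominus>\<^bsub>D\<^esub> (c j \<otimes>\<^bsub>D\<^esub> \<chi> j y)"
      using z[OF y] cl[of j] cc[of j] y cy by (intro D.sum_zero_eq_neg) (auto simp: D.a_comm)
    also have "\<chi> j (w \<otimes>\<^bsub>R\<^esub> y) = \<chi> j w \<otimes>\<^bsub>D\<^esub> \<chi> j y"
      using ring_hom_mult[OF hom] w y by blast
    also have "\<ominus>\<^bsub>D\<^esub> (c j \<otimes>\<^bsub>D\<^esub> (\<chi> j w \<otimes>\<^bsub>D\<^esub> \<chi> j y)) \<oplus>\<^bsub>D\<^esub> (\<ominus>\<^bsub>D\<^esub> \<chi> j w) \<otimes>\<^bsub>D\<^esub> (\<ominus>\<^bsub>D\<^esub> (c j \<otimes>\<^bsub>D\<^esub> \<chi> j y)) = \<zero>\<^bsub>D\<^esub>"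
    proof -
      have "c j \<in> carrier D" "\<chi> j w \<in> carrier D" "\<chi> j y \<in> carrier D" using cl cc w y by auto
      then show ?thesis by algebra
    qed
    finally show "(\<Oplus>\<^bsub>D\<^esub>i\<in>A. c i \<otimes>\<^bsub>D\<^esub> (\<chi> i w \<ominus>\<^bsub>D\<^esub> \<chi> j w) \<otimes>\<^bsub>D\<^esub> \<chi> i y) = \<zero>\<^bsub>D\<^esub>" .
  qed
  then have 0: "c i = \<zero>\<^bsub>D\<^esub>" if i: "i \<in> A" for i
  proof -
    obtain w where w: "w \<in> carrier R" "\<chi> i w \<noteq> \<chi> j w"
      using insert.prems(2)[of i j] i insert.hyps by blast
    have "c i \<otimes>\<^bsub>D\<^esub> (\<chi> i w \<ominus>\<^bsub>D\<^esub> \<chi> j w) = \<zero>\<^bsub>D\<^esub>"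
      using \<open>\<And>w. w \<in> carrier R \<Longrightarrow> \<forall>i\<in>A. c i \<otimes>\<^bsub>D\<^esub> (\<chi> i w \<ominus>\<^bsub>D\<^esub> \<chi> j w) = \<zero>\<^bsub>D\<^esub>\<close> w(1) i by blast
    moreover have "\<chi> i w \<ominus>\<^bsub>D\<^esub> \<chi> j w \<noteq> \<zero>\<^bsub>D\<^esub>" using w cl i by simp
    ultimately show ?thesis using D.integral[of "c i" "\<chi> i w \<ominus>\<^bsub>D\<^esub> \<chi> j w"] w cl cc i by auto
  qed
  have "(\<Oplus>\<^bsub>D\<^esub>i\<in>A. c i \<otimes>\<^bsub>D\<^esub> \<chi> i \<one>\<^bsub>R\<^esub>) = \<zero>\<^bsub>D\<^esub>"
    using 0 cl by (intro D.add.finprod_one_eqI) auto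
  moreover have "\<chi> j \<one>\<^bsub>R\<^esub> = \<one>\<^bsub>D\<^esub>" using ring_hom_one[OF hom] by blast
  ultimately have "c j = \<zero>\<^bsub>D\<^esub>" using z[of "\<one>\<^bsub>R\<^esub>"] cc by simp
  then show ?case using 0 by blast
qed simp

subsection \<open>Actions of finite groups on rings\<close>

locale finite_ring_action = ring_action G R \<phi>
  for G :: "('g, 'm) monoid_scheme" and R :: "('a, 'n) ring_scheme" (structure) and \<phi> :: "'g \<Rightarrow> 'a \<Rightarrow> 'a" +
  assumes finite_carrier: "finite (carrier G)"

sublocale finite_ring_action \<subseteq> grp: group G
  using group_hom group_hom.axioms(1) by blast

context finite_ring_action
begin

lemma act_closed [simp]: "g \<in> carrier G \<Longrightarrow> r \<in> carrier R \<Longrightarrow> \<phi> g r \<in> carrier R"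
  using element_image by blast

lemma act_comp: "g \<in> carrier G \<Longrightarrow> h \<in> carrier G \<Longrightarrow> r \<in> carrier R \<Longrightarrow> \<phi> (g \<otimes>\<^bsub>G\<^esub> h) r = \<phi> g (\<phi> h r)"
  using composition_rule by blast

lemma act_one_grp [simp]: "r \<in> carrier R \<Longrightarrow> \<phi> \<one>\<^bsub>G\<^esub> r = r"
  using id_eq_one by (metis restrict_apply')

lemma act_inv_act [simp]:
  "g \<in> carrier G \<Longrightarrow> r \<in> carrier R \<Longrightarrow> \<phi> (inv\<^bsub>G\<^esub> g) (\<phi> g r) = r"
  "g \<in> carrier G \<Longrightarrow> r \<in> carrier R \<Longrightarrow> \<phi> g (\<phi> (inv\<^bsub>G\<^esub> g) r) = r"
  by (simp_all flip: act_comp)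

lemma act_ring_hom_cring: "g \<in> carrier G \<Longrightarrow> ring_hom_cring R R (\<phi> g)"
  using action_ring_hom by (simp add: ring_hom_cring_def ring_hom_cring_axioms_def ring.is_cring)

lemma act_add [simp]: "g \<in> carrier G \<Longrightarrow> r \<in> carrier R \<Longrightarrow> s \<in> carrier R \<Longrightarrow> \<phi> g (r \<oplus> s) = \<phi> g r \<oplus> \<phi> g s"
  and act_mult [simp]: "g \<in> carrier G \<Longrightarrow> r \<in> carrier R \<Longrightarrow> s \<in> carrier R \<Longrightarrow> \<phi> g (r \<otimes> s) = \<phi> g r \<otimes> \<phi> g s"
  and act_one [simp]: "g \<in> carrier G \<Longrightarrow> \<phi> g \<one> = \<one>"
  using action_ring_hom by (auto simp: ring_hom_add ring_hom_mult ring_hom_one)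

lemma act_zero [simp]: "g \<in> carrier G \<Longrightarrow> \<phi> g \<zero> = \<zero>"
  using ring_hom_cring.hom_zero[OF act_ring_hom_cring] .

lemma act_neg [simp]: "g \<in> carrier G \<Longrightarrow> r \<in> carrier R \<Longrightarrow> \<phi> g (\<ominus> r) = \<ominus> \<phi> g r"
  using ring_hom_cring.hom_a_inv[OF act_ring_hom_cring] .

lemma act_minus [simp]: "g \<in> carrier G \<Longrightarrow> r \<in> carrier R \<Longrightarrow> s \<in> carrier R \<Longrightarrow> \<phi> g (r \<ominus> s) = \<phi> g r \<ominus> \<phi> g s"
  by (simp add: ring.minus_eq)

lemma act_pow [simp]: "g \<in> carrier G \<Longrightarrow> r \<in> carrier R \<Longrightarrow> \<phi> g (r [^] (n::nat)) = \<phi> g r [^] n"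
  by (induction n) auto

lemma act_finsum: "g \<in> carrier G \<Longrightarrow> f \<in> A \<rightarrow> carrier R \<Longrightarrow> \<phi> g (finsum R f A) = (\<Oplus>i\<in>A. \<phi> g (f i))"
  using ring_hom_cring.hom_finsum[OF act_ring_hom_cring, of g f A] by (simp add: comp_def)

lemma act_finprod: "g \<in> carrier G \<Longrightarrow> f \<in> A \<rightarrow> carrier R \<Longrightarrow> \<phi> g (finprod R f A) = (\<Otimes>i\<in>A. \<phi> g (f i))"
  using ring_hom_cring.hom_finprod[OF act_ring_hom_cring, of g f A] by (simp add: comp_def)

lemma act_of_nat: "g \<in> carrier G \<Longrightarrow> \<phi> g ([(n::nat)] \<cdot> \<one>) = [n] \<cdot> \<one>"
  by (induction n) auto

lemma act_of_int: "g \<in> carrier G \<Longrightarrow> \<phi> g ([(n::int)] \<cdot> \<one>) = [n] \<cdot> \<one>"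
  by (cases "n \<ge> 0") (auto simp: add_pow_int_ge add_pow_int_lt act_of_nat)

abbreviation "Fx \<equiv> fixed_points R \<phi>"

lemma FxI: "r \<in> carrier R \<Longrightarrow> (\<And>h. h \<in> N \<Longrightarrow> \<phi> h r = r) \<Longrightarrow> r \<in> Fx N"
  by (simp add: fixed_points_def)

lemma FxD: "r \<in> Fx N \<Longrightarrow> r \<in> carrier R" "r \<in> Fx N \<Longrightarrow> h \<in> N \<Longrightarrow> \<phi> h r = r"
  by (simp_all add: fixed_points_def)

lemma Fx_mono: "N \<subseteq> M \<Longrightarrow> Fx M \<subseteq> Fx N"
  by (auto simp: fixed_points_def)

context
  fixes N assumes N: "N \<subseteq> carrier G"
begin

lemma Fx_zero: "\<zero> \<in> Fx N" and Fx_one: "\<one> \<in> Fx N"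
  using N by (auto intro!: FxI)

lemma Fx_add: "r \<in> Fx N \<Longrightarrow> s \<in> Fx N \<Longrightarrow> r \<oplus> s \<in> Fx N"
  and Fx_mult: "r \<in> Fx N \<Longrightarrow> s \<in> Fx N \<Longrightarrow> r \<otimes> s \<in> Fx N"
  and Fx_minus: "r \<in> Fx N \<Longrightarrow> s \<in> Fx N \<Longrightarrow> r \<ominus> s \<in> Fx N"
  and Fx_neg: "r \<in> Fx N \<Longrightarrow> \<ominus> r \<in> Fx N"
  and Fx_pow: "r \<in> Fx N \<Longrightarrow> r [^] (n::nat) \<in> Fx N"
  using N by (auto simp: fixed_points_def subset_iff)

end

abbreviation "A \<equiv> fixed_ring R \<phi> (carrier G)"

lemma A_simps [simp]: "carrier A = Fx (carrier G)" "monoid.mult A = monoid.mult R" "ring.add A = ring.add R"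
  "monoid.one A = monoid.one R" "ring.zero A = ring.zero R"
  by (simp_all add: fixed_ring_def)

section \<open>Norms and translates of prime ideals\<close>

lemma reindex_left_mult:
  assumes "subgroup N G" "n \<in> N"
  shows "bij_betw (\<lambda>g. n \<otimes>\<^bsub>G\<^esub> g) N N"
proof -
  interpret N: subgroup N G by fact
  have c: "x \<in> carrier G" if "x \<in> N" for x using that N.subset by blast
  show ?thesis
    by (rule bij_betw_byWitness[where f' = "\<lambda>g. inv\<^bsub>G\<^esub> n \<otimes>\<^bsub>G\<^esub> g"])
      (use assms(2) c in \<open>auto simp: grp.m_assoc[symmetric]\<close>)
qed

definition norm_over :: "'g set \<Rightarrow> 'a \<Rightarrow> 'a" where
  "norm_over N r = (\<Otimes>g\<in>N. \<phi> g r)"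

lemma norm_over_Fx:
  assumes N: "subgroup N G" and r: "r \<in> carrier R"
  shows "norm_over N r \<in> Fx N"
proof -
  interpret N: subgroup N G by fact
  have c: "x \<in> carrier G" if "x \<in> N" for x using that N.subset by blast
  show ?thesis
  proof (rule FxI)
    show "norm_over N r \<in> carrier R" using r c by (auto simp: norm_over_def intro!: ring.finprod_closed)
    fix n assume n: "n \<in> N"
    have b: "bij_betw (\<lambda>g. n \<otimes>\<^bsub>G\<^esub> g) N N" by (rule reindex_left_mult[OF N n])
    have "\<phi> n (norm_over N r) = (\<Otimes>g\<in>N. \<phi> n (\<phi> g r))"
      unfolding norm_over_def using n c r by (intro act_finprod) auto
    also have "\<dots> = (\<Otimes>g\<in>N. \<phi> (n \<otimes>\<^bsub>G\<^esub> g) r)"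
      using n c r by (intro ring.finprod_cong') (auto simp: act_comp)
    also have "\<dots> = (\<Otimes>g\<in>(\<lambda>g. n \<otimes>\<^bsub>G\<^esub> g) ` N. \<phi> g r)"
      using b n c r by (intro ring.finprod_reindex[symmetric]) (auto simp: bij_betw_def)
    also have "\<dots> = norm_over N r" using b by (simp add: norm_over_def bij_betw_def)
    finally show "\<phi> n (norm_over N r) = norm_over N r" .
  qed
qed

lemma mem_image_iff:
  assumes "g \<in> carrier G" "Q \<subseteq> carrier R" "r \<in> carrier R"
  shows "r \<in> \<phi> g ` Q \<longleftrightarrow> \<phi> (inv\<^bsub>G\<^esub> g) r \<in> Q"
proof
  assume "r \<in> \<phi> g ` Q"
  then obtain s where "s \<in> Q" "r = \<phi> g s" by blast
  then show "\<phi> (inv\<^bsub>G\<^esub> g) r \<in> Q" using assms by (auto simp: subset_iff)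
next
  assume "\<phi> (inv\<^bsub>G\<^esub> g) r \<in> Q"
  moreover have "r = \<phi> g (\<phi> (inv\<^bsub>G\<^esub> g) r)" using assms by simp
  ultimately show "r \<in> \<phi> g ` Q" by blast
qed

lemma image_subset_carrier: "g \<in> carrier G \<Longrightarrow> Q \<subseteq> carrier R \<Longrightarrow> \<phi> g ` Q \<subseteq> carrier R"
  by auto

lemma primeideal_subset: "primeideal Q R \<Longrightarrow> Q \<subseteq> carrier R"
  by (rule additive_subgroup.a_subset[OF ideal.axioms(1)[OF primeideal.axioms(1)]])

lemma primeideal_image:
  assumes g: "g \<in> carrier G" and Q: "primeideal Q R"
  shows "primeideal (\<phi> g ` Q) R"
proof -
  interpret Q: primeideal Q R by fact
  have Qc: "Q \<subseteq> carrier R" by (rule primeideal_subset[OF Q])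
  have ic: "\<phi> g ` Q \<subseteq> carrier R" by (rule image_subset_carrier[OF g Qc])
  note iff = mem_image_iff[OF g Qc]
  show ?thesis
  proof (rule primeidealI)
    show "ideal (\<phi> g ` Q) R"
    proof (rule idealI)
      show "subgroup (\<phi> g ` Q) (add_monoid R)"
      proof (rule ring.add.subgroupI)
        show "\<phi> g ` Q \<subseteq> carrier R" by (rule ic)
        show "\<phi> g ` Q \<noteq> {}" using Q.zero_closed by blast
        show "\<ominus> a \<in> \<phi> g ` Q" if "a \<in> \<phi> g ` Q" for a
        proof -
          have "a \<in> carrier R" using that ic by blast
          then show ?thesis using that iff g by simp
        qed
        show "a \<oplus> b \<in> \<phi> g ` Q" if "a \<in> \<phi> g ` Q" "b \<in> \<phi> g ` Q" for a b
        proof -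
          have "a \<in> carrier R" "b \<in> carrier R" using that ic by blast+
          then show ?thesis using that iff g by simp
        qed
      qed
      show 1: "x \<otimes> a \<in> \<phi> g ` Q" if "a \<in> \<phi> g ` Q" "x \<in> carrier R" for a x
      proof -
        have "a \<in> carrier R" using that ic by blast
        then show ?thesis using that iff g by (simp add: Q.I_l_closed)
      qed
      show "a \<otimes> x \<in> \<phi> g ` Q" if "a \<in> \<phi> g ` Q" "x \<in> carrier R" for a x
      proof -
        have "a \<in> carrier R" using that ic by blast
        then show ?thesis using 1[OF that] ring.m_comm[of a x] that by simp
      qed
    qed (rule ring.ring_axioms)
    show "cring R" by (rule ring.is_cring)
    have "\<one> \<notin> \<phi> g ` Q" using iff[of \<one>] g Q.one_imp_carrier Q.I_notcarr by auto
    then show "carrier R \<noteq> \<phi> g ` Q" by auto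
    show "a \<in> \<phi> g ` Q \<or> b \<in> \<phi> g ` Q"
      if "a \<in> carrier R" "b \<in> carrier R" "a \<otimes> b \<in> \<phi> g ` Q" for a b
      using that iff g Q.I_prime[of "\<phi> (inv\<^bsub>G\<^esub> g) a" "\<phi> (inv\<^bsub>G\<^esub> g) b"] by simp
  qed
qed

lemma prime_height_le_image:
  assumes g: "g \<in> carrier G"
  shows "prime_height R Q \<le> prime_height R (\<phi> g ` Q)"
  unfolding prime_height_def
proof (rule SUP_subset_mono)
  show "{n. \<exists>C. (\<forall>i\<le>n. primeideal (C i) R) \<and> (\<forall>i<n. C i \<subset> C (Suc i)) \<and> C n = Q}
    \<subseteq> {n. \<exists>C. (\<forall>i\<le>n. primeideal (C i) R) \<and> (\<forall>i<n. C i \<subset> C (Suc i)) \<and> C n = \<phi> g ` Q}"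
  proof
    fix n assume "n \<in> {n. \<exists>C. (\<forall>i\<le>n. primeideal (C i) R) \<and> (\<forall>i<n. C i \<subset> C (Suc i)) \<and> C n = Q}"
    then obtain C where C: "\<forall>i\<le>n. primeideal (C i) R" "\<forall>i<n. C i \<subset> C (Suc i)" "C n = Q" by blast
    have "\<phi> g ` C i \<subset> \<phi> g ` C (Suc i)" if "i < n" for i
    proof -
      have "C i \<subseteq> carrier R" "C (Suc i) \<subseteq> carrier R" using C(1) that by (simp_all add: primeideal_subset)
      then show ?thesis
        using C(2) that inj_on_image_eq_iff[OF inj_prop[OF g], of "C i" "C (Suc i)"] by (simp add: psubset_eq image_mono)
    qed
    then show "n \<in> {n. \<exists>C. (\<forall>i\<le>n. primeideal (C i) R) \<and> (\<forall>i<n. C i \<subset> C (Suc i)) \<and> C n = \<phi> g ` Q}"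
      using C primeideal_image[OF g] by (intro CollectI exI[of _ "\<lambda>i. \<phi> g ` C i"]) auto
  qed
qed simp

lemma image_inv_image:
  assumes "g \<in> carrier G" "Q \<subseteq> carrier R"
  shows "\<phi> (inv\<^bsub>G\<^esub> g) ` \<phi> g ` Q = Q"
  using assms by (force simp: image_image subset_iff)

lemma prime_height_image:
  assumes g: "g \<in> carrier G" and Q: "Q \<subseteq> carrier R"
  shows "prime_height R (\<phi> g ` Q) = prime_height R Q"
  using prime_height_le_image[OF g, of Q] prime_height_le_image[of "inv\<^bsub>G\<^esub> g" "\<phi> g ` Q"]
    image_inv_image[OF assms] g by simp

section \<open>Inertia groups and bireflections\<close>

definition inertia :: "'a set \<Rightarrow> 'g set" where
  "inertia Q = {g \<in> carrier G. \<forall>r\<in>carrier R. \<phi> g r \<ominus> r \<in> Q}"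

lemma inertiaD:
  "g \<in> inertia Q \<Longrightarrow> g \<in> carrier G"
  "g \<in> inertia Q \<Longrightarrow> r \<in> carrier R \<Longrightarrow> \<phi> g r \<ominus> r \<in> Q"
  by (simp_all add: inertia_def)

lemma subgroup_inertia:
  assumes Q: "ideal Q R"
  shows "subgroup (inertia Q) G"
proof -
  interpret Q: ideal Q R by fact
  show ?thesis
  proof (rule grp.subgroupI)
    show "inertia Q \<subseteq> carrier G" by (auto simp: inertia_def)
    have "\<one>\<^bsub>G\<^esub> \<in> inertia Q" by (auto simp: inertia_def ring.minus_eq ring.r_neg)
    then show "inertia Q \<noteq> {}" by blast
    show "inv\<^bsub>G\<^esub> g \<in> inertia Q" if g: "g \<in> inertia Q" for g
    proof -
      have "\<phi> (inv\<^bsub>G\<^esub> g) r \<ominus> r \<in> Q" if r: "r \<in> carrier R" for r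
      proof -
        have gc: "g \<in> carrier G" by (rule inertiaD(1)[OF g])
        have "r \<ominus> \<phi> (inv\<^bsub>G\<^esub> g) r \<in> Q"
          using inertiaD(2)[OF g, of "\<phi> (inv\<^bsub>G\<^esub> g) r"] gc r by simp
        then have "\<ominus> (r \<ominus> \<phi> (inv\<^bsub>G\<^esub> g) r) \<in> Q" by (rule Q.a_inv_closed)
        moreover have "\<ominus> (r \<ominus> \<phi> (inv\<^bsub>G\<^esub> g) r) = \<phi> (inv\<^bsub>G\<^esub> g) r \<ominus> r"
          using gc r by (simp add: ring.minus_eq ring.minus_add ring.a_comm)
        ultimately show ?thesis by simp
      qed
      then show ?thesis using g by (simp add: inertia_def)
    qed
    show "g \<otimes>\<^bsub>G\<^esub> h \<in> inertia Q" if gh: "g \<in> inertia Q" "h \<in> inertia Q" for g h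
    proof -
      have "\<phi> (g \<otimes>\<^bsub>G\<^esub> h) r \<ominus> r \<in> Q" if r: "r \<in> carrier R" for r
      proof -
        have c: "g \<in> carrier G" "h \<in> carrier G" using gh by (simp_all add: inertia_def)
        have "(\<phi> g (\<phi> h r) \<ominus> \<phi> h r) \<oplus> (\<phi> h r \<ominus> r) \<in> Q"
          using gh r c by (intro Q.a_closed) (auto simp: inertia_def)
        moreover have "(x \<ominus> y) \<oplus> (y \<ominus> r) = x \<ominus> r" if "x \<in> carrier R" "y \<in> carrier R" for x y
          using that r by (simp add: ring.minus_eq ring.a_assoc ring.r_neg1)
        ultimately show ?thesis using r c by (simp add: act_comp)
      qed
      then show ?thesis using gh by (simp add: inertia_def)
    qed
  qed
qed

text \<open>The bridge between bireflections and inertia. The cyclic group may be replaced by its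
  generator because the inertia group is a subgroup.\<close>

lemma moving_ideal_subset_iff:
  assumes Q: "ideal Q R" and g: "g \<in> carrier G"
  shows "moving_ideal R \<phi> (generate G {g}) \<subseteq> Q \<longleftrightarrow> g \<in> inertia Q"
proof -
  interpret Q: ideal Q R by fact
  have gen: "generate G {g} \<subseteq> carrier G" using g by (intro grp.generate_incl) simp
  let ?X = "{\<phi> h r \<ominus> r |h r. h \<in> generate G {g} \<and> r \<in> carrier R}"
  have X: "?X \<subseteq> carrier R" using gen by auto
  have "moving_ideal R \<phi> (generate G {g}) \<subseteq> Q \<longleftrightarrow> ?X \<subseteq> Q"
    unfolding moving_ideal_def using ring.Idl_subset_ideal[OF Q X] .
  also have "\<dots> \<longleftrightarrow> generate G {g} \<subseteq> inertia Q"
    using gen by (auto simp: inertia_def)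
  also have "\<dots> \<longleftrightarrow> g \<in> inertia Q"
  proof
    assume "generate G {g} \<subseteq> inertia Q"
    moreover have "g \<in> generate G {g}" by (rule generate.incl) simp
    ultimately show "g \<in> inertia Q" by blast
  next
    assume "g \<in> inertia Q"
    then show "generate G {g} \<subseteq> inertia Q"
      by (intro grp.generate_subgroup_incl subgroup_inertia[OF Q]) simp
  qed
  finally show ?thesis .
qed

lemma inertia_image:
  assumes Q: "Q \<subseteq> carrier R" and x: "x \<in> carrier G" and g: "g \<in> inertia Q"
  shows "x \<otimes>\<^bsub>G\<^esub> g \<otimes>\<^bsub>G\<^esub> inv\<^bsub>G\<^esub> x \<in> inertia (\<phi> x ` Q)"
proof -
  have gc: "g \<in> carrier G" using g by (simp add: inertia_def)
  have "\<phi> (x \<otimes>\<^bsub>G\<^esub> g \<otimes>\<^bsub>G\<^esub> inv\<^bsub>G\<^esub> x) r \<ominus> r \<in> \<phi> x ` Q" if r: "r \<in> carrier R" for r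
  proof -
    have "\<phi> g (\<phi> (inv\<^bsub>G\<^esub> x) r) \<ominus> \<phi> (inv\<^bsub>G\<^esub> x) r \<in> Q" using g r x by (auto simp: inertia_def)
    then have "\<phi> x (\<phi> g (\<phi> (inv\<^bsub>G\<^esub> x) r) \<ominus> \<phi> (inv\<^bsub>G\<^esub> x) r) \<in> \<phi> x ` Q" by blast
    moreover have "\<phi> x (\<phi> g (\<phi> (inv\<^bsub>G\<^esub> x) r) \<ominus> \<phi> (inv\<^bsub>G\<^esub> x) r)
        = \<phi> (x \<otimes>\<^bsub>G\<^esub> g \<otimes>\<^bsub>G\<^esub> inv\<^bsub>G\<^esub> x) r \<ominus> r"
      using x gc r by (simp add: act_comp)
    ultimately show ?thesis by simp
  qed
  then show ?thesis using x gc by (simp add: inertia_def)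
qed

lemma prime_height_gt_if_not_bireflection:
  assumes Q: "primeideal Q R" and g: "g \<in> inertia Q" "\<not> bireflection G R \<phi> g"
  shows "2 < prime_height R Q"
proof -
  have gc: "g \<in> carrier G" using g(1) by (simp add: inertia_def)
  have "moving_ideal R \<phi> (generate G {g}) \<subseteq> Q"
    using moving_ideal_subset_iff[OF primeideal.axioms(1)[OF Q] gc] g(1) by simp
  then have "height R (moving_ideal R \<phi> (generate G {g})) \<le> prime_height R Q"
    unfolding height_def using Q by (intro INF_lower) simp
  moreover have "2 < height R (moving_ideal R \<phi> (generate G {g}))"
    using g(2) gc by (simp add: bireflection_def not_le)
  ultimately show ?thesis by simp
qed

text \<open>Translation by \<open>x\<close> preserves heights and takes primes over the moving ideal
  of \<open>g\<close> to primes over that of the conjugate.\<close>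

lemma bireflection_conj:
  assumes b: "bireflection G R \<phi> g" and x: "x \<in> carrier G"
  shows "bireflection G R \<phi> (x \<otimes>\<^bsub>G\<^esub> g \<otimes>\<^bsub>G\<^esub> inv\<^bsub>G\<^esub> x)"
proof -
  let ?h = "x \<otimes>\<^bsub>G\<^esub> g \<otimes>\<^bsub>G\<^esub> inv\<^bsub>G\<^esub> x"
  have g: "g \<in> carrier G" using b by (simp add: bireflection_def)
  have h: "?h \<in> carrier G" using g x by simp
  have "height R (moving_ideal R \<phi> (generate G {?h})) \<le> height R (moving_ideal R \<phi> (generate G {g}))"
    unfolding height_def[of R "moving_ideal R \<phi> (generate G {g})"]
  proof (rule INF_greatest)
    fix Q assume "Q \<in> {P. primeideal P R \<and> moving_ideal R \<phi> (generate G {g}) \<subseteq> P}"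
    then have Q: "primeideal Q R" "moving_ideal R \<phi> (generate G {g}) \<subseteq> Q" by simp_all
    have Qc: "Q \<subseteq> carrier R" by (rule primeideal_subset[OF Q(1)])
    have xQ: "primeideal (\<phi> x ` Q) R" by (rule primeideal_image[OF x Q(1)])
    have "g \<in> inertia Q" using Q(2) moving_ideal_subset_iff[OF primeideal.axioms(1)[OF Q(1)] g] by simp
    then have "?h \<in> inertia (\<phi> x ` Q)" by (rule inertia_image[OF Qc x])
    then have "moving_ideal R \<phi> (generate G {?h}) \<subseteq> \<phi> x ` Q"
      using moving_ideal_subset_iff[OF primeideal.axioms(1)[OF xQ] h] by simp
    then have "height R (moving_ideal R \<phi> (generate G {?h})) \<le> prime_height R (\<phi> x ` Q)"
      unfolding height_def using xQ by (intro INF_lower) simp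
    then show "height R (moving_ideal R \<phi> (generate G {?h})) \<le> prime_height R Q"
      by (simp add: prime_height_image[OF x Qc])
  qed
  then show ?thesis using b h by (auto simp: bireflection_def)
qed

end

subsection \<open>Prime ideals of the invariant ring\<close>

lemma (in primeideal) finprod_mem_prime:
  assumes "finite A" "f \<in> A \<rightarrow> carrier R" "finprod R f A \<in> I"
  shows "\<exists>i\<in>A. f i \<in> I"
  using assms
proof (induction A rule: finite_induct)
  case empty
  then show ?case using one_imp_carrier I_notcarr by simp
next
  case (insert i A)
  then have "f i \<otimes> finprod R f A \<in> I" by (subst (asm) finprod_insert) auto
  then have "f i \<in> I \<or> finprod R f A \<in> I" using insert.prems(1) by (intro I_prime) (auto intro!: finprod_closed)
  then show ?case using insert by auto
qed

lemma (in ideal) finprod_mem_ideal: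
  assumes "cring R" "finite A" "f \<in> A \<rightarrow> carrier R" "i \<in> A" "f i \<in> I"
  shows "finprod R f A \<in> I"
proof -
  interpret cring R by fact
  have "finprod R f (insert i (A - {i})) = f i \<otimes> finprod R f (A - {i})"
    using assms by (intro finprod_insert) auto
  then have "finprod R f A = f i \<otimes> finprod R f (A - {i})"
    using assms(4) by (simp add: insert_absorb)
  moreover have "f i \<otimes> finprod R f (A - {i}) \<in> I"
    using assms by (intro I_r_closed) (auto intro!: finprod_closed)
  ultimately show ?thesis by simp
qed

text \<open>On expansion all terms except the power of \<open>e\<close> carry a factor
  \<open>c\<close>. For \<open>y\<close> the conjugates of one element and invariant
  \<open>e\<close>, \<open>c\<close>, this computes a norm modulo \<open>c\<close>.\<close>

lemma (in cring) finprod_minus_pow: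
  assumes "finite S" "e \<in> carrier R" "c \<in> carrier R" "y \<in> S \<rightarrow> carrier R"
  shows "\<exists>t\<in>carrier R. (\<Otimes>i\<in>S. e \<ominus> c \<otimes> y i) = e [^] card S \<ominus> c \<otimes> t"
  using assms
proof (induction S rule: finite_induct)
  case empty
  then show ?case by (intro bexI[of _ \<zero>]) (simp_all add: minus_eq)
next
  case (insert i S)
  then obtain t where t: "t \<in> carrier R" "(\<Otimes>i\<in>S. e \<ominus> c \<otimes> y i) = e [^] card S \<ominus> c \<otimes> t" by auto
  have y: "y i \<in> carrier R" "y \<in> S \<rightarrow> carrier R" using insert by auto
  define z where "z = e [^] card S"
  have z: "z \<in> carrier R" using insert by (simp add: z_def)
  have "(\<Otimes>i\<in>insert i S. e \<ominus> c \<otimes> y i) = (e \<ominus> c \<otimes> y i) \<otimes> (z \<ominus> c \<otimes> t)"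
    using insert y by (subst finprod_insert) (auto simp: t(2) z_def)
  also have "\<dots> = z \<otimes> e \<ominus> c \<otimes> (e \<otimes> t \<oplus> y i \<otimes> (z \<ominus> c \<otimes> t))"
    using insert.prems(1,2) y(1) t(1) z by algebra
  finally show ?case
    using insert y t z by (intro bexI[of _ "e \<otimes> t \<oplus> y i \<otimes> (z \<ominus> c \<otimes> t)"]) (auto simp: z_def)
qed

lemma (in cring) ideal_plus_principal:
  assumes J: "ideal J R" and x: "x \<in> carrier R"
  obtains J' where "ideal J' R" "J \<subseteq> J'" "x \<in> J'" "\<And>c. c \<in> J' \<Longrightarrow> \<exists>j\<in>J. \<exists>r\<in>carrier R. c = j \<oplus> x \<otimes> r"
proof -
  interpret J: ideal J R by fact
  have id: "ideal (PIdl x) R" by (rule cgenideal_ideal[OF x])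
  have xP: "x \<in> PIdl x" by (rule cgenideal_self[OF x])
  have z: "\<zero> \<in> PIdl x" using id by (simp add: additive_subgroup.zero_closed ideal.axioms(1))
  show thesis
  proof (rule that)
    show "ideal (J <+>\<^bsub>R\<^esub> PIdl x) R" by (rule add_ideals[OF J id])
    show "J \<subseteq> J <+>\<^bsub>R\<^esub> PIdl x"
    proof
      fix j assume j: "j \<in> J"
      then have "j = j \<oplus> \<zero>" by (simp add: J.Icarr)
      then show "j \<in> J <+>\<^bsub>R\<^esub> PIdl x" unfolding set_add_def' using j z by blast
    qed
    have "x = \<zero> \<oplus> x" using x by simp
    then show "x \<in> J <+>\<^bsub>R\<^esub> PIdl x" unfolding set_add_def' using J.zero_closed xP by blast
    show "\<exists>j\<in>J. \<exists>r\<in>carrier R. c = j \<oplus> x \<otimes> r" if "c \<in> J <+>\<^bsub>R\<^esub> PIdl x" for c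
    proof -
      obtain j y where jy: "j \<in> J" "y \<in> PIdl x" "c = j \<oplus> y" using \<open>c \<in> J <+>\<^bsub>R\<^esub> PIdl x\<close> unfolding set_add_def' by blast
      obtain r where "r \<in> carrier R" "y = r \<otimes> x" using jy(2) unfolding cgenideal_def by blast
      then show ?thesis using jy x m_comm[of r x] by auto
    qed
  qed
qed

context finite_ring_action
begin

text \<open>Conjugation by an arbitrary element need not preserve \<open>P\<close>, so the
  generating set is not visibly stable under \<open>G\<close>. It is stable under \<open>P\<close>,
  hence \<open>P\<close> normalizes \<open>H\<close>. Moreover \<open>P\<close> and \<open>H\<close>
  generate \<open>G\<close>, because together they contain a Sylow subgroup and all
  \<open>p'\<close>-elements.\<close>

lemma normal_generate_bireflections:
  assumes P: "subgroup P G" and p: "Factorial_Ring.prime (p::nat)" and syl: "sylow_subgroup p P G"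
    and H: "H = generate G (p_regular_elements p G \<union> {g \<in> P. bireflection G R \<phi> g})"
    and reg: "\<And>g n. g \<in> carrier G \<Longrightarrow> g [^]\<^bsub>G\<^esub> (n::nat) = \<one>\<^bsub>G\<^esub> \<Longrightarrow> \<not> p dvd n \<Longrightarrow> g \<in> p_regular_elements p G"
    and ordc: "\<And>x g. x \<in> carrier G \<Longrightarrow> g \<in> p_regular_elements p G \<Longrightarrow> x \<otimes>\<^bsub>G\<^esub> g \<otimes>\<^bsub>G\<^esub> inv\<^bsub>G\<^esub> x \<in> p_regular_elements p G"
  shows "H \<lhd> G"
proof -
  interpret P: subgroup P G by fact
  let ?X = "p_regular_elements p G \<union> {g \<in> P. bireflection G R \<phi> g}"
  have X: "?X \<subseteq> carrier G" using P.subset by (auto simp: p_regular_elements_def)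
  have Hs: "subgroup H G" unfolding H by (rule grp.generate_is_subgroup[OF X])
  interpret H: subgroup H G by fact
  have XH: "x \<in> H" if "x \<in> ?X" for x unfolding H using that by (rule generate.incl)
  let ?c = "\<lambda>x g. x \<otimes>\<^bsub>G\<^esub> g \<otimes>\<^bsub>G\<^esub> inv\<^bsub>G\<^esub> x"
  have cmult: "?c x (g \<otimes>\<^bsub>G\<^esub> h) = ?c x g \<otimes>\<^bsub>G\<^esub> ?c x h"
    if "x \<in> carrier G" "g \<in> carrier G" "h \<in> carrier G" for x g h
  proof -
    have "?c x g \<otimes>\<^bsub>G\<^esub> ?c x h = x \<otimes>\<^bsub>G\<^esub> g \<otimes>\<^bsub>G\<^esub> (inv\<^bsub>G\<^esub> x \<otimes>\<^bsub>G\<^esub> x) \<otimes>\<^bsub>G\<^esub> h \<otimes>\<^bsub>G\<^esub> inv\<^bsub>G\<^esub> x"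
      using that by (simp only: grp.m_assoc grp.m_closed grp.inv_closed)
    then show ?thesis using that by (simp add: grp.m_assoc)
  qed
  have cinv: "?c x (inv\<^bsub>G\<^esub> g) = inv\<^bsub>G\<^esub> (?c x g)" if "x \<in> carrier G" "g \<in> carrier G" for x g
    using that by (simp add: grp.inv_mult_group grp.m_assoc)
  have PH: "?c x h \<in> H" if x: "x \<in> P" and h: "h \<in> H" for x h
  proof -
    have xc: "x \<in> carrier G" using x P.subset by blast
    show ?thesis using h[unfolded H]
    proof (induction rule: generate.induct)
      case one
      then show ?case using xc by simp
    next
      case (incl g)
      have "?c x g \<in> ?X"
        using incl ordc[OF xc] bireflection_conj[OF _ xc] x P.m_closed P.m_inv_closed by auto
      then show ?case by (rule XH)
    next
      case (inv g)
      have "?c x g \<in> ?X"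
        using inv ordc[OF xc] bireflection_conj[OF _ xc] x P.m_closed P.m_inv_closed by auto
      then have "?c x g \<in> H" by (rule XH)
      then show ?case using cinv[OF xc, of g] inv X by auto
    next
      case (eng g h)
      then have "g \<in> carrier G" "h \<in> carrier G" using grp.generate_in_carrier[OF X] by auto
      then show ?case using cmult[OF xc] eng.IH by simp
    qed
  qed
  let ?M = "generate G (P \<union> H)"
  have PHc: "P \<union> H \<subseteq> carrier G" using P.subset H.subset by blast
  have "?M = carrier G"
  proof (rule grp.subgroup_eq_carrier_if_regular_and_sylow[OF finite_carrier p _ _ syl])
    show "subgroup ?M G" by (rule grp.generate_is_subgroup[OF PHc])
    show "g \<in> ?M" if "g \<in> carrier G" "g [^]\<^bsub>G\<^esub> (n::nat) = \<one>\<^bsub>G\<^esub>" "\<not> p dvd n" for g n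
      using XH reg[OF that] by (intro generate.incl) blast
    show "P \<subseteq> ?M" by (auto intro: generate.incl)
  qed
  moreover have "\<forall>h\<in>H. ?c x h \<in> H" if "x \<in> ?M" for x
    using that
  proof (induction rule: generate.induct)
    case one
    then show ?case using H.subset by auto
  next
    case (incl x)
    then show ?case using PH by auto
  next
    case (inv x)
    then have "inv\<^bsub>G\<^esub> x \<in> P \<or> inv\<^bsub>G\<^esub> x \<in> H" by auto
    then show ?case using PH by auto
  next
    case (eng x y)
    then have c: "x \<in> carrier G" "y \<in> carrier G" using grp.generate_in_carrier[OF PHc] by auto
    have "?c (x \<otimes>\<^bsub>G\<^esub> y) h = ?c x (?c y h)" if "h \<in> H" for h
    proof -
      have "h \<in> carrier G" using that H.subset by blast
      then show ?thesis using c by (simp add: grp.inv_mult_group grp.m_assoc)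
    qed
    then show ?case using eng.IH by auto
  qed
  ultimately show ?thesis using Hs by (simp add: grp.normal_inv_iff)
qed

text \<open>\<open>Q\<close> is chosen maximal among the ideals whose invariants lie in
  \<open>q\<close>. Maximality makes \<open>Q\<close> prime, and norms show that \<open>Q\<close>
  contains \<open>q\<close>.\<close>

lemma exists_lying_over:
  assumes R: "noetherian_ring R" and q: "primeideal q A"
  obtains Q where "primeideal Q R" "Q \<inter> Fx (carrier G) = q"
proof -
  interpret N: noetherian_ring R by fact
  interpret q: primeideal q A by fact
  have qs: "q \<subseteq> Fx (carrier G)" using q.Icarr by auto
  have one: "\<one> \<notin> q" using q.one_imp_carrier q.I_notcarr by auto
  have qprime: "a \<in> q \<or> b \<in> q"
    if "a \<in> Fx (carrier G)" "b \<in> Fx (carrier G)" "a \<otimes> b \<in> q" for a b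
    using q.I_prime[of a b] that by simp
  have qmult: "a \<otimes> b \<in> q" if "a \<in> q" "b \<in> Fx (carrier G)" for a b
    using q.I_r_closed[of a b] that by simp
  have qadd: "a \<oplus> b \<in> q" if "a \<in> q" "b \<in> q" for a b
    using additive_subgroup.a_closed[OF q.additive_subgroup_axioms, of a b] that by simp
  have qpow: "a \<in> q" if "a \<in> Fx (carrier G)" "a [^] (n::nat) \<in> q" for a n
    using that(2)
  proof (induction n)
    case (Suc n)
    then show ?case using qprime[of "a [^] n" a] that(1) Fx_pow[OF subset_refl that(1)] by auto
  qed (use one in simp)
  let ?F = "{J. ideal J R \<and> J \<inter> Fx (carrier G) \<subseteq> q}"
  have "\<And>J. J \<in> ?F \<Longrightarrow> ideal J R" by simp
  moreover have "{\<zero>} \<in> ?F" using ring.zeroideal additive_subgroup.zero_closed[OF q.additive_subgroup_axioms] by auto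
  ultimately obtain Q where Q: "Q \<in> ?F" "\<And>J'. J' \<in> ?F \<Longrightarrow> Q \<subseteq> J' \<Longrightarrow> J' = Q"
    by (rule N.exists_maximal_ideal_in_family) auto
  interpret Q: ideal Q R using Q by simp
  \<comment> \<open>By maximality, enlarging \<open>Q\<close> by \<open>x\<close> produces an
    invariant outside of \<open>q\<close>.\<close>
  have ex: "\<exists>c\<in>Fx (carrier G). c \<notin> q \<and> (\<exists>j\<in>Q. \<exists>r\<in>carrier R. c = j \<oplus> x \<otimes> r)"
    if x: "x \<in> carrier R" "x \<notin> Q" for x
  proof -
    obtain J where J: "ideal J R" "Q \<subseteq> J" "x \<in> J" "\<And>c. c \<in> J \<Longrightarrow> \<exists>j\<in>Q. \<exists>r\<in>carrier R. c = j \<oplus> x \<otimes> r"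
      using ring.ideal_plus_principal[OF Q.is_ideal x(1)] by blast
    have "J \<notin> ?F" using Q(2)[of J] J(2,3) x(2) by auto
    then obtain c where "c \<in> J" "c \<in> Fx (carrier G)" "c \<notin> q" using J(1) by blast
    then show ?thesis using J(4) by blast
  qed
  have prime: "primeideal Q R"
  proof (rule primeidealI)
    show "ideal Q R" by (rule Q.is_ideal)
    show "cring R" by (rule ring.is_cring)
    show "carrier R \<noteq> Q" using Q(1) one Fx_one[OF subset_refl] ring.one_closed by auto
    fix x y assume xy: "x \<in> carrier R" "y \<in> carrier R" "x \<otimes> y \<in> Q"
    show "x \<in> Q \<or> y \<in> Q"
    proof (rule ccontr)
      assume "\<not> ?thesis"
      then have "x \<notin> Q" "y \<notin> Q" by simp_all
      obtain c j r where c: "c \<in> Fx (carrier G)" "c \<notin> q" "j \<in> Q" "r \<in> carrier R" "c = j \<oplus> x \<otimes> r"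
        using ex[OF xy(1) \<open>x \<notin> Q\<close>] by blast
      obtain d k s where d: "d \<in> Fx (carrier G)" "d \<notin> q" "k \<in> Q" "s \<in> carrier R" "d = k \<oplus> y \<otimes> s"
        using ex[OF xy(2) \<open>y \<notin> Q\<close>] by blast
      have cc: "j \<in> carrier R" "k \<in> carrier R" using c d Q.Icarr by blast+
      have "c \<otimes> d = j \<otimes> (k \<oplus> y \<otimes> s) \<oplus> (k \<otimes> (x \<otimes> r) \<oplus> (x \<otimes> y) \<otimes> (r \<otimes> s))"
        unfolding c(5) d(5) using cc c(4) d(4) xy(1,2) by algebra
      also have "\<dots> \<in> Q"
        by (intro additive_subgroup.a_closed[OF Q.additive_subgroup_axioms] Q.I_r_closed[OF c(3)]
            Q.I_r_closed[OF d(3)] Q.I_r_closed[OF xy(3)]) (use cc c(4) d(4) xy(1,2) in auto)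
      finally have "c \<otimes> d \<in> Q \<inter> Fx (carrier G)" using c d Fx_mult[OF subset_refl] by simp
      then have "c \<otimes> d \<in> q" using Q(1) by auto
      then show False using qprime c d by blast
    qed
  qed
  have "q \<subseteq> Q"
  proof (rule ccontr)
    assume "\<not> q \<subseteq> Q"
    then obtain c where c: "c \<in> q" "c \<notin> Q" by blast
    have cF: "c \<in> Fx (carrier G)" using c qs by blast
    have cc: "c \<in> carrier R" using FxD(1)[OF cF] .
    obtain e j r where e: "e \<in> Fx (carrier G)" "e \<notin> q" "j \<in> Q" "r \<in> carrier R" "e = j \<oplus> c \<otimes> r"
      using ex[OF cc c(2)] by blast
    have ec: "e \<in> carrier R" using FxD(1)[OF e(1)] .
    have jc: "j \<in> carrier R" using e Q.Icarr by blast
    have "j = (j \<oplus> c \<otimes> r) \<ominus> c \<otimes> r" using jc cc e(4) by algebra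
    then have j: "j = e \<ominus> c \<otimes> r" using e(5) by simp
    have gj: "\<phi> g j = e \<ominus> c \<otimes> \<phi> g r" if "g \<in> carrier G" for g
      unfolding j using that ec cc e(4) FxD(2)[OF e(1) that] FxD(2)[OF cF that] by simp
    obtain t where t: "t \<in> carrier R"
      "(\<Otimes>g\<in>carrier G. e \<ominus> c \<otimes> \<phi> g r) = e [^] card (carrier G) \<ominus> c \<otimes> t"
      using ring.finprod_minus_pow[OF finite_carrier ec cc, of "\<lambda>g. \<phi> g r"] e(4) by auto
    \<comment> \<open>The norm of \<open>j = e - c r\<close> lies in \<open>Q\<close> and is
      invariant, hence lies in \<open>q\<close>; on the other hand it is a power of \<open>e\<close>
      minus a multiple of \<open>c\<close>.\<close>
    define N where "N = norm_over (carrier G) j"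
    have NF: "N \<in> Fx (carrier G)"
      unfolding N_def by (rule norm_over_Fx[OF grp.subgroup_self jc])
    have "N \<in> Q"
      unfolding N_def norm_over_def using jc e(3)
      by (intro Q.finprod_mem_ideal[where i = "\<one>\<^bsub>G\<^esub>"]) (auto simp: finite_carrier ring.is_cring)
    then have Nq: "N \<in> q" using NF Q(1) by blast
    have "N = (\<Otimes>g\<in>carrier G. e \<ominus> c \<otimes> \<phi> g r)"
      unfolding N_def norm_over_def using gj ec cc e(4) by (intro ring.finprod_cong') auto
    then have N: "N = e [^] card (carrier G) \<ominus> c \<otimes> t" using t(2) by simp
    \<comment> \<open>Although \<open>t\<close> need not be invariant, \<open>c t\<close> is, as a
      difference of invariants. It lies outside of \<open>q\<close> because \<open>e\<close>
      does.\<close>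
    define s where "s = c \<otimes> t"
    have sc: "s \<in> carrier R" using cc t by (simp add: s_def)
    define z where "z = e [^] card (carrier G)"
    have zF: "z \<in> Fx (carrier G)" using Fx_pow[OF subset_refl e(1)] by (simp add: z_def)
    have zc: "z \<in> carrier R" using FxD(1)[OF zF] .
    have N': "N = z \<ominus> s" using N by (simp add: z_def s_def)
    have "s = z \<ominus> (z \<ominus> s)" using zc sc by algebra
    then have s: "s = z \<ominus> N" using N' by simp
    then have sF: "s \<in> Fx (carrier G)" using Fx_minus[OF subset_refl zF NF] by simp
    have "z = (z \<ominus> s) \<oplus> s" using zc sc by algebra
    then have z: "z = N \<oplus> s" using N' by simp
    have sq: "s \<notin> q"
    proof
      assume "s \<in> q"
      then have "z \<in> q" using qadd[OF Nq] z by simp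
      then show False using qpow[OF e(1)] e(2) by (simp add: z_def)
    qed
    \<comment> \<open>As \<open>t\<close> is not known to be invariant, \<open>c \<in> q\<close>
      does not directly give \<open>c t \<in> q\<close>. Taking norms replaces \<open>t\<close> by
      its invariant norm.\<close>
    have "s [^] card (carrier G) = (\<Otimes>g\<in>carrier G. s)"
      by (rule ring.finprod_const[symmetric, OF sc])
    also have "\<dots> = (\<Otimes>g\<in>carrier G. c \<otimes> \<phi> g t)"
    proof (rule ring.finprod_cong')
      show "s = c \<otimes> \<phi> g t" if "g \<in> carrier G" for g
        using FxD(2)[OF sF that] FxD(2)[OF cF that] cc t(1) that by (simp add: s_def)
    qed (use cc t in auto)
    also have "\<dots> = (\<Otimes>g\<in>carrier G. c) \<otimes> norm_over (carrier G) t"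
      unfolding norm_over_def using cc t by (intro ring.finprod_multf) auto
    also have "(\<Otimes>g\<in>carrier G. c) = c [^] card (carrier G)" by (rule ring.finprod_const[OF cc])
    also have "\<dots> = c \<otimes> c [^] (card (carrier G) - 1)"
    proof -
      have "card (carrier G) > 0" using finite_carrier by (simp add: card_gt_0_iff ex_in_conv[symmetric]) blast
      then have "c [^] card (carrier G) = c [^] Suc (card (carrier G) - 1)" by simp
      then show ?thesis using cc ring.m_comm by simp
    qed
    also have "c \<otimes> c [^] (card (carrier G) - 1) \<otimes> norm_over (carrier G) t
        = c \<otimes> (c [^] (card (carrier G) - 1) \<otimes> norm_over (carrier G) t)"
      using cc FxD(1)[OF norm_over_Fx[OF grp.subgroup_self t(1)]] by (simp add: ring.m_assoc)
    also have "\<dots> \<in> q"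
      using c(1) Fx_pow[OF subset_refl cF] norm_over_Fx[OF grp.subgroup_self t(1)]
      by (intro qmult Fx_mult) auto
    finally have "s \<in> q" using qpow[OF sF] by simp
    then show False using sq by simp
  qed
  then have "Q \<inter> Fx (carrier G) = q" using Q(1) qs by auto
  then show thesis using prime that by blast
qed

text \<open>The inverse of \<open>g\<close> maps \<open>Q\<close> into itself, and \<open>g\<close>
  is a power of its inverse.\<close>

lemma image_subset_if_subset_image:
  assumes g: "g \<in> carrier G" and Q: "Q \<subseteq> carrier R" "Q \<subseteq> \<phi> g ` Q"
  shows "\<phi> g ` Q \<subseteq> Q"
proof -
  let ?h = "inv\<^bsub>G\<^esub> g"
  have h: "\<phi> ?h r \<in> Q" if "r \<in> Q" for r
    using mem_image_iff[OF g Q(1), of r] that Q by blast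
  have hk: "\<phi> (?h [^]\<^bsub>G\<^esub> (k::nat)) r \<in> Q" if "r \<in> Q" for r k
  proof (induction k)
    case 0
    then show ?case using that Q(1) by auto
  next
    case (Suc k)
    have "?h [^]\<^bsub>G\<^esub> Suc k = ?h \<otimes>\<^bsub>G\<^esub> ?h [^]\<^bsub>G\<^esub> k" using g by (simp only: grp.nat_pow_Suc2 grp.inv_closed)
    then show ?case using h[OF Suc] act_comp[of ?h "?h [^]\<^bsub>G\<^esub> k" r] g that Q(1) by auto
  qed
  have pos: "order G > 0" using finite_carrier by (simp add: grp.order_gt_0_iff_finite)
  have "?h \<otimes>\<^bsub>G\<^esub> ?h [^]\<^bsub>G\<^esub> (order G - 1) = ?h [^]\<^bsub>G\<^esub> Suc (order G - 1)"
    using g by (simp only: grp.nat_pow_Suc2 grp.inv_closed)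
  also have "\<dots> = \<one>\<^bsub>G\<^esub>" using pos g by (simp add: grp.pow_order_eq_1 del: grp.nat_pow_Suc)
  finally have 1: "?h \<otimes>\<^bsub>G\<^esub> ?h [^]\<^bsub>G\<^esub> (order G - 1) = \<one>\<^bsub>G\<^esub>" .
  have "?h [^]\<^bsub>G\<^esub> (order G - 1) = g \<otimes>\<^bsub>G\<^esub> (?h \<otimes>\<^bsub>G\<^esub> ?h [^]\<^bsub>G\<^esub> (order G - 1))"
    using g by (simp add: grp.m_assoc[symmetric])
  then have "?h [^]\<^bsub>G\<^esub> (order G - 1) = g" using 1 g by simp
  then show ?thesis using hk[of _ "order G - 1"] by auto
qed

text \<open>If the contractions agreed, \<open>Q2\<close> would be contained in a translate of
  \<open>Q1\<close>: otherwise prime avoidance gives an element of \<open>Q2\<close> outside of all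
  translates of \<open>Q1\<close>, and its norm lies in \<open>Q2\<close> but not in
  \<open>Q1\<close>. A strict inclusion of \<open>Q1\<close> in its own translate is impossible, as
  the group is finite.\<close>

lemma incomparability:
  assumes Q1: "primeideal Q1 R" and Q2: "primeideal Q2 R" and sub: "Q1 \<subset> Q2"
  shows "Q1 \<inter> Fx (carrier G) \<subset> Q2 \<inter> Fx (carrier G)"
proof (rule ccontr)
  assume "\<not> ?thesis"
  then have eq: "Q1 \<inter> Fx (carrier G) = Q2 \<inter> Fx (carrier G)" using sub by blast
  interpret Q1: primeideal Q1 R by fact
  interpret Q2: primeideal Q2 R by fact
  have Q1c: "Q1 \<subseteq> carrier R" by (rule primeideal_subset[OF Q1])
  have "\<exists>g\<in>carrier G. Q2 \<subseteq> \<phi> g ` Q1"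
  proof (rule ccontr)
    assume neg: "\<not> ?thesis"
    obtain a where a: "a \<in> Q2" "\<And>P. P \<in> (\<lambda>g. \<phi> g ` Q1) ` carrier G \<Longrightarrow> a \<notin> P"
      by (rule ring.prime_avoidance[OF Q2.is_ideal, of "(\<lambda>g. \<phi> g ` Q1) ` carrier G"])
        (use finite_carrier primeideal_image[OF _ Q1] neg in auto)
    have ac: "a \<in> carrier R" using a Q2.Icarr by blast
    have "norm_over (carrier G) a \<in> Q2"
      unfolding norm_over_def using ac a(1)
      by (intro Q2.finprod_mem_ideal[where i = "\<one>\<^bsub>G\<^esub>"]) (auto simp: finite_carrier ring.is_cring)
    then have "norm_over (carrier G) a \<in> Q1"
      using eq norm_over_Fx[OF grp.subgroup_self ac] by blast
    then obtain g where g: "g \<in> carrier G" "\<phi> g a \<in> Q1"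
      using Q1.finprod_mem_prime[OF finite_carrier, of "\<lambda>g. \<phi> g a"] ac unfolding norm_over_def by auto
    then have "a \<in> \<phi> (inv\<^bsub>G\<^esub> g) ` Q1"
      using mem_image_iff[of "inv\<^bsub>G\<^esub> g" Q1 a] Q1c ac by simp
    then show False using a(2) g(1) by blast
  qed
  then obtain g where g: "g \<in> carrier G" "Q2 \<subseteq> \<phi> g ` Q1" by blast
  then have "\<phi> g ` Q1 \<subseteq> Q1" using sub by (intro image_subset_if_subset_image Q1c) auto
  then have "Q2 \<subseteq> Q1" using g(2) by (rule subset_trans[rotated])
  then show False using sub by simp
qed

lemma primeideal_contract:
  assumes A: "cring A" and Q: "primeideal Q R"
  shows "primeideal (Q \<inter> Fx (carrier G)) A"
proof -
  interpret Q: primeideal Q R by fact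
  interpret A: cring A by fact
  have sub: "x \<in> carrier R" if "x \<in> Fx (carrier G)" for x using FxD(1)[OF that] .
  note cl = Fx_zero[OF subset_refl] Fx_add[OF subset_refl] Fx_mult[OF subset_refl] Fx_neg[OF subset_refl]
  show ?thesis
  proof (rule primeidealI)
    show "ideal (Q \<inter> Fx (carrier G)) A"
    proof (rule idealI)
      show "subgroup (Q \<inter> Fx (carrier G)) (add_monoid A)"
      proof (rule A.add.subgroupI)
        show "Q \<inter> Fx (carrier G) \<subseteq> carrier A" by simp
        show "Q \<inter> Fx (carrier G) \<noteq> {}" using Q.zero_closed cl(1) by blast
        show "\<ominus>\<^bsub>A\<^esub> a \<in> Q \<inter> Fx (carrier G)" if a: "a \<in> Q \<inter> Fx (carrier G)" for a
        proof -
          have "\<ominus>\<^bsub>A\<^esub> a = \<ominus> a"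
            using a cl(4)[of a] sub[of a] by (intro A.minus_equality) (auto simp: ring.l_neg)
          then show ?thesis using a cl(4) by auto
        qed
        show "a \<oplus>\<^bsub>A\<^esub> b \<in> Q \<inter> Fx (carrier G)"
          if "a \<in> Q \<inter> Fx (carrier G)" "b \<in> Q \<inter> Fx (carrier G)" for a b
          using that cl(2) by auto
      qed
      show "x \<otimes>\<^bsub>A\<^esub> a \<in> Q \<inter> Fx (carrier G)" if "a \<in> Q \<inter> Fx (carrier G)" "x \<in> carrier A" for a x
        using that cl(3) sub Q.I_l_closed by auto
      show "a \<otimes>\<^bsub>A\<^esub> x \<in> Q \<inter> Fx (carrier G)" if "a \<in> Q \<inter> Fx (carrier G)" "x \<in> carrier A" for a x
        using that cl(3) sub Q.I_r_closed by auto
    qed (rule A.ring_axioms)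
    show "cring A" by fact
    have "\<one> \<notin> Q" using Q.one_imp_carrier Q.I_notcarr by auto
    then show "carrier A \<noteq> Q \<inter> Fx (carrier G)" using Fx_one[OF subset_refl] by auto
    show "a \<in> Q \<inter> Fx (carrier G) \<or> b \<in> Q \<inter> Fx (carrier G)"
      if "a \<in> carrier A" "b \<in> carrier A" "a \<otimes>\<^bsub>A\<^esub> b \<in> Q \<inter> Fx (carrier G)" for a b
      using that sub Q.I_prime[of a b] by auto
  qed
qed

lemma prime_height_le_contract:
  assumes A: "cring A"
  shows "prime_height R Q \<le> prime_height A (Q \<inter> Fx (carrier G))"
  unfolding prime_height_def
proof (rule SUP_subset_mono)
  show "{n. \<exists>C. (\<forall>i\<le>n. primeideal (C i) R) \<and> (\<forall>i<n. C i \<subset> C (Suc i)) \<and> C n = Q}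
    \<subseteq> {n. \<exists>C. (\<forall>i\<le>n. primeideal (C i) A) \<and> (\<forall>i<n. C i \<subset> C (Suc i)) \<and> C n = Q \<inter> Fx (carrier G)}"
  proof
    fix n assume "n \<in> {n. \<exists>C. (\<forall>i\<le>n. primeideal (C i) R) \<and> (\<forall>i<n. C i \<subset> C (Suc i)) \<and> C n = Q}"
    then obtain C where C: "\<forall>i\<le>n. primeideal (C i) R" "\<forall>i<n. C i \<subset> C (Suc i)" "C n = Q" by blast
    then show "n \<in> {n. \<exists>C. (\<forall>i\<le>n. primeideal (C i) A) \<and> (\<forall>i<n. C i \<subset> C (Suc i)) \<and> C n = Q \<inter> Fx (carrier G)}"
      using primeideal_contract[OF A] incomparability
      by (intro CollectI exI[of _ "\<lambda>i. C i \<inter> Fx (carrier G)"]) auto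
  qed
qed simp

end

subsection \<open>Traces\<close>

context group
begin

abbreviation "cosets_of N U \<equiv> (\<lambda>g. g <#\<^bsub>G\<^esub> U) ` N"

lemma lcosets_eq_cosets_of: "lcosets U = cosets_of (carrier G) U"
  unfolding LCOSETS_def by blast

lemma lcos_mult_mem:
  assumes H: "subgroup H G" and x: "x \<in> carrier G" and h: "h \<in> H"
  shows "(x \<otimes> h) <#\<^bsub>G\<^esub> H = x <#\<^bsub>G\<^esub> H"
proof -
  have hc: "h \<in> carrier G" using h subgroup.subset[OF H] by blast
  have "(x \<otimes> h) <#\<^bsub>G\<^esub> H = x <#\<^bsub>G\<^esub> (h <#\<^bsub>G\<^esub> H)" using x hc subgroup.subset[OF H] by (simp add: lcos_m_assoc)
  also have "h <#\<^bsub>G\<^esub> H = H" using coset_join3[OF hc H h] .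
  finally show ?thesis .
qed

lemma lcos_eqD:
  assumes H: "subgroup H G" and x: "x \<in> carrier G" "y \<in> carrier G" and e: "x <#\<^bsub>G\<^esub> H = y <#\<^bsub>G\<^esub> H"
  obtains h where "h \<in> H" "x = y \<otimes> h"
proof -
  have "x \<in> y <#\<^bsub>G\<^esub> H" using lcos_self[OF x(1) H] e by simp
  then show thesis using that by (auto simp: l_coset_def)
qed

lemma some_mem_lcos:
  assumes U: "subgroup U G" and x: "x \<in> carrier G"
  obtains u where "u \<in> U" "(SOME g. g \<in> x <#\<^bsub>G\<^esub> U) = x \<otimes> u"
proof -
  have "(SOME g. g \<in> x <#\<^bsub>G\<^esub> U) \<in> x <#\<^bsub>G\<^esub> U" by (rule someI[of _ x]) (rule lcos_self[OF x U])
  then show thesis using that by (auto simp: l_coset_def)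
qed

lemma some_lcos_lcos:
  assumes U: "subgroup U G" and H: "subgroup H G" and UH: "U \<subseteq> H" and x: "x \<in> carrier G"
  shows "(SOME g. g \<in> x <#\<^bsub>G\<^esub> U) <#\<^bsub>G\<^esub> H = x <#\<^bsub>G\<^esub> H"
proof -
  obtain u where "u \<in> U" "(SOME g. g \<in> x <#\<^bsub>G\<^esub> U) = x \<otimes> u" by (rule some_mem_lcos[OF U x])
  then show ?thesis using lcos_mult_mem[OF H x] UH by auto
qed

lemma inj_on_lcos:
  assumes x: "x \<in> carrier G"
  shows "inj_on (\<lambda>D. x <#\<^bsub>G\<^esub> D) (Pow (carrier G))"
proof (rule inj_on_inverseI[where g = "\<lambda>D. inv x <#\<^bsub>G\<^esub> D"])
  fix D assume "D \<in> Pow (carrier G)"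
  then show "inv x <#\<^bsub>G\<^esub> (x <#\<^bsub>G\<^esub> D) = D" using x by (simp add: lcos_m_assoc lcos_mult_one)
qed

lemma cosets_of_subset_Pow: "N \<subseteq> carrier G \<Longrightarrow> U \<subseteq> carrier G \<Longrightarrow> cosets_of N U \<subseteq> Pow (carrier G)"
  using l_coset_subset_G by blast

text \<open>\<open>E \<mapsto> (SOME g. g \<in> E) H\<close> is the projection from \<open>G/U\<close> to \<open>G/H\<close>.\<close>
lemma coset_fibre:
  assumes U: "subgroup U G" and H: "subgroup H G" and UH: "U \<subseteq> H"
    and N: "N \<subseteq> carrier G" "\<And>g h. g \<in> N \<Longrightarrow> h \<in> H \<Longrightarrow> g \<otimes> h \<in> N" and x: "x \<in> N"
  shows "{E \<in> cosets_of N U. (SOME g. g \<in> E) <#\<^bsub>G\<^esub> H = x <#\<^bsub>G\<^esub> H} = (\<lambda>D. x <#\<^bsub>G\<^esub> D) ` cosets_of H U"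
proof
  have xc: "x \<in> carrier G" using x N by blast
  have Hc: "h \<in> carrier G" if "h \<in> H" for h using that subgroup.subset[OF H] by blast
  have Uc: "U \<subseteq> carrier G" by (rule subgroup.subset[OF U])
  show "{E \<in> cosets_of N U. (SOME g. g \<in> E) <#\<^bsub>G\<^esub> H = x <#\<^bsub>G\<^esub> H} \<subseteq> (\<lambda>D. x <#\<^bsub>G\<^esub> D) ` cosets_of H U"
  proof
    fix E assume "E \<in> {E \<in> cosets_of N U. (SOME g. g \<in> E) <#\<^bsub>G\<^esub> H = x <#\<^bsub>G\<^esub> H}"
    then obtain g where g: "g \<in> N" "E = g <#\<^bsub>G\<^esub> U" "(SOME g. g \<in> E) <#\<^bsub>G\<^esub> H = x <#\<^bsub>G\<^esub> H" by blast
    have gc: "g \<in> carrier G" using g N by blast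
    have "g <#\<^bsub>G\<^esub> H = x <#\<^bsub>G\<^esub> H" using some_lcos_lcos[OF U H UH gc] g by simp
    then obtain h where h: "h \<in> H" "g = x \<otimes> h" by (rule lcos_eqD[OF H gc xc])
    then have "E = x <#\<^bsub>G\<^esub> (h <#\<^bsub>G\<^esub> U)" using g(2) xc Hc Uc by (simp add: lcos_m_assoc)
    then show "E \<in> (\<lambda>D. x <#\<^bsub>G\<^esub> D) ` cosets_of H U" using h by blast
  qed
  show "(\<lambda>D. x <#\<^bsub>G\<^esub> D) ` cosets_of H U \<subseteq> {E \<in> cosets_of N U. (SOME g. g \<in> E) <#\<^bsub>G\<^esub> H = x <#\<^bsub>G\<^esub> H}"
  proof clarify
    fix h assume h: "h \<in> H"
    have e: "x <#\<^bsub>G\<^esub> (h <#\<^bsub>G\<^esub> U) = (x \<otimes> h) <#\<^bsub>G\<^esub> U" using xc Hc[OF h] Uc by (simp add: lcos_m_assoc)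
    have "(SOME g. g \<in> (x \<otimes> h) <#\<^bsub>G\<^esub> U) <#\<^bsub>G\<^esub> H = (x \<otimes> h) <#\<^bsub>G\<^esub> H"
      using xc Hc[OF h] by (intro some_lcos_lcos[OF U H UH]) auto
    also have "\<dots> = x <#\<^bsub>G\<^esub> H" by (rule lcos_mult_mem[OF H xc h])
    finally show "x <#\<^bsub>G\<^esub> (h <#\<^bsub>G\<^esub> U) \<in> cosets_of N U \<and> (SOME g. g \<in> x <#\<^bsub>G\<^esub> (h <#\<^bsub>G\<^esub> U)) <#\<^bsub>G\<^esub> H = x <#\<^bsub>G\<^esub> H"
      unfolding e using N(2)[OF x h] by blast
  qed
qed

text \<open>Exponents replace orders, so that conjugates can be treated without computing their
  orders.\<close>

lemma p_regular_elements_iff: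
  assumes fin: "finite (carrier G)"
  shows "g \<in> p_regular_elements p G \<longleftrightarrow> g \<in> carrier G \<and> (\<exists>n::nat. g [^] n = \<one> \<and> \<not> p dvd n)"
proof -
  have "\<not> p dvd ord g" if "g [^] (n::nat) = \<one>" "\<not> p dvd n" "g \<in> carrier G" for n
    using that dvd_trans[of p "ord g" n] by (auto simp: pow_eq_id)
  then show ?thesis
    unfolding p_regular_elements_def by (auto intro!: exI[of _ "ord g"] pow_ord_eq_1)
qed

lemma p_regular_elements_conj:
  assumes fin: "finite (carrier G)" and x: "x \<in> carrier G" and g: "g \<in> p_regular_elements p G"
  shows "x \<otimes> g \<otimes> inv x \<in> p_regular_elements p G"
proof -
  obtain n :: nat where n: "g \<in> carrier G" "g [^] n = \<one>" "\<not> p dvd n"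
    using g by (auto simp: p_regular_elements_iff[OF fin])
  have "(x \<otimes> g \<otimes> inv x) [^] k = x \<otimes> g [^] k \<otimes> inv x" for k :: nat
  proof (induction k)
    case 0
    then show ?case using x by simp
  next
    case (Suc k)
    have "x \<otimes> g [^] k \<otimes> inv x \<otimes> (x \<otimes> g \<otimes> inv x) = x \<otimes> g [^] k \<otimes> (inv x \<otimes> x) \<otimes> g \<otimes> inv x"
      using x n(1) by (simp only: m_assoc m_closed inv_closed nat_pow_closed)
    then show ?case using Suc x n(1) by (simp add: m_assoc)
  qed
  then have "(x \<otimes> g \<otimes> inv x) [^] n = \<one>" using n(2) x by simp
  then show ?thesis using n x by (auto simp: p_regular_elements_iff[OF fin])
qed

end

lemma (in abelian_monoid) finsum_fibres:
  assumes "finite A" and f: "\<And>a. a \<in> A \<Longrightarrow> f a \<in> carrier G"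
  shows "finsum G f A = (\<Oplus>b\<in>\<pi> ` A. finsum G f {a \<in> A. \<pi> a = b})"
proof -
  have "A = (\<Union>b\<in>\<pi> ` A. {a \<in> A. \<pi> a = b})" by blast
  then have "finsum G f A = finsum G f (\<Union>b\<in>\<pi> ` A. {a \<in> A. \<pi> a = b})" by simp
  also have "\<dots> = (\<Oplus>b\<in>\<pi> ` A. finsum G f {a \<in> A. \<pi> a = b})"
    using assms by (intro add.finprod_UN_disjoint) (auto simp: pairwise_def disjnt_def)
  finally show ?thesis .
qed

section \<open>Relative traces between subgroups\<close>

context finite_ring_action
begin

text \<open>The summand of \<open>relative_trace\<close>. The chosen representative does not matter
  if \<open>r\<close> is fixed by the subgroup (\<open>coset_act_eq\<close>). For arbitrary
  \<open>r\<close> it does not matter modulo a prime whose inertia group contains the subgroup, as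
  long as the coset lies in the decomposition group.\<close>

definition coset_act :: "'g set \<Rightarrow> 'a \<Rightarrow> 'a" where
  "coset_act C r = \<phi> (SOME g. g \<in> C) r"

lemma coset_act_eq:
  assumes U: "subgroup U G" and x: "x \<in> carrier G" and r: "r \<in> Fx U"
  shows "coset_act (x <#\<^bsub>G\<^esub> U) r = \<phi> x r"
proof -
  obtain u where u: "u \<in> U" "(SOME g. g \<in> x <#\<^bsub>G\<^esub> U) = x \<otimes>\<^bsub>G\<^esub> u" by (rule grp.some_mem_lcos[OF U x])
  have "u \<in> carrier G" using u subgroup.subset[OF U] by blast
  then show ?thesis unfolding coset_act_def u(2) using act_comp[OF x] FxD[OF r] u(1) by simp
qed

text \<open>The cosets are formed in \<open>G\<close> with representatives in \<open>N\<close>, so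
  that traces to intermediate subgroups require no restricted group structure.\<close>

definition trace_over :: "'g set \<Rightarrow> 'g set \<Rightarrow> 'a \<Rightarrow> 'a" where
  "trace_over N U r = (\<Oplus>C\<in>grp.cosets_of N U. coset_act C r)"

lemma relative_trace_eq: "relative_trace G R \<phi> U r = trace_over (carrier G) U r"
  unfolding relative_trace_def trace_over_def coset_act_def grp.lcosets_eq_cosets_of ..

lemma coset_act_closed:
  assumes U: "subgroup U G" and N: "N \<subseteq> carrier G" and r: "r \<in> Fx U" and C: "C \<in> grp.cosets_of N U"
  shows "coset_act C r \<in> carrier R"
proof -
  obtain x where "x \<in> N" "C = x <#\<^bsub>G\<^esub> U" using C by blast
  then show ?thesis using coset_act_eq[OF U _ r] N FxD(1)[OF r] by auto
qed

lemma act_coset_act: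
  assumes U: "subgroup U G" and N: "N \<subseteq> carrier G" and r: "r \<in> Fx U"
    and C: "C \<in> grp.cosets_of N U" and x: "x \<in> carrier G"
  shows "\<phi> x (coset_act C r) = coset_act (x <#\<^bsub>G\<^esub> C) r"
proof -
  obtain g where g: "g \<in> N" "C = g <#\<^bsub>G\<^esub> U" using C by blast
  have gc: "g \<in> carrier G" using g N by blast
  have e: "x <#\<^bsub>G\<^esub> C = (x \<otimes>\<^bsub>G\<^esub> g) <#\<^bsub>G\<^esub> U"
    using g gc x subgroup.subset[OF U] by (simp add: grp.lcos_m_assoc)
  have "coset_act (x <#\<^bsub>G\<^esub> C) r = \<phi> (x \<otimes>\<^bsub>G\<^esub> g) r"
    unfolding e using coset_act_eq[OF U _ r] x gc by simp
  then show ?thesis using coset_act_eq[OF U gc r] g act_comp[OF x gc] FxD(1)[OF r] by simp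
qed

lemma finite_cosets_of: "N \<subseteq> carrier G \<Longrightarrow> finite (grp.cosets_of N U)"
  using finite_carrier finite_subset by blast

lemma act_trace_over:
  assumes U: "subgroup U G" and N: "N \<subseteq> carrier G" and r: "r \<in> Fx U" and x: "x \<in> carrier G"
  shows "\<phi> x (trace_over N U r) = (\<Oplus>C\<in>(\<lambda>D. x <#\<^bsub>G\<^esub> D) ` grp.cosets_of N U. coset_act C r)"
proof -
  have Uc: "U \<subseteq> carrier G" by (rule subgroup.subset[OF U])
  have "\<phi> x (trace_over N U r) = (\<Oplus>C\<in>grp.cosets_of N U. \<phi> x (coset_act C r))"
    unfolding trace_over_def using coset_act_closed[OF U N r] x by (intro act_finsum) auto
  also have "\<dots> = (\<Oplus>C\<in>grp.cosets_of N U. coset_act (x <#\<^bsub>G\<^esub> C) r)"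
    using coset_act_closed[OF U N r] x act_coset_act[OF U N r _ x]
    by (intro ring.finsum_cong') (auto simp flip: act_coset_act[OF U N r _ x])
  also have "\<dots> = (\<Oplus>C\<in>(\<lambda>D. x <#\<^bsub>G\<^esub> D) ` grp.cosets_of N U. coset_act C r)"
  proof (rule ring.finsum_reindex[symmetric])
    show "inj_on (\<lambda>D. x <#\<^bsub>G\<^esub> D) (grp.cosets_of N U)"
      using grp.inj_on_lcos[OF x] grp.cosets_of_subset_Pow[OF N Uc] by (rule inj_on_subset)
    show "(\<lambda>C. coset_act C r) \<in> (\<lambda>D. x <#\<^bsub>G\<^esub> D) ` grp.cosets_of N U \<rightarrow> carrier R"
      using coset_act_closed[OF U N r] x by (auto simp flip: act_coset_act[OF U N r _ x])
  qed
  finally show ?thesis .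
qed

lemma translate_cosets_of:
  assumes U: "subgroup U G" and N: "subgroup N G" and n: "n \<in> N"
  shows "(\<lambda>D. n <#\<^bsub>G\<^esub> D) ` grp.cosets_of N U = grp.cosets_of N U"
proof -
  have c: "g \<in> carrier G" if "g \<in> N" for g using that subgroup.subset[OF N] by blast
  have "(\<lambda>D. n <#\<^bsub>G\<^esub> D) ` grp.cosets_of N U = (\<lambda>g. (n \<otimes>\<^bsub>G\<^esub> g) <#\<^bsub>G\<^esub> U) ` N"
    unfolding image_image using c n subgroup.subset[OF U] by (intro image_cong) (auto simp: grp.lcos_m_assoc)
  also have "\<dots> = (\<lambda>g. g <#\<^bsub>G\<^esub> U) ` (\<lambda>g. n \<otimes>\<^bsub>G\<^esub> g) ` N" by (simp add: image_image)
  also have "(\<lambda>g. n \<otimes>\<^bsub>G\<^esub> g) ` N = N" using reindex_left_mult[OF N n] by (simp add: bij_betw_def)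
  finally show ?thesis .
qed

lemma trace_over_closed:
  assumes U: "subgroup U G" and N: "N \<subseteq> carrier G" and r: "r \<in> Fx U"
  shows "trace_over N U r \<in> carrier R"
  unfolding trace_over_def using coset_act_closed[OF U N r] by (intro ring.finsum_closed) auto

lemma trace_over_Fx:
  assumes U: "subgroup U G" and N: "subgroup N G" and r: "r \<in> Fx U"
  shows "trace_over N U r \<in> Fx N"
proof (rule FxI)
  have Nc: "N \<subseteq> carrier G" by (rule subgroup.subset[OF N])
  show "trace_over N U r \<in> carrier R" by (rule trace_over_closed[OF U Nc r])
  show "\<phi> n (trace_over N U r) = trace_over N U r" if n: "n \<in> N" for n
    using act_trace_over[OF U Nc r, of n] n Nc unfolding translate_cosets_of[OF U N n]
    by (auto simp: trace_over_def)
qed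

lemma trace_over_trans:
  assumes U: "subgroup U G" and H: "subgroup H G" and UH: "U \<subseteq> H" and r: "r \<in> Fx U"
  shows "trace_over (carrier G) H (trace_over H U r) = trace_over (carrier G) U r"
proof -
  let ?\<pi> = "\<lambda>E. (SOME g. g \<in> E) <#\<^bsub>G\<^esub> H"
  let ?N = "carrier G"
  have Hc: "H \<subseteq> carrier G" by (rule subgroup.subset[OF H])
  have b: "trace_over H U r \<in> Fx H" by (rule trace_over_Fx[OF U H r])
  have im: "?\<pi> ` grp.cosets_of ?N U = grp.cosets_of ?N H"
    unfolding image_image using grp.some_lcos_lcos[OF U H UH] by (intro image_cong) auto
  have "trace_over ?N U r = (\<Oplus>C\<in>grp.cosets_of ?N H. \<Oplus>E\<in>{E \<in> grp.cosets_of ?N U. ?\<pi> E = C}. coset_act E r)"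
    unfolding trace_over_def im[symmetric]
    using coset_act_closed[OF U subset_refl r] by (intro ring.finsum_fibres finite_cosets_of) auto
  also have "\<dots> = (\<Oplus>C\<in>grp.cosets_of ?N H. coset_act C (trace_over H U r))"
  proof (rule ring.finsum_cong')
    show "(\<lambda>C. coset_act C (trace_over H U r)) \<in> grp.cosets_of ?N H \<rightarrow> carrier R"
      using coset_act_closed[OF H subset_refl b] by auto
    fix C assume "C \<in> grp.cosets_of ?N H"
    then obtain x where x: "x \<in> carrier G" "C = x <#\<^bsub>G\<^esub> H" by blast
    have "{E \<in> grp.cosets_of ?N U. ?\<pi> E = C} = (\<lambda>D. x <#\<^bsub>G\<^esub> D) ` grp.cosets_of H U"
      unfolding x(2) using Hc by (intro grp.coset_fibre[OF U H UH subset_refl _ x(1)]) auto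
    then show "(\<Oplus>E\<in>{E \<in> grp.cosets_of ?N U. ?\<pi> E = C}. coset_act E r) = coset_act C (trace_over H U r)"
      using act_trace_over[OF U Hc r x(1)] coset_act_eq[OF H x(1) b] x(2) by simp
  qed simp
  finally show ?thesis by (simp add: trace_over_def)
qed

lemma inertia_subset_stabilizer:
  assumes Q: "ideal Q R" and g: "g \<in> inertia Q"
  shows "\<phi> g ` Q \<subseteq> Q"
proof clarify
  interpret Q: ideal Q R by fact
  fix r assume r: "r \<in> Q"
  then have rc: "r \<in> carrier R" by (rule Q.Icarr)
  have "(\<phi> g r \<ominus> r) \<oplus> r \<in> Q"
    by (rule additive_subgroup.a_closed[OF Q.additive_subgroup_axioms inertiaD(2)[OF g rc] r])
  moreover have "(\<phi> g r \<ominus> r) \<oplus> r = \<phi> g r"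
    using rc inertiaD(1)[OF g] by (simp add: ring.minus_eq ring.a_assoc ring.l_neg)
  ultimately show "\<phi> g r \<in> Q" by simp
qed

lemma stabilizer_inv:
  assumes g: "g \<in> carrier G" and Q: "Q \<subseteq> carrier R" "\<phi> g ` Q \<subseteq> Q"
  shows "\<phi> (inv\<^bsub>G\<^esub> g) ` Q \<subseteq> Q"
proof (rule image_subset_if_subset_image)
  have "\<phi> (inv\<^bsub>G\<^esub> g) ` \<phi> g ` Q \<subseteq> \<phi> (inv\<^bsub>G\<^esub> g) ` Q" using Q(2) by (rule image_mono)
  then show "Q \<subseteq> \<phi> (inv\<^bsub>G\<^esub> g) ` Q" unfolding image_inv_image[OF g Q(1)] .
qed (use g Q in auto)

end

subsection \<open>Inertia groups\<close>

context finite_ring_action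
begin

text \<open>For each \<open>g\<close> that does not stabilize \<open>Q\<close>, its inverse does not
  either, so some \<open>e g \<notin> Q\<close> satisfies \<open>\<phi> g (e g) \<in> Q\<close>. The
  product of all these elements works for every \<open>g\<close> at once.\<close>

lemma exists_separating_element:
  assumes Q: "primeideal Q R"
  obtains c where "c \<in> carrier R" "c \<notin> Q"
    "\<And>g. g \<in> carrier G \<Longrightarrow> \<not> \<phi> g ` Q \<subseteq> Q \<Longrightarrow> \<phi> g c \<in> Q"
proof -
  interpret Q: primeideal Q R by fact
  have Qc: "Q \<subseteq> carrier R" by (rule primeideal_subset[OF Q])
  let ?B = "{g \<in> carrier G. \<not> \<phi> g ` Q \<subseteq> Q}"
  have ex: "\<exists>c. c \<in> carrier R \<and> c \<notin> Q \<and> \<phi> g c \<in> Q" if g: "g \<in> ?B" for g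
  proof -
    have gc: "g \<in> carrier G" and ng: "\<not> \<phi> g ` Q \<subseteq> Q" using g by simp_all
    have "\<not> \<phi> (inv\<^bsub>G\<^esub> g) ` Q \<subseteq> Q"
    proof
      assume "\<phi> (inv\<^bsub>G\<^esub> g) ` Q \<subseteq> Q"
      then have "\<phi> (inv\<^bsub>G\<^esub> (inv\<^bsub>G\<^esub> g)) ` Q \<subseteq> Q" by (rule stabilizer_inv[OF grp.inv_closed[OF gc] Qc])
      then show False using ng gc by simp
    qed
    then obtain b where b: "b \<in> Q" "\<phi> (inv\<^bsub>G\<^esub> g) b \<notin> Q" by blast
    then have "b \<in> carrier R" using Qc by blast
    then show ?thesis using b gc by (intro exI[of _ "\<phi> (inv\<^bsub>G\<^esub> g) b"]) auto
  qed
  define e where "e g = (SOME c. c \<in> carrier R \<and> c \<notin> Q \<and> \<phi> g c \<in> Q)" for g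
  have e: "e g \<in> carrier R" "e g \<notin> Q" "\<phi> g (e g) \<in> Q" if "g \<in> ?B" for g
    using someI_ex[OF ex[OF that]] unfolding e_def by simp_all
  have fin: "finite ?B" using finite_carrier by simp
  have ec: "e \<in> ?B \<rightarrow> carrier R" using e(1) by blast
  show thesis
  proof (rule that)
    show "finprod R e ?B \<in> carrier R" by (rule ring.finprod_closed[OF ec])
    show "finprod R e ?B \<notin> Q" using Q.finprod_mem_prime[OF fin ec] e(2) by blast
    fix g assume "g \<in> carrier G" "\<not> \<phi> g ` Q \<subseteq> Q"
    then have g: "g \<in> ?B" "g \<in> carrier G" by simp_all
    have "(\<lambda>h. \<phi> g (e h)) \<in> ?B \<rightarrow> carrier R"
      by (intro Pi_I act_closed g(2) e(1))
    then have "(\<Otimes>h\<in>?B. \<phi> g (e h)) \<in> Q"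
      by (rule Q.finprod_mem_ideal[OF ring.is_cring fin _ g(1)]) (rule e(3)[OF g(1)])
    then show "\<phi> g (finprod R e ?B) \<in> Q" using act_finprod[OF g(2) ec] by simp
  qed
qed

text \<open>If the inertia group \<open>T\<close> of \<open>Q\<close> is contained in \<open>H\<close>, take a Sylow \<open>p\<close>-subgroup \<open>U\<close> of \<open>T\<close>, let
  \<open>D\<close> be the decomposition group, and choose \<open>y\<close> lying in all conjugates of \<open>Q\<close> other than \<open>Q\<close>. Since \<open>U\<close>
  acts trivially modulo \<open>Q\<close>, the trace from \<open>U\<close> to \<open>G\<close> of \<open>\<Prod>\<^sub>u u(y)\<close> is congruent to
  \<open>[T : U] (\<Sum>\<^sub>d d(y))\<^sup>|\<^sup>U\<^sup>|\<close> with \<open>d\<close> running over \<open>D/T\<close>, which is nonzero for suitable \<open>y\<close> by the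
  independence of characters.\<close>
theorem inertia_not_subset:
  assumes p: "Factorial_Ring.prime (p::nat)" and char: "[p] \<cdot> \<one> = \<zero>"
    and H: "subgroup H G" and Q: "primeideal Q R" and I: "trace_image G R \<phi> H \<subseteq> Q"
  shows "\<not> inertia Q \<subseteq> H"
proof
  define T where "T = inertia Q"
  assume "inertia Q \<subseteq> H"
  then have TH: "T \<subseteq> H" by (simp add: T_def)
  interpret Q: primeideal Q R by fact
  have Qc: "Q \<subseteq> carrier R" by (rule primeideal_subset[OF Q])
  have T: "subgroup T G" unfolding T_def by (rule subgroup_inertia[OF Q.is_ideal])
  interpret T: subgroup T G by fact
  \<comment> \<open>Inclusion suffices to define the decomposition group, because each
    \<open>g\<close> has finite order.\<close>
  define D where "D = {g \<in> carrier G. \<phi> g ` Q \<subseteq> Q}"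
  have Dc: "D \<subseteq> carrier G" by (auto simp: D_def)
  have TD: "T \<subseteq> D"
    unfolding T_def D_def using inertia_subset_stabilizer[OF Q.is_ideal] inertiaD(1) by blast
  have DQ: "\<phi> g r \<in> Q" if "g \<in> D" "r \<in> Q" for g r using that by (auto simp: D_def)
  have Dinv: "inv\<^bsub>G\<^esub> g \<in> D" if "g \<in> D" for g
    using that stabilizer_inv[OF _ Qc] by (auto simp: D_def)
  have Dmult: "g \<otimes>\<^bsub>G\<^esub> h \<in> D" if "g \<in> D" "h \<in> D" for g h
  proof -
    have c: "g \<in> carrier G" "h \<in> carrier G" using that Dc by blast+
    have "\<phi> (g \<otimes>\<^bsub>G\<^esub> h) r \<in> Q" if "r \<in> Q" for r
      using act_comp[OF c, of r] DQ[OF \<open>g \<in> D\<close> DQ[OF \<open>h \<in> D\<close> that]] that Qc by auto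
    then show ?thesis using c by (auto simp: D_def)
  qed
  have cT: "card T > 0"
    unfolding card_gt_0_iff using T.one_closed finite_subset[OF T.subset finite_carrier] by blast
  obtain a m where m: "card T = p ^ a * m" "\<not> p dvd m"
  proof -
    have "card T \<noteq> 0" "\<not> is_unit p" using cT p not_prime_unit by auto
    then obtain m where "card T = p ^ multiplicity p (card T) * m" "\<not> p dvd m"
      by (rule multiplicity_decompose')
    then show thesis by (rule that)
  qed
  obtain U where U: "subgroup U G" "U \<subseteq> T" "card U = p ^ a"
  proof -
    interpret TG: group "G\<lparr>carrier := T\<rparr>" by (rule grp.subgroup_imp_group[OF T])
    have "\<exists>U. subgroup U (G\<lparr>carrier := T\<rparr>) \<and> card U = p ^ a"
      using m(1) T.subset finite_carrier
      by (intro sylow_thm[OF p TG.is_group]) (auto simp: order_def finite_subset)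
    then obtain U where "subgroup U (G\<lparr>carrier := T\<rparr>)" "card U = p ^ a" by blast
    then show thesis
      using that grp.incl_subgroup[OF T] subgroup.subset by fastforce
  qed
  interpret U: subgroup U G by (rule U(1))
  have UH: "U \<subseteq> H" using U(2) TH by blast
  have UD: "U \<subseteq> D" using U(2) TD by blast
  let ?K = "R Quot Q"
  interpret K: domain ?K by (rule Q.quotient_is_domain)
  define \<pi> where "\<pi> = (+>) Q"
  interpret \<pi>: ring_hom_cring R ?K \<pi> unfolding \<pi>_def by (rule Q.rcos_ring_hom_cring)
  have \<pi>0: "\<pi> r = \<zero>\<^bsub>?K\<^esub> \<longleftrightarrow> r \<in> Q" if "r \<in> carrier R" for r
  proof -
    have "\<zero>\<^bsub>?K\<^esub> = Q" by (simp add: FactRing_def)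
    then show ?thesis
      unfolding \<pi>_def using that Q.a_rcos_const Q.rcos_const_imp_mem by auto
  qed
  have \<pi>_iff: "\<pi> r = \<pi> s \<longleftrightarrow> r \<ominus> s \<in> Q" if "r \<in> carrier R" "s \<in> carrier R" for r s
    using \<pi>0[of "r \<ominus> s"] that by simp
  have \<pi>T: "\<pi> (\<phi> (g \<otimes>\<^bsub>G\<^esub> t) r) = \<pi> (\<phi> g r)" if g: "g \<in> D" and t: "t \<in> T" and r: "r \<in> carrier R" for g t r
  proof -
    have gc: "g \<in> carrier G" "t \<in> carrier G" using g t Dc T.subset by blast+
    have "\<phi> g (\<phi> t r \<ominus> r) \<in> Q" using DQ[OF g] inertiaD(2)[of t Q r] t r by (simp add: T_def)
    then show ?thesis using gc r by (simp add: \<pi>_iff act_comp)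
  qed
  \<comment> \<open>Here \<open>r\<close> need not be fixed by \<open>V\<close>; it is enough that
    \<open>V\<close> acts trivially modulo \<open>Q\<close>.\<close>
  have \<pi>c: "\<pi> (coset_act (g <#\<^bsub>G\<^esub> V) r) = \<pi> (\<phi> g r)"
    if g: "g \<in> D" and V: "subgroup V G" "V \<subseteq> T" and r: "r \<in> carrier R" for g V r
  proof -
    have gc: "g \<in> carrier G" using g Dc by blast
    obtain v where "v \<in> V" "(SOME h. h \<in> g <#\<^bsub>G\<^esub> V) = g \<otimes>\<^bsub>G\<^esub> v" by (rule grp.some_mem_lcos[OF V(1) gc])
    then show ?thesis using \<pi>T[OF g _ r, of v] V(2) unfolding coset_act_def by auto
  qed
  obtain c where c: "c \<in> carrier R" "c \<notin> Q" "\<And>g. g \<in> carrier G \<Longrightarrow> \<not> \<phi> g ` Q \<subseteq> Q \<Longrightarrow> \<phi> g c \<in> Q"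
    by (rule exists_separating_element[OF Q]) blast
  let ?X = "grp.cosets_of D T"
  define \<chi> where "\<chi> C r = \<pi> (coset_act C r)" for C r
  have \<chi>: "\<chi> (g <#\<^bsub>G\<^esub> T) r = \<pi> (\<phi> g r)" if "g \<in> D" "r \<in> carrier R" for g r
    unfolding \<chi>_def using \<pi>c[OF that(1) T subset_refl that(2)] .
  have finX: "finite ?X" by (rule finite_cosets_of[OF Dc])
  have "\<exists>z\<in>carrier R. (\<Oplus>\<^bsub>?K\<^esub>C\<in>?X. \<chi> C c \<otimes>\<^bsub>?K\<^esub> \<chi> C z) \<noteq> \<zero>\<^bsub>?K\<^esub>"
  proof (rule ccontr)
    assume neg: "\<not> ?thesis"
    have "\<forall>C\<in>?X. \<chi> C c = \<zero>\<^bsub>?K\<^esub>"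
    proof (rule Dedekind_independence[OF ring.ring_axioms K.domain_axioms finX])
      show "\<chi> C \<in> ring_hom R ?K" if "C \<in> ?X" for C
      proof -
        obtain g where g: "g \<in> D" "C = g <#\<^bsub>G\<^esub> T" using \<open>C \<in> ?X\<close> by blast
        have gc: "g \<in> carrier G" using g Dc by blast
        show ?thesis unfolding g(2) using g(1) gc by (intro ring_hom_memI) (simp_all add: \<chi>)
      qed
      \<comment> \<open>If two cosets induced the same homomorphism,
        \<open>inv h \<otimes> g\<close> would act trivially modulo \<open>Q\<close> and so lie in
        \<open>T\<close>.\<close>
      show "\<exists>w\<in>carrier R. \<chi> C w \<noteq> \<chi> C' w" if CC: "C \<in> ?X" "C' \<in> ?X" "C \<noteq> C'" for C C'
      proof (rule ccontr)
        assume same: "\<not> ?thesis"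
        obtain g where g: "g \<in> D" "C = g <#\<^bsub>G\<^esub> T" using CC(1) by blast
        obtain h where h: "h \<in> D" "C' = h <#\<^bsub>G\<^esub> T" using CC(2) by blast
        have cc: "g \<in> carrier G" "h \<in> carrier G" using g h Dc by blast+
        have triv: "\<phi> (inv\<^bsub>G\<^esub> h \<otimes>\<^bsub>G\<^esub> g) r \<ominus> r \<in> Q" if r: "r \<in> carrier R" for r
        proof -
          have "\<pi> (\<phi> g r) = \<pi> (\<phi> h r)" using same g h \<chi> r by auto
          then have "\<phi> g r \<ominus> \<phi> h r \<in> Q" using cc r by (simp add: \<pi>_iff)
          then have "\<phi> (inv\<^bsub>G\<^esub> h) (\<phi> g r \<ominus> \<phi> h r) \<in> Q" by (rule DQ[OF Dinv[OF h(1)]])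
          then show ?thesis using cc r by (simp add: act_comp)
        qed
        have "inv\<^bsub>G\<^esub> h \<otimes>\<^bsub>G\<^esub> g \<in> T"
          unfolding T_def inertia_def by (intro CollectI conjI ballI triv grp.m_closed grp.inv_closed cc)
        then have "(h \<otimes>\<^bsub>G\<^esub> (inv\<^bsub>G\<^esub> h \<otimes>\<^bsub>G\<^esub> g)) <#\<^bsub>G\<^esub> T = h <#\<^bsub>G\<^esub> T"
          by (rule grp.lcos_mult_mem[OF T cc(2)])
        then have "C = C'" using cc g h by (simp add: grp.m_assoc[symmetric])
        then show False using CC(3) by simp
      qed
      show "\<chi> C c \<in> carrier ?K" if "C \<in> ?X" for C
        using \<open>C \<in> ?X\<close> \<chi> c(1) Dc by auto
      show "(\<Oplus>\<^bsub>?K\<^esub>C\<in>?X. \<chi> C c \<otimes>\<^bsub>?K\<^esub> \<chi> C z) = \<zero>\<^bsub>?K\<^esub>" if "z \<in> carrier R" for z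
        using neg that by blast
    qed
    \<comment> \<open>The coefficient at the coset of the identity is the class of \<open>c\<close>,
      which is nonzero.\<close>
    moreover have "\<one>\<^bsub>G\<^esub> \<in> D" using TD T.one_closed by blast
    ultimately have "\<pi> (\<phi> \<one>\<^bsub>G\<^esub> c) = \<zero>\<^bsub>?K\<^esub>" using \<chi>[of "\<one>\<^bsub>G\<^esub>" c] c(1) by auto
    then show False using \<pi>0[OF c(1)] c by simp
  qed
  then obtain z where z: "z \<in> carrier R" "(\<Oplus>\<^bsub>?K\<^esub>C\<in>?X. \<chi> C c \<otimes>\<^bsub>?K\<^esub> \<chi> C z) \<noteq> \<zero>\<^bsub>?K\<^esub>" by blast
  \<comment> \<open>The factor \<open>c\<close> puts \<open>\<phi> g y\<close> into \<open>Q\<close>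
    for all \<open>g\<close> outside of \<open>D\<close>, and \<open>z\<close> keeps the sum over
    \<open>D/T\<close> nonzero modulo \<open>Q\<close>.\<close>
  define y where "y = c \<otimes> z"
  have yc: "y \<in> carrier R" using c z by (simp add: y_def)
  have \<chi>c: "\<chi> C r \<in> carrier ?K" if "C \<in> ?X" "r \<in> carrier R" for C r
    using that \<chi> Dc by auto
  have "\<chi> C y = \<chi> C c \<otimes>\<^bsub>?K\<^esub> \<chi> C z" if "C \<in> ?X" for C
    using that \<chi> c(1) z(1) Dc by (auto simp: y_def)
  then have "(\<Oplus>\<^bsub>?K\<^esub>C\<in>?X. \<chi> C y) = (\<Oplus>\<^bsub>?K\<^esub>C\<in>?X. \<chi> C c \<otimes>\<^bsub>?K\<^esub> \<chi> C z)"
    using \<chi>c c(1) z(1) by (intro K.finsum_cong') auto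
  then have sum: "(\<Oplus>\<^bsub>?K\<^esub>C\<in>?X. \<chi> C y) \<noteq> \<zero>\<^bsub>?K\<^esub>" using z by simp
  have y_out: "\<phi> g y \<in> Q" if "g \<in> carrier G" "g \<notin> D" for g
    using c(3)[of g] that c(1) z(1) by (auto simp: D_def y_def intro: Q.I_r_closed)
  \<comment> \<open>The trace from \<open>U\<close> needs a \<open>U\<close>-invariant element, and
    modulo \<open>Q\<close> the norm is just a power of \<open>y\<close>. A Sylow subgroup is used
    in place of \<open>T\<close> in order that the exponent is a power of \<open>p\<close>; the
    remaining multiplicity \<open>m\<close> is then prime to \<open>p\<close>.\<close>
  define n where "n = norm_over U y"
  have n: "n \<in> Fx U" unfolding n_def by (rule norm_over_Fx[OF U(1) yc])
  have nc: "n \<in> carrier R" using FxD(1)[OF n] .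
  have gn: "\<phi> g n = (\<Otimes>u\<in>U. \<phi> (g \<otimes>\<^bsub>G\<^esub> u) y)" if g: "g \<in> carrier G" for g
  proof -
    have "\<phi> g n = (\<Otimes>u\<in>U. \<phi> g (\<phi> u y))"
      unfolding n_def norm_over_def using g yc U.subset by (intro act_finprod) auto
    also have "\<dots> = (\<Otimes>u\<in>U. \<phi> (g \<otimes>\<^bsub>G\<^esub> u) y)"
      using g yc U.subset by (intro ring.finprod_cong') (auto simp: act_comp subset_iff)
    finally show ?thesis .
  qed
  have n_out: "\<phi> g n \<in> Q" if g: "g \<in> carrier G" "g \<notin> D" for g
    unfolding gn[OF g(1)]
  proof (rule Q.finprod_mem_ideal[OF ring.is_cring _ _ U.one_closed])
    show "finite U" using U.subset finite_carrier finite_subset by blast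
    show "(\<lambda>u. \<phi> (g \<otimes>\<^bsub>G\<^esub> u) y) \<in> U \<rightarrow> carrier R" using g yc U.subset by auto
    show "\<phi> (g \<otimes>\<^bsub>G\<^esub> \<one>\<^bsub>G\<^esub>) y \<in> Q" using y_out[OF g] g by simp
  qed
  have n_in: "\<pi> (\<phi> g n) = \<pi> (\<phi> g y) [^]\<^bsub>?K\<^esub> (p ^ a)" if g: "g \<in> D" for g
  proof -
    have gc: "g \<in> carrier G" using g Dc by blast
    have uc: "u \<in> carrier G" if "u \<in> U" for u using that U.subset by blast
    have "\<pi> (\<phi> g n) = (\<Otimes>\<^bsub>?K\<^esub>u\<in>U. \<pi> (\<phi> (g \<otimes>\<^bsub>G\<^esub> u) y))"
      unfolding gn[OF gc] using gc yc uc by (subst \<pi>.hom_finprod) (auto simp: comp_def)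
    also have "\<dots> = (\<Otimes>\<^bsub>?K\<^esub>u\<in>U. \<pi> (\<phi> g y))"
      using \<pi>T[OF g _ yc] U(2) gc yc by (intro K.finprod_cong') auto
    also have "\<dots> = \<pi> (\<phi> g y) [^]\<^bsub>?K\<^esub> card U" using gc yc by (intro K.finprod_const) auto
    finally show ?thesis by (simp add: U(3))
  qed
  define tr where "tr = trace_over (carrier G) U n"
  have trc: "tr \<in> carrier R" unfolding tr_def by (rule trace_over_closed[OF U(1) subset_refl n])
  have "tr \<in> trace_image G R \<phi> H"
  proof -
    have "tr = relative_trace G R \<phi> H (trace_over H U n)"
      unfolding tr_def relative_trace_eq by (rule trace_over_trans[OF U(1) H UH n, symmetric])
    then show ?thesis unfolding trace_image_def using trace_over_Fx[OF U(1) H n] by blast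
  qed
  then have "tr \<in> Q" using I by blast
  then have tr0: "\<pi> tr = \<zero>\<^bsub>?K\<^esub>" using \<pi>0[OF trc] by simp
  let ?Y = "grp.cosets_of (carrier G) U" and ?Z = "grp.cosets_of D U"
  have ca: "coset_act E n \<in> carrier R" if "E \<in> ?Y" for E
    using coset_act_closed[OF U(1) subset_refl n that] .
  have ZY: "?Z \<subseteq> ?Y" using Dc by blast
  let ?f = "\<lambda>E. \<pi> (coset_act E y) [^]\<^bsub>?K\<^esub> (p ^ a)"
  have fin: "finite ?Y" "finite ?Z" using finite_cosets_of[OF subset_refl] finite_cosets_of[OF Dc] .
  have fZ: "\<pi> (coset_act E n) = ?f E" if E: "E \<in> ?Z" for E
  proof -
    obtain g where g: "g \<in> D" "E = g <#\<^bsub>G\<^esub> U" using E by blast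
    then show ?thesis using n_in[OF g(1)] \<pi>c[OF g(1) U(1,2)] nc yc by simp
  qed
  have fc: "?f E \<in> carrier ?K" if "E \<in> ?Z" for E
    using fZ[OF that] ca[of E] that ZY by (metis \<pi>.hom_closed subsetD)
  have "\<pi> tr = (\<Oplus>\<^bsub>?K\<^esub>E\<in>?Y. \<pi> (coset_act E n))"
    unfolding tr_def trace_over_def using ca by (subst \<pi>.hom_finsum) (auto simp: comp_def)
  \<comment> \<open>Cosets outside of the decomposition group contribute zero by the choice of
    \<open>c\<close>.\<close>
  also have "\<dots> = (\<Oplus>\<^bsub>?K\<^esub>E\<in>?Z. ?f E)"
  proof (rule K.add.finprod_mono_neutral_cong_right[OF fin(1) ZY])
    show "\<pi> (coset_act E n) = \<zero>\<^bsub>?K\<^esub>" if E: "E \<in> ?Y - ?Z" for E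
    proof -
      from E obtain g where g: "g \<in> carrier G" "E = g <#\<^bsub>G\<^esub> U" "g \<notin> D" by blast
      then show "\<pi> (coset_act E n) = \<zero>\<^bsub>?K\<^esub>"
        using coset_act_eq[OF U(1) g(1) n] n_out[OF g(1,3)] \<pi>0[of "\<phi> g n"] nc by simp
    qed
    show "(\<lambda>E. \<pi> (coset_act E n)) \<in> ?Y \<rightarrow> carrier ?K" using ca by auto
  qed (use fZ in auto)
  \<comment> \<open>The cosets of \<open>U\<close> are grouped by the coset of \<open>T\<close> that
    contains them; each group consists of \<open>m\<close> equal summands.\<close>
  also have "\<dots> = (\<Oplus>\<^bsub>?K\<^esub>C\<in>?X. \<Oplus>\<^bsub>?K\<^esub>E\<in>{E \<in> ?Z. (SOME g. g \<in> E) <#\<^bsub>G\<^esub> T = C}. ?f E)"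
  proof -
    have im: "(\<lambda>E. (SOME g. g \<in> E) <#\<^bsub>G\<^esub> T) ` ?Z = ?X"
      unfolding image_image using grp.some_lcos_lcos[OF U(1) T U(2)] Dc by (intro image_cong) auto
    show ?thesis unfolding im[symmetric] by (rule K.finsum_fibres[OF fin(2) fc])
  qed
  also have "\<dots> = (\<Oplus>\<^bsub>?K\<^esub>C\<in>?X. [m] \<cdot>\<^bsub>?K\<^esub> \<one>\<^bsub>?K\<^esub> \<otimes>\<^bsub>?K\<^esub> \<chi> C y [^]\<^bsub>?K\<^esub> (p ^ a))"
  proof (rule K.finsum_cong')
    show "(\<lambda>C. [m] \<cdot>\<^bsub>?K\<^esub> \<one>\<^bsub>?K\<^esub> \<otimes>\<^bsub>?K\<^esub> \<chi> C y [^]\<^bsub>?K\<^esub> (p ^ a)) \<in> ?X \<rightarrow> carrier ?K"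
      using \<chi>c yc by auto
    fix C assume "C \<in> ?X"
    then obtain g where g: "g \<in> D" "C = g <#\<^bsub>G\<^esub> T" by blast
    have gc: "g \<in> carrier G" using g Dc by blast
    let ?F = "{E \<in> ?Z. (SOME g. g \<in> E) <#\<^bsub>G\<^esub> T = C}"
    have F: "?F = (\<lambda>E. g <#\<^bsub>G\<^esub> E) ` grp.cosets_of T U"
      unfolding g(2) using TD Dmult by (intro grp.coset_fibre[OF U(1) T U(2) Dc _ g(1)]) auto
    have cardF: "card ?F = m"
    proof -
      have "card ?F = card (grp.cosets_of T U)"
        unfolding F using grp.inj_on_lcos[OF gc] grp.cosets_of_subset_Pow[OF T.subset U.subset]
        by (intro card_image) (rule inj_on_subset)
      moreover have "card (grp.cosets_of T U) * card U = card T"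
      proof -
        interpret TG: group "G\<lparr>carrier := T\<rparr>" by (rule grp.subgroup_imp_group[OF T])
        have "card (lcosets\<^bsub>G\<lparr>carrier := T\<rparr>\<^esub> U) * card U = order (G\<lparr>carrier := T\<rparr>)"
          using finite_subset[OF T.subset finite_carrier]
          by (intro TG.l_lagrange grp.subgroup_incl[OF U(1) T U(2)]) simp
        then show ?thesis by (simp add: TG.lcosets_eq_cosets_of order_def)
      qed
      ultimately show ?thesis using m(1) U(3) prime_gt_0_nat[OF p] by simp
    qed
    have "(\<Oplus>\<^bsub>?K\<^esub>E\<in>?F. ?f E) = (\<Oplus>\<^bsub>?K\<^esub>E\<in>?F. \<chi> C y [^]\<^bsub>?K\<^esub> (p ^ a))"
    proof (rule K.finsum_cong')
      show "(\<lambda>E. \<chi> C y [^]\<^bsub>?K\<^esub> (p ^ a)) \<in> ?F \<rightarrow> carrier ?K"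
        using \<chi>c[OF \<open>C \<in> ?X\<close> yc] by auto
      fix E assume "E \<in> ?F"
      then obtain t where t: "t \<in> T" "E = g <#\<^bsub>G\<^esub> (t <#\<^bsub>G\<^esub> U)" unfolding F by blast
      have tc: "t \<in> carrier G" using t T.subset by blast
      have "E = (g \<otimes>\<^bsub>G\<^esub> t) <#\<^bsub>G\<^esub> U" using t(2) gc tc U.subset by (simp add: grp.lcos_m_assoc)
      then have "\<pi> (coset_act E y) = \<pi> (\<phi> (g \<otimes>\<^bsub>G\<^esub> t) y)"
        using \<pi>c[OF Dmult[OF g(1), of t] U(1,2) yc] t(1) TD by auto
      also have "\<dots> = \<chi> C y" unfolding g(2) \<chi>[OF g(1) yc] by (rule \<pi>T[OF g(1) t(1) yc])
      finally show "?f E = \<chi> C y [^]\<^bsub>?K\<^esub> (p ^ a)" by simp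
    qed simp
    also have "\<dots> = [m] \<cdot>\<^bsub>?K\<^esub> (\<chi> C y [^]\<^bsub>?K\<^esub> (p ^ a))"
      using K.add.finprod_const[of "\<chi> C y [^]\<^bsub>?K\<^esub> (p ^ a)" ?F] \<chi>c[OF \<open>C \<in> ?X\<close> yc] cardF by simp
    also have "\<dots> = [m] \<cdot>\<^bsub>?K\<^esub> \<one>\<^bsub>?K\<^esub> \<otimes>\<^bsub>?K\<^esub> \<chi> C y [^]\<^bsub>?K\<^esub> (p ^ a)"
      using \<chi>c[OF \<open>C \<in> ?X\<close> yc] by (intro K.add_pow_one_mult) simp
    finally show "(\<Oplus>\<^bsub>?K\<^esub>E\<in>?F. ?f E) = [m] \<cdot>\<^bsub>?K\<^esub> \<one>\<^bsub>?K\<^esub> \<otimes>\<^bsub>?K\<^esub> \<chi> C y [^]\<^bsub>?K\<^esub> (p ^ a)" .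
  qed simp
  also have "\<dots> = [m] \<cdot>\<^bsub>?K\<^esub> \<one>\<^bsub>?K\<^esub> \<otimes>\<^bsub>?K\<^esub> (\<Oplus>\<^bsub>?K\<^esub>C\<in>?X. \<chi> C y [^]\<^bsub>?K\<^esub> (p ^ a))"
    using finX \<chi>c yc by (intro K.finsum_rdistr[symmetric]) auto
  \<comment> \<open>Raising to the power \<open>p ^ a\<close> is additive in characteristic
    \<open>p\<close>.\<close>
  also have "(\<Oplus>\<^bsub>?K\<^esub>C\<in>?X. \<chi> C y [^]\<^bsub>?K\<^esub> (p ^ a)) = (\<Oplus>\<^bsub>?K\<^esub>C\<in>?X. \<chi> C y) [^]\<^bsub>?K\<^esub> (p ^ a)"
  proof (rule K.frobenius_finsum[OF p _ finX, symmetric])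
    have nat: "\<pi> ([(k::nat)] \<cdot> \<one>) = [k] \<cdot>\<^bsub>?K\<^esub> \<one>\<^bsub>?K\<^esub>" for k by (induction k) auto
    show "[p] \<cdot>\<^bsub>?K\<^esub> \<one>\<^bsub>?K\<^esub> = \<zero>\<^bsub>?K\<^esub>" unfolding nat[symmetric] char by simp
    show "(\<lambda>C. \<chi> C y) \<in> ?X \<rightarrow> carrier ?K" using \<chi>c yc by auto
  qed
  finally have 0: "[m] \<cdot>\<^bsub>?K\<^esub> \<one>\<^bsub>?K\<^esub> \<otimes>\<^bsub>?K\<^esub> (\<Oplus>\<^bsub>?K\<^esub>C\<in>?X. \<chi> C y) [^]\<^bsub>?K\<^esub> (p ^ a) = \<zero>\<^bsub>?K\<^esub>"
    using tr0 by simp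
  have nat: "\<pi> ([(k::nat)] \<cdot> \<one>) = [k] \<cdot>\<^bsub>?K\<^esub> \<one>\<^bsub>?K\<^esub>" for k by (induction k) auto
  have "[int m] \<cdot> \<one> \<notin> Q" using ring.of_int_notin_prime[OF p char Q] m(2) by simp
  then have "[m] \<cdot> \<one> \<notin> Q" by (simp add: add_pow_int_ge)
  then have "\<pi> ([m] \<cdot> \<one>) \<noteq> \<zero>\<^bsub>?K\<^esub>" using \<pi>0 by simp
  then have m0: "[m] \<cdot>\<^bsub>?K\<^esub> \<one>\<^bsub>?K\<^esub> \<noteq> \<zero>\<^bsub>?K\<^esub>" unfolding nat .
  have Sc: "(\<Oplus>\<^bsub>?K\<^esub>C\<in>?X. \<chi> C y) \<in> carrier ?K" using \<chi>c yc by (intro K.finsum_closed) auto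
  have "(\<Oplus>\<^bsub>?K\<^esub>C\<in>?X. \<chi> C y) [^]\<^bsub>?K\<^esub> (k::nat) \<noteq> \<zero>\<^bsub>?K\<^esub>" for k
    using sum Sc by (induction k) (auto simp: K.integral_iff)
  then show False using 0 m0 Sc K.integral[OF 0] by auto
qed

end

subsection \<open>Vanishing of first cohomology and the main theorem\<close>

context cring
begin

lemma weakly_regular_Nil: "weakly_regular []"
  by (simp add: weakly_regular_def)

lemma weakly_regular_snoc:
  assumes "weakly_regular xs" "a \<in> carrier R"
    and "\<And>r. r \<in> carrier R \<Longrightarrow> a \<otimes> r \<in> Idl (set xs) \<Longrightarrow> r \<in> Idl (set xs)"
  shows "weakly_regular (xs @ [a])"
  using assms by (auto simp: weakly_regular_def nth_append less_Suc_eq)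

lemma prime_height_assoc_max:
  assumes "cohen_macaulay R" "weakly_regular as" "length as \<le> 2" "P \<in> assoc_max (Idl (set as))"
  shows "prime_height R P \<le> 2"
proof -
  have id: "ideal (Idl (set as)) R" using assms(2) by (intro genideal_ideal) (simp add: weakly_regular_def)
  obtain x where x: "x \<in> carrier R" "x \<notin> Idl (set as)" "P = quotient_ideal (Idl (set as)) x"
    using assms(4) unfolding assoc_max_def by blast
  have "prime_height R P \<le> enat (length as)"
    using assms(1) primeideal_assoc_max[OF id assms(4)] assms(2,3) x(1,2)
    by (rule cohen_macaulay_unmixed) (simp add: x(3) quotient_ideal_def)
  also have "\<dots> \<le> enat 2" using assms(3) by simp
  finally show ?thesis by (simp add: numeral_eq_enat)
qed

end

context finite_ring_action
begin

lemma trace_over_mult: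
  assumes U: "subgroup U G" and N: "N \<subseteq> carrier G" and UN: "U \<subseteq> N" and r: "r \<in> Fx U" and a: "a \<in> Fx N"
  shows "trace_over N U (a \<otimes> r) = a \<otimes> trace_over N U r"
proof -
  have Uc: "U \<subseteq> carrier G" by (rule subgroup.subset[OF U])
  have ac: "a \<in> carrier R" using FxD(1)[OF a] .
  have aU: "a \<in> Fx U" using a Fx_mono[OF UN] by blast
  have "trace_over N U (a \<otimes> r) = (\<Oplus>C\<in>grp.cosets_of N U. a \<otimes> coset_act C r)"
    unfolding trace_over_def
  proof (rule ring.finsum_cong')
    show "(\<lambda>C. a \<otimes> coset_act C r) \<in> grp.cosets_of N U \<rightarrow> carrier R"
      using coset_act_closed[OF U N r] ac by auto
    fix C assume "C \<in> grp.cosets_of N U"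
    then obtain x where x: "x \<in> N" "C = x <#\<^bsub>G\<^esub> U" by blast
    have xc: "x \<in> carrier G" using x N by blast
    show "coset_act C (a \<otimes> r) = a \<otimes> coset_act C r"
      unfolding x(2) coset_act_eq[OF U xc r] coset_act_eq[OF U xc Fx_mult[OF Uc aU r]]
      using xc ac FxD(1)[OF r] FxD(2)[OF a x(1)] by simp
  qed simp
  also have "\<dots> = a \<otimes> trace_over N U r"
    unfolding trace_over_def using coset_act_closed[OF U N r] ac finite_cosets_of[OF N]
    by (intro ring.finsum_rdistr[symmetric]) auto
  finally show ?thesis .
qed

lemma trace_over_add:
  assumes U: "subgroup U G" and N: "N \<subseteq> carrier G" and r: "r \<in> Fx U" "s \<in> Fx U"
  shows "trace_over N U (r \<oplus> s) = trace_over N U r \<oplus> trace_over N U s"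
proof -
  have Uc: "U \<subseteq> carrier G" by (rule subgroup.subset[OF U])
  have "trace_over N U (r \<oplus> s) = (\<Oplus>C\<in>grp.cosets_of N U. coset_act C r \<oplus> coset_act C s)"
    unfolding trace_over_def
  proof (rule ring.finsum_cong')
    show "(\<lambda>C. coset_act C r \<oplus> coset_act C s) \<in> grp.cosets_of N U \<rightarrow> carrier R"
      using coset_act_closed[OF U N r(1)] coset_act_closed[OF U N r(2)] by auto
    fix C assume "C \<in> grp.cosets_of N U"
    then obtain x where x: "x \<in> N" "C = x <#\<^bsub>G\<^esub> U" by blast
    have xc: "x \<in> carrier G" using x N by blast
    show "coset_act C (r \<oplus> s) = coset_act C r \<oplus> coset_act C s"
      unfolding x(2) coset_act_eq[OF U xc r(1)] coset_act_eq[OF U xc r(2)]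
        coset_act_eq[OF U xc Fx_add[OF Uc r]]
      using xc FxD(1)[OF r(1)] FxD(1)[OF r(2)] by simp
  qed simp
  also have "\<dots> = trace_over N U r \<oplus> trace_over N U s"
    unfolding trace_over_def using coset_act_closed[OF U N r(1)] coset_act_closed[OF U N r(2)]
    by (intro ring.finsum_addf) auto
  finally show ?thesis .
qed

lemma trace_image_eq: "trace_image G R \<phi> U = trace_over (carrier G) U ` Fx U"
  unfolding trace_image_def relative_trace_eq ..

lemma trace_image_subset: "subgroup U G \<Longrightarrow> trace_image G R \<phi> U \<subseteq> Fx (carrier G)"
  unfolding trace_image_eq using trace_over_Fx[OF _ grp.subgroup_self] by blast

lemma ideal_trace_image:
  assumes A: "cring A" and U: "subgroup U G"
  shows "ideal (trace_image G R \<phi> U) A"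
proof -
  interpret A: cring A by fact
  have Uc: "U \<subseteq> carrier G" by (rule subgroup.subset[OF U])
  note sub = trace_image_subset[OF U]
  have mult: "x \<otimes> a \<in> trace_image G R \<phi> U" if a: "a \<in> trace_image G R \<phi> U" and x: "x \<in> Fx (carrier G)" for a x
  proof -
    obtain r where r: "r \<in> Fx U" "a = trace_over (carrier G) U r" using a unfolding trace_image_eq by blast
    have "x \<in> Fx U" using x Fx_mono[OF Uc] by blast
    then have "x \<otimes> r \<in> Fx U" using r(1) by (rule Fx_mult[OF Uc])
    moreover have "x \<otimes> a = trace_over (carrier G) U (x \<otimes> r)"
      using trace_over_mult[OF U subset_refl Uc r(1) x] r(2) by simp
    ultimately show ?thesis unfolding trace_image_eq by blast
  qed
  show ?thesis
  proof (rule idealI)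
    show "subgroup (trace_image G R \<phi> U) (add_monoid A)"
    proof (rule A.add.subgroupI)
      show "trace_image G R \<phi> U \<subseteq> carrier A" using sub by simp
      show "trace_image G R \<phi> U \<noteq> {}" unfolding trace_image_eq using Fx_zero[OF Uc] by blast
      show "\<ominus>\<^bsub>A\<^esub> a \<in> trace_image G R \<phi> U" if a: "a \<in> trace_image G R \<phi> U" for a
      proof -
        have aF: "a \<in> carrier A" using a sub by auto
        \<comment> \<open>Negation in \<open>A\<close> is not literally negation in
          \<open>R\<close>, so it is expressed as multiplication by an element of
          \<open>A\<close>.\<close>
        have "\<ominus>\<^bsub>A\<^esub> a = (\<ominus>\<^bsub>A\<^esub> \<one>\<^bsub>A\<^esub>) \<otimes>\<^bsub>A\<^esub> a" using aF by (subst A.l_minus) (simp_all del: A_simps)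
        also have "\<dots> \<in> trace_image G R \<phi> U"
          using mult[OF a, of "\<ominus>\<^bsub>A\<^esub> \<one>\<^bsub>A\<^esub>"] A.a_inv_closed[OF A.one_closed] by simp
        finally show ?thesis .
      qed
      show "a \<oplus>\<^bsub>A\<^esub> b \<in> trace_image G R \<phi> U"
        if ab: "a \<in> trace_image G R \<phi> U" "b \<in> trace_image G R \<phi> U" for a b
      proof -
        obtain r s where r: "r \<in> Fx U" "a = trace_over (carrier G) U r"
          and s: "s \<in> Fx U" "b = trace_over (carrier G) U s"
          using ab unfolding trace_image_eq by blast
        then have "a \<oplus> b = trace_over (carrier G) U (r \<oplus> s)" by (simp add: trace_over_add[OF U subset_refl])
        then show ?thesis unfolding trace_image_eq using Fx_add[OF Uc r(1) s(1)] by auto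
      qed
    qed
    show "x \<otimes>\<^bsub>A\<^esub> a \<in> trace_image G R \<phi> U" if "a \<in> trace_image G R \<phi> U" "x \<in> carrier A" for a x
      using mult that by simp
    show "a \<otimes>\<^bsub>A\<^esub> x \<in> trace_image G R \<phi> U" if "a \<in> trace_image G R \<phi> U" "x \<in> carrier A" for a x
      using mult[OF that(1), of x] that A.m_comm[of a x] sub by auto
  qed (rule A.ring_axioms)
qed

section \<open>Homomorphisms to the prime field as classes in first cohomology\<close>

context
  fixes p :: nat
  assumes p: "Factorial_Ring.prime p" and char: "[p] \<cdot> \<one> = \<zero>"
begin

text \<open>That is, \<open>a\<close> annihilates the class of \<open>f\<close> in \<open>H\<^sup>1(N, R)\<close>. If \<open>a\<close> is the trace of \<open>b\<close>, then \<open>u\<close> is the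
  sum of the \<open>- w(g) g(b)\<close>, where \<open>w\<close> extends \<open>f\<close> to \<open>G/H\<close> such that \<open>w(n g) = f(n) + w(g)\<close> for \<open>n \<in> N\<close>.\<close>
lemma trace_image_kills_hom:
  assumes H: "H \<lhd> G" and N: "subgroup N G" and HN: "H \<subseteq> N"
    and f: "\<And>g h. g \<in> N \<Longrightarrow> h \<in> N \<Longrightarrow> f (g \<otimes>\<^bsub>G\<^esub> h) = (f g + f h) mod int p"
    and fH: "\<And>h. h \<in> H \<Longrightarrow> f h = 0"
    and a: "a \<in> trace_image G R \<phi> H"
  obtains u where "u \<in> carrier R" "\<And>n. n \<in> N \<Longrightarrow> \<phi> n u = u \<oplus> a \<otimes> [(f n :: int)] \<cdot> \<one>"
proof -
  interpret H: normal H G by fact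
  interpret N: subgroup N G by fact
  note Hs = H.is_subgroup
  let ?e = "\<lambda>k::int. [k] \<cdot> \<one>"
  have ec: "?e k \<in> carrier R" for k by (rule ring.of_int_closed[OF p char])
  have Nc: "n \<in> carrier G" if "n \<in> N" for n using that N.subset by blast
  obtain b where b: "b \<in> Fx H" "a = trace_over (carrier G) H b" using a unfolding trace_image_eq by blast
  \<comment> \<open>The representative depends only on the coset \<open>N g\<close>, so that
    \<open>s (n g) = s g\<close>.\<close>
  define s where "s g = (SOME x. x \<in> N #>\<^bsub>G\<^esub> g)" for g
  have s: "\<exists>n\<in>N. s g = n \<otimes>\<^bsub>G\<^esub> g" if "g \<in> carrier G" for g
  proof -
    have "s g \<in> N #>\<^bsub>G\<^esub> g" unfolding s_def by (rule someI[of _ g]) (rule grp.rcos_self[OF that N])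
    then show ?thesis by (auto simp: r_coset_def)
  qed
  have gs: "g \<otimes>\<^bsub>G\<^esub> inv\<^bsub>G\<^esub> (s g) \<in> N" "s g \<in> carrier G" if g: "g \<in> carrier G" for g
  proof -
    obtain n where n: "n \<in> N" "s g = n \<otimes>\<^bsub>G\<^esub> g" using s[OF g] by blast
    have "g \<otimes>\<^bsub>G\<^esub> inv\<^bsub>G\<^esub> (s g) = inv\<^bsub>G\<^esub> n"
      unfolding n(2) using g Nc[OF n(1)] by (simp add: grp.inv_mult_group grp.m_assoc[symmetric])
    then show "g \<otimes>\<^bsub>G\<^esub> inv\<^bsub>G\<^esub> (s g) \<in> N" using n(1) by simp
    show "s g \<in> carrier G" using n g Nc by simp
  qed
  have sN: "s (n \<otimes>\<^bsub>G\<^esub> g) = s g" if n: "n \<in> N" and g: "g \<in> carrier G" for n g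
  proof -
    have "N #>\<^bsub>G\<^esub> (n \<otimes>\<^bsub>G\<^esub> g) = (N #>\<^bsub>G\<^esub> n) #>\<^bsub>G\<^esub> g"
      using n g Nc N.subset by (simp add: grp.coset_mult_assoc)
    also have "N #>\<^bsub>G\<^esub> n = N" using grp.coset_join2[OF Nc[OF n] N n] .
    finally show ?thesis unfolding s_def by simp
  qed
  \<comment> \<open>Each \<open>g\<close> is an element of \<open>N\<close> times the representative
    \<open>s g\<close>, and \<open>f\<close> is applied to that element.\<close>
  define w where "w g = ?e (f (g \<otimes>\<^bsub>G\<^esub> inv\<^bsub>G\<^esub> (s g)))" for g
  have wc: "w g \<in> carrier R" for g unfolding w_def by (rule ec)
  have wN: "w (n \<otimes>\<^bsub>G\<^esub> g) = ?e (f n) \<oplus> w g" if n: "n \<in> N" and g: "g \<in> carrier G" for n g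
  proof -
    have "n \<otimes>\<^bsub>G\<^esub> g \<otimes>\<^bsub>G\<^esub> inv\<^bsub>G\<^esub> (s g) = n \<otimes>\<^bsub>G\<^esub> (g \<otimes>\<^bsub>G\<^esub> inv\<^bsub>G\<^esub> (s g))"
      using Nc[OF n] g gs(2)[OF g] by (simp add: grp.m_assoc)
    then show ?thesis
      unfolding w_def sN[OF n g] using f[OF n gs(1)[OF g]]
      by (simp only: ring.of_int_mod[OF p char] ring.of_int_add[OF p char])
  qed
  \<comment> \<open>As \<open>H\<close> is normal, \<open>g h = k g\<close> with
    \<open>k \<in> H\<close>, where \<open>f\<close> vanishes. Hence \<open>w\<close> is a function
    on \<open>G/H\<close>.\<close>
  have wH: "w (g \<otimes>\<^bsub>G\<^esub> h) = w g" if g: "g \<in> carrier G" and h: "h \<in> H" for g h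
  proof -
    have hc: "h \<in> carrier G" using h H.subset by blast
    obtain k where k: "k \<in> H" "g \<otimes>\<^bsub>G\<^esub> h = k \<otimes>\<^bsub>G\<^esub> g"
    proof (rule that)
      show "g \<otimes>\<^bsub>G\<^esub> h \<otimes>\<^bsub>G\<^esub> inv\<^bsub>G\<^esub> g \<in> H" by (rule H.inv_op_closed2[OF g h])
      show "g \<otimes>\<^bsub>G\<^esub> h = g \<otimes>\<^bsub>G\<^esub> h \<otimes>\<^bsub>G\<^esub> inv\<^bsub>G\<^esub> g \<otimes>\<^bsub>G\<^esub> g"
        using g hc by (simp add: grp.m_assoc)
    qed
    have "k \<in> N" using k(1) HN by blast
    then show ?thesis unfolding k(2) using wN[OF _ g] fH[OF k(1)] wc by (simp add: ring.of_int_zero)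
  qed
  define W where "W C = w (SOME g. g \<in> C)" for C
  have W: "W (x <#\<^bsub>G\<^esub> H) = w x" if x: "x \<in> carrier G" for x
  proof -
    obtain h where "h \<in> H" "(SOME g. g \<in> x <#\<^bsub>G\<^esub> H) = x \<otimes>\<^bsub>G\<^esub> h" by (rule grp.some_mem_lcos[OF Hs x])
    then show ?thesis unfolding W_def using wH[OF x] by simp
  qed
  let ?X = "grp.cosets_of (carrier G) H"
  have bc: "coset_act C b \<in> carrier R" if "C \<in> ?X" for C
    using coset_act_closed[OF Hs subset_refl b(1) that] .
  have Wc: "W C \<in> carrier R" for C unfolding W_def by (rule wc)
  have actW: "\<phi> g (W C) = W C" if "g \<in> carrier G" for g C
    unfolding W_def w_def by (rule act_of_int[OF that])
  define u where "u = (\<Oplus>C\<in>?X. W C \<otimes> coset_act C b)"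
  have uc: "u \<in> carrier R" unfolding u_def using bc Wc by (intro ring.finsum_closed) auto
  \<comment> \<open>Translation by \<open>n\<close> permutes the cosets and raises the weight of
    each by \<open>f n\<close>; the total excess is \<open>f n\<close> times the trace
    \<open>a\<close> of \<open>b\<close>.\<close>
  have act_u: "\<phi> n u = u \<ominus> a \<otimes> ?e (f n)" if n: "n \<in> N" for n
  proof -
    have nc: "n \<in> carrier G" by (rule Nc[OF n])
    let ?g = "\<lambda>C. W C \<otimes> coset_act C b \<oplus> (\<ominus> ?e (f n)) \<otimes> coset_act C b"
    have g: "?g \<in> ?X \<rightarrow> carrier R" using bc Wc ec by auto
    have im: "(\<lambda>D. n <#\<^bsub>G\<^esub> D) ` ?X = ?X" by (rule translate_cosets_of[OF Hs grp.subgroup_self nc])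
    have nX: "n <#\<^bsub>G\<^esub> C \<in> ?X" if "C \<in> ?X" for C
      by (subst im[symmetric]) (rule imageI[OF that])
    have "\<phi> n u = (\<Oplus>C\<in>?X. \<phi> n (W C \<otimes> coset_act C b))"
      unfolding u_def using bc Wc by (intro act_finsum nc) auto
    also have "\<dots> = (\<Oplus>C\<in>?X. ?g (n <#\<^bsub>G\<^esub> C))"
    proof (rule ring.finsum_cong')
      show "(\<lambda>C. ?g (n <#\<^bsub>G\<^esub> C)) \<in> ?X \<rightarrow> carrier R"
        by (intro Pi_I funcset_mem[OF g] nX)
      fix C assume C: "C \<in> ?X"
      then obtain x where x: "x \<in> carrier G" "C = x <#\<^bsub>G\<^esub> H" by blast
      have e: "n <#\<^bsub>G\<^esub> C = (n \<otimes>\<^bsub>G\<^esub> x) <#\<^bsub>G\<^esub> H"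
        unfolding x(2) using x nc H.subset by (simp add: grp.lcos_m_assoc)
      have WnC: "W (n <#\<^bsub>G\<^esub> C) = ?e (f n) \<oplus> W C"
        using e W[OF grp.m_closed[OF nc x(1)]] wN[OF n x(1)] W[OF x(1)] x(2) by simp
      have ca: "\<phi> n (coset_act C b) = coset_act (n <#\<^bsub>G\<^esub> C) b"
        by (rule act_coset_act[OF Hs subset_refl b(1) C nc])
      have cl: "W C \<in> carrier R" "?e (f n) \<in> carrier R" "\<phi> n (coset_act C b) \<in> carrier R"
        using Wc ec bc[OF C] nc by auto
      have "\<phi> n (W C \<otimes> coset_act C b) = W C \<otimes> \<phi> n (coset_act C b)"
        using nc Wc bc[OF C] by (simp add: actW)
      also have "\<dots> = (?e (f n) \<oplus> W C) \<otimes> \<phi> n (coset_act C b) \<oplus> (\<ominus> ?e (f n)) \<otimes> \<phi> n (coset_act C b)"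
        using cl by algebra
      finally show "\<phi> n (W C \<otimes> coset_act C b) = ?g (n <#\<^bsub>G\<^esub> C)" unfolding WnC ca .
    qed simp
    also have "\<dots> = (\<Oplus>C\<in>(\<lambda>D. n <#\<^bsub>G\<^esub> D) ` ?X. ?g C)"
    proof (rule ring.finsum_reindex[symmetric])
      show "?g \<in> (\<lambda>D. n <#\<^bsub>G\<^esub> D) ` ?X \<rightarrow> carrier R" unfolding im by (rule g)
      show "inj_on (\<lambda>D. n <#\<^bsub>G\<^esub> D) ?X"
        using grp.inj_on_lcos[OF nc] grp.cosets_of_subset_Pow[OF subset_refl H.subset] by (rule inj_on_subset)
    qed
    also have "\<dots> = u \<oplus> (\<Oplus>C\<in>?X. (\<ominus> ?e (f n)) \<otimes> coset_act C b)"
      unfolding im u_def using bc Wc ec by (intro ring.finsum_addf) auto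
    also have "(\<Oplus>C\<in>?X. (\<ominus> ?e (f n)) \<otimes> coset_act C b) = (\<ominus> ?e (f n)) \<otimes> a"
      unfolding b(2) trace_over_def using bc ec finite_cosets_of[OF subset_refl]
      by (intro ring.finsum_rdistr[symmetric]) auto
    also have "u \<oplus> (\<ominus> ?e (f n)) \<otimes> a = u \<ominus> a \<otimes> ?e (f n)"
    proof -
      have "a \<in> carrier R" "?e (f n) \<in> carrier R"
        using b(2) trace_over_closed[OF Hs subset_refl b(1)] ec by auto
      then show ?thesis using uc by algebra
    qed
    finally show ?thesis .
  qed
  have ac: "a \<in> carrier R" using b(2) trace_over_closed[OF Hs subset_refl b(1)] by simp
  show thesis
  proof (rule that[of "\<ominus> u"])
    show "\<ominus> u \<in> carrier R" using uc by simp
    fix n assume n: "n \<in> N"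
    have "\<ominus> (u \<ominus> a \<otimes> ?e (f n)) = \<ominus> u \<oplus> a \<otimes> ?e (f n)" using uc ac ec[of "f n"] by algebra
    then show "\<phi> n (\<ominus> u) = \<ominus> u \<oplus> a \<otimes> ?e (f n)" using act_u[OF n] uc Nc[OF n] by simp
  qed
qed

text \<open>That is, \<open>a3\<close> is a nonzerodivisor on \<open>R\<^sup>N/(a1, a2)\<close>.
  This is the only part of the regularity on \<open>R\<^sup>G\<close> that is carried to smaller
  subgroups.\<close>

definition regular_on :: "'a \<Rightarrow> 'a \<Rightarrow> 'a \<Rightarrow> 'g set \<Rightarrow> bool" where
  "regular_on a1 a2 a3 N \<longleftrightarrow> (\<forall>x\<in>Fx N. \<forall>y\<in>Fx N. \<forall>z\<in>Fx N. a3 \<otimes> x = a1 \<otimes> y \<oplus> a2 \<otimes> z \<longrightarrow>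
     (\<exists>y\<in>Fx N. \<exists>z\<in>Fx N. x = a1 \<otimes> y \<oplus> a2 \<otimes> z))"

text \<open>The \<open>a\<^sub>i u\<^sub>j - a\<^sub>j u\<^sub>i\<close> are invariant under \<open>N\<close>, so regularity on \<open>R\<^sup>N\<close> allows to change \<open>u\<^sub>1\<close> by an
  invariant to a multiple of \<open>a\<^sub>1\<close>.\<close>
lemma cocycle_vanishes:
  assumes N: "N \<subseteq> carrier G" and a: "a1 \<in> Fx (carrier G)" "a2 \<in> Fx (carrier G)" "a3 \<in> Fx (carrier G)"
    and reg: "ring.weakly_regular [a1, a2]" and regN: "regular_on a1 a2 a3 N"
    and e: "\<And>n. e n \<in> carrier R"
    and u1: "u1 \<in> carrier R" "\<And>n. n \<in> N \<Longrightarrow> \<phi> n u1 = u1 \<oplus> a1 \<otimes> e n"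
    and u2: "u2 \<in> carrier R" "\<And>n. n \<in> N \<Longrightarrow> \<phi> n u2 = u2 \<oplus> a2 \<otimes> e n"
    and u3: "u3 \<in> carrier R" "\<And>n. n \<in> N \<Longrightarrow> \<phi> n u3 = u3 \<oplus> a3 \<otimes> e n"
  obtains w where "w \<in> carrier R" "\<And>n. n \<in> N \<Longrightarrow> \<phi> n w = w \<oplus> e n"
proof -
  have inv: "b \<otimes> v \<ominus> c \<otimes> u \<in> Fx N"
    if b: "b \<in> Fx (carrier G)" and c: "c \<in> Fx (carrier G)"
      and u: "u \<in> carrier R" "\<And>n. n \<in> N \<Longrightarrow> \<phi> n u = u \<oplus> b \<otimes> e n"
      and v: "v \<in> carrier R" "\<And>n. n \<in> N \<Longrightarrow> \<phi> n v = v \<oplus> c \<otimes> e n" for b c u v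
  proof (rule FxI)
    have cc: "b \<in> carrier R" "c \<in> carrier R" using FxD(1) b c by auto
    show "b \<otimes> v \<ominus> c \<otimes> u \<in> carrier R" using cc u(1) v(1) by simp
    fix n assume n: "n \<in> N"
    have nc: "n \<in> carrier G" using n N by blast
    have "\<phi> n (b \<otimes> v \<ominus> c \<otimes> u) = b \<otimes> (v \<oplus> c \<otimes> e n) \<ominus> c \<otimes> (u \<oplus> b \<otimes> e n)"
      using nc cc u v n FxD(2)[OF b nc] FxD(2)[OF c nc] by simp
    also have "\<dots> = b \<otimes> v \<ominus> c \<otimes> u" using cc u(1) v(1) e[of n] by algebra
    finally show "\<phi> n (b \<otimes> v \<ominus> c \<otimes> u) = b \<otimes> v \<ominus> c \<otimes> u" .
  qed
  have ac: "a1 \<in> carrier R" "a2 \<in> carrier R" "a3 \<in> carrier R" using a FxD(1) by auto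
  have 12: "a1 \<otimes> u2 \<ominus> a2 \<otimes> u1 \<in> Fx N" by (rule inv[OF a(1,2) u1 u2])
  have 32: "a3 \<otimes> u2 \<ominus> a2 \<otimes> u3 \<in> Fx N" by (rule inv[OF a(3,2) u3 u2])
  have 13: "a1 \<otimes> u3 \<ominus> a3 \<otimes> u1 \<in> Fx N" by (rule inv[OF a(1,3) u1 u3])
  \<comment> \<open>The Koszul relation of the three invariants, to which the regularity of
    \<open>a3\<close> applies.\<close>
  have "a3 \<otimes> (a1 \<otimes> u2 \<ominus> a2 \<otimes> u1) = a1 \<otimes> (a3 \<otimes> u2 \<ominus> a2 \<otimes> u3) \<oplus> a2 \<otimes> (a1 \<otimes> u3 \<ominus> a3 \<otimes> u1)"
    using ac u1(1) u2(1) u3(1) by algebra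
  then obtain y z where yz: "y \<in> Fx N" "z \<in> Fx N" "a1 \<otimes> u2 \<ominus> a2 \<otimes> u1 = a1 \<otimes> y \<oplus> a2 \<otimes> z"
    using regN 12 32 13 unfolding regular_on_def by blast
  have yzc: "y \<in> carrier R" "z \<in> carrier R" using yz FxD(1) by auto
  have "a2 \<otimes> (u1 \<oplus> z) = a1 \<otimes> (u2 \<ominus> y) \<ominus> ((a1 \<otimes> u2 \<ominus> a2 \<otimes> u1) \<ominus> (a1 \<otimes> y \<oplus> a2 \<otimes> z))"
    using ac u1(1) u2(1) yzc by algebra
  also have "\<dots> = a1 \<otimes> (u2 \<ominus> y)"
    unfolding yz(3) using ac yzc u2(1) by (simp add: ring.minus_eq ring.r_neg)
  finally obtain w where w: "w \<in> carrier R" "u1 \<oplus> z = a1 \<otimes> w"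
    using ring.weakly_regularD2(2)[OF reg, of "u1 \<oplus> z" "u2 \<ominus> y"] u1(1) u2(1) yzc by auto
  show thesis
  proof (rule that[OF w(1)])
    fix n assume n: "n \<in> N"
    have nc: "n \<in> carrier G" using n N by blast
    have "a1 \<otimes> \<phi> n w = \<phi> n (u1 \<oplus> z)" unfolding w(2) using nc ac w FxD(2)[OF a(1) nc] by simp
    also have "\<dots> = (u1 \<oplus> z) \<oplus> a1 \<otimes> e n"
      using nc n u1 yzc FxD(2)[OF yz(2) n] e[of n] ac by (simp add: ring.a_ac)
    also have "\<dots> = a1 \<otimes> (w \<oplus> e n)" unfolding w(2) using ac w(1) e[of n] by (simp add: ring.r_distr)
    finally have eq: "a1 \<otimes> \<phi> n w = a1 \<otimes> (w \<oplus> e n)" .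
    show "\<phi> n w = w \<oplus> e n"
      by (rule ring.weakly_regular_cancel[OF reg _ _ eq])
        (intro act_closed nc w(1) ring.a_closed e)+
  qed
qed

text \<open>For \<open>w\<close> with \<open>n(w) = w + f(n)\<close>, the function \<open>1 - (w - n(w))\<^sup>p\<^sup>-\<^sup>1\<close> of \<open>n\<close> is the indicator of the
  kernel \<open>N'\<close> of \<open>f\<close>. Hence every \<open>x\<close> in \<open>R\<^sup>N\<^sup>'\<close> is a combination of traces to \<open>R\<^sup>N\<close> of multiples of \<open>x\<close>.\<close>
lemma regular_on_kernel:
  assumes N: "subgroup N G" and N': "subgroup N' G" and K: "N' = {n \<in> N. f n = 0}"
    and f: "\<And>g. g \<in> N \<Longrightarrow> f g \<in> {0..<int p}"
    and a: "a1 \<in> Fx (carrier G)" "a2 \<in> Fx (carrier G)" "a3 \<in> Fx (carrier G)"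
    and w: "w \<in> carrier R" "\<And>n. n \<in> N \<Longrightarrow> \<phi> n w = w \<oplus> [(f n :: int)] \<cdot> \<one>"
    and reg: "regular_on a1 a2 a3 N"
  shows "regular_on a1 a2 a3 N'"
  unfolding regular_on_def
proof (intro ballI impI)
  interpret N: subgroup N G by fact
  interpret N': subgroup N' G by fact
  let ?e = "\<lambda>k::int. [k] \<cdot> \<one>"
  have ec: "?e k \<in> carrier R" for k by (rule ring.of_int_closed[OF p char])
  have NN: "N' \<subseteq> N" using K by blast
  note Nc = N.subset and N'c = N'.subset
  fix x y z
  assume x: "x \<in> Fx N'" and y: "y \<in> Fx N'" and z: "z \<in> Fx N'" and eq: "a3 \<otimes> x = a1 \<otimes> y \<oplus> a2 \<otimes> z"
  have aN: "a1 \<in> Fx N" "a2 \<in> Fx N" "a3 \<in> Fx N" using a Fx_mono[OF Nc] by auto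
  have aN': "a1 \<in> Fx N'" "a2 \<in> Fx N'" "a3 \<in> Fx N'" using a Fx_mono[OF N'c] by auto
  have ac: "a1 \<in> carrier R" "a2 \<in> carrier R" "a3 \<in> carrier R" using a FxD(1) by auto
  have c: "x \<in> carrier R" "y \<in> carrier R" "z \<in> carrier R" using x y z FxD(1) by auto
  have wF: "w \<in> Fx N'" using w K by (auto intro!: FxI simp: ring.of_int_zero)
  \<comment> \<open>The ideal \<open>(a1, a2)\<close> of \<open>R\<^sup>N\<^sup>'\<close>, which is
    to contain \<open>x\<close>.\<close>
  define J where "J = {a1 \<otimes> s \<oplus> a2 \<otimes> t |s t. s \<in> Fx N' \<and> t \<in> Fx N'}"
  have JI: "a1 \<otimes> s \<oplus> a2 \<otimes> t \<in> J" if "s \<in> Fx N'" "t \<in> Fx N'" for s t using that unfolding J_def by blast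
  have J_minus: "j \<ominus> k \<in> J" if j: "j \<in> J" and k: "k \<in> J" for j k
  proof -
    obtain s t where st: "s \<in> Fx N'" "t \<in> Fx N'" "j = a1 \<otimes> s \<oplus> a2 \<otimes> t" using j unfolding J_def by blast
    obtain s' t' where st': "s' \<in> Fx N'" "t' \<in> Fx N'" "k = a1 \<otimes> s' \<oplus> a2 \<otimes> t'" using k unfolding J_def by blast
    have "s \<in> carrier R" "t \<in> carrier R" "s' \<in> carrier R" "t' \<in> carrier R" using st st' FxD(1) by auto
    then have "j \<ominus> k = a1 \<otimes> (s \<ominus> s') \<oplus> a2 \<otimes> (t \<ominus> t')" unfolding st(3) st'(3) using ac by algebra
    then show ?thesis using JI[OF Fx_minus[OF N'c st(1) st'(1)] Fx_minus[OF N'c st(2) st'(2)]] by simp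
  qed
  have J_mult: "v \<otimes> j \<in> J" if v: "v \<in> Fx N'" and j: "j \<in> J" for v j
  proof -
    obtain s t where st: "s \<in> Fx N'" "t \<in> Fx N'" "j = a1 \<otimes> s \<oplus> a2 \<otimes> t" using j unfolding J_def by blast
    have "s \<in> carrier R" "t \<in> carrier R" "v \<in> carrier R" using st v FxD(1) by auto
    then have "v \<otimes> j = a1 \<otimes> (v \<otimes> s) \<oplus> a2 \<otimes> (v \<otimes> t)" unfolding st(3) using ac by algebra
    then show ?thesis using JI[OF Fx_mult[OF N'c v st(1)] Fx_mult[OF N'c v st(2)]] by simp
  qed
  let ?X = "grp.cosets_of N N'"
  have fin: "finite ?X" by (rule finite_cosets_of[OF Nc])
  define d where "d C = w \<ominus> coset_act C w" for C
  have cc: "coset_act C r \<in> carrier R" if "C \<in> ?X" "r \<in> Fx N'" for C r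
    using coset_act_closed[OF N' Nc that(2,1)] .
  have dc: "d C \<in> carrier R" if "C \<in> ?X" for C unfolding d_def using cc[OF that wF] w(1) by simp
  \<comment> \<open>The trace of \<open>v x\<close> with each summand weighted by a power of
    \<open>w - g(w)\<close>. At \<open>k = p - 1\<close> the weights are those of the indicator of
    the complement of \<open>N'\<close>.\<close>
  define S where "S k v = (\<Oplus>C\<in>?X. coset_act C (v \<otimes> x) \<otimes> d C [^] (k::nat))" for k v
  have vx: "v \<otimes> x \<in> Fx N'" if "v \<in> Fx N'" for v by (rule Fx_mult[OF N'c that x])
  \<comment> \<open>For \<open>k = 0\<close> the sum is a trace to \<open>R\<^sup>N\<close>, where
    the assumed regularity applies. The recursion \<open>S (Suc k) v = w S k v - S k (v w)\<close>
    changes \<open>v\<close>, which is why \<open>v\<close> is left arbitrary.\<close>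
  have SJ: "S k v \<in> J" if "v \<in> Fx N'" for k v
    using that
  proof (induction k arbitrary: v)
    case 0
    have vc: "v \<in> carrier R" using FxD(1)[OF 0] .
    note vxN = vx[OF 0] and vy = Fx_mult[OF N'c 0 y] and vz = Fx_mult[OF N'c 0 z]
    have S0: "S 0 v = trace_over N N' (v \<otimes> x)"
      unfolding S_def trace_over_def using cc[OF _ vxN] by (intro ring.finsum_cong') auto
    have "a3 \<otimes> trace_over N N' (v \<otimes> x) = trace_over N N' (a3 \<otimes> (v \<otimes> x))"
      by (rule trace_over_mult[OF N' Nc NN vxN aN(3), symmetric])
    also have "a3 \<otimes> (v \<otimes> x) = a1 \<otimes> (v \<otimes> y) \<oplus> a2 \<otimes> (v \<otimes> z)"
    proof -
      have "a3 \<otimes> (v \<otimes> x) = v \<otimes> (a3 \<otimes> x)" using ac vc c by (simp add: ring.m_ac)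
      also have "\<dots> = a1 \<otimes> (v \<otimes> y) \<oplus> a2 \<otimes> (v \<otimes> z)" unfolding eq using ac vc c by algebra
      finally show ?thesis .
    qed
    also have "trace_over N N' (a1 \<otimes> (v \<otimes> y) \<oplus> a2 \<otimes> (v \<otimes> z))
        = a1 \<otimes> trace_over N N' (v \<otimes> y) \<oplus> a2 \<otimes> trace_over N N' (v \<otimes> z)"
      by (simp only: trace_over_add[OF N' Nc Fx_mult[OF N'c aN'(1) vy] Fx_mult[OF N'c aN'(2) vz]]
          trace_over_mult[OF N' Nc NN vy aN(1)] trace_over_mult[OF N' Nc NN vz aN(2)])
    finally obtain s t where "s \<in> Fx N" "t \<in> Fx N" "trace_over N N' (v \<otimes> x) = a1 \<otimes> s \<oplus> a2 \<otimes> t"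
      using reg trace_over_Fx[OF N' N vxN] trace_over_Fx[OF N' N vy] trace_over_Fx[OF N' N vz]
      unfolding regular_on_def by blast
    then show ?case unfolding S0 using JI Fx_mono[OF NN] by auto
  next
    case (Suc k)
    have vc: "v \<in> carrier R" using FxD(1)[OF Suc.prems] .
    have vw: "v \<otimes> w \<in> Fx N'" by (rule Fx_mult[OF N'c Suc.prems wF])
    have 1: "coset_act C (v \<otimes> x) \<otimes> d C [^] Suc k
        = w \<otimes> (coset_act C (v \<otimes> x) \<otimes> d C [^] k) \<oplus> \<ominus> (coset_act C (v \<otimes> w \<otimes> x) \<otimes> d C [^] k)" if C: "C \<in> ?X" for C
    proof -
      obtain g where g: "g \<in> N" "C = g <#\<^bsub>G\<^esub> N'" using C by blast
      have gc: "g \<in> carrier G" using g Nc by blast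
      have vwx: "coset_act C (v \<otimes> w \<otimes> x) = coset_act C (v \<otimes> x) \<otimes> coset_act C w"
        unfolding g(2) coset_act_eq[OF N' gc vx[OF vw]] coset_act_eq[OF N' gc vx[OF Suc.prems]] coset_act_eq[OF N' gc wF]
        using gc vc w(1) c(1) by (simp add: ring.m_ac)
      have dk: "d C [^] k \<in> carrier R" using dc[OF C] by simp
      have "coset_act C (v \<otimes> x) \<otimes> (d C [^] k \<otimes> (w \<ominus> coset_act C w))
          = w \<otimes> (coset_act C (v \<otimes> x) \<otimes> d C [^] k) \<oplus> \<ominus> (coset_act C (v \<otimes> x) \<otimes> coset_act C w \<otimes> d C [^] k)"
        using dk cc[OF C vx[OF Suc.prems]] cc[OF C wF] w(1) by algebra
      then show ?thesis unfolding vwx by (simp add: d_def)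
    qed
    have cl: "coset_act C (v' \<otimes> x) \<otimes> d C [^] k \<in> carrier R" if "C \<in> ?X" "v' \<in> Fx N'" for C v'
      using cc[OF that(1) vx[OF that(2)]] dc[OF that(1)] by simp
    have neg: "(\<Oplus>C\<in>?X. \<ominus> (coset_act C (v \<otimes> w \<otimes> x) \<otimes> d C [^] k)) = \<ominus> S k (v \<otimes> w)"
    proof -
      have "(\<Oplus>C\<in>?X. \<ominus> (coset_act C (v \<otimes> w \<otimes> x) \<otimes> d C [^] k))
          = (\<Oplus>C\<in>?X. \<ominus> \<one> \<otimes> (coset_act C (v \<otimes> w \<otimes> x) \<otimes> d C [^] k))"
        using cl[OF _ vw] by (intro ring.finsum_cong') (auto simp: ring.l_minus)
      also have "\<dots> = \<ominus> \<one> \<otimes> S k (v \<otimes> w)"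
        unfolding S_def using cl[OF _ vw] fin by (intro ring.finsum_rdistr[symmetric]) auto
      also have "S k (v \<otimes> w) \<in> carrier R" unfolding S_def using cl[OF _ vw] by (intro ring.finsum_closed) auto
      then have "\<ominus> \<one> \<otimes> S k (v \<otimes> w) = \<ominus> S k (v \<otimes> w)" by (simp add: ring.l_minus)
      finally show ?thesis .
    qed
    have "S (Suc k) v = (\<Oplus>C\<in>?X. w \<otimes> (coset_act C (v \<otimes> x) \<otimes> d C [^] k) \<oplus> \<ominus> (coset_act C (v \<otimes> w \<otimes> x) \<otimes> d C [^] k))"
      unfolding S_def using 1 cl[OF _ vw] cl[OF _ Suc.prems] w(1)
      by (intro ring.finsum_cong') (auto simp del: ring.nat_pow_Suc)
    also have "\<dots> = (\<Oplus>C\<in>?X. w \<otimes> (coset_act C (v \<otimes> x) \<otimes> d C [^] k)) \<oplus> \<ominus> S k (v \<otimes> w)"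
      unfolding neg[symmetric] using cl[OF _ vw] cl[OF _ Suc.prems] w(1) by (intro ring.finsum_addf) auto
    also have "(\<Oplus>C\<in>?X. w \<otimes> (coset_act C (v \<otimes> x) \<otimes> d C [^] k)) = w \<otimes> S k v"
      unfolding S_def using cl[OF _ Suc.prems] w(1) fin by (intro ring.finsum_rdistr[symmetric]) auto
    also have "w \<otimes> S k v \<oplus> \<ominus> S k (v \<otimes> w) = w \<otimes> S k v \<ominus> S k (v \<otimes> w)" by (simp only: ring.minus_eq)
    finally show ?case using J_minus[OF J_mult[OF wF Suc.IH[OF Suc.prems]] Suc.IH[OF vw]] by simp
  qed
  have oneF: "\<one> \<in> Fx N'" by (rule Fx_one[OF N'c])
  \<comment> \<open>\<open>d C\<close> is the element \<open>- f g\<close> of the prime field, so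
    Fermat's theorem gives its power.\<close>
  have d0: "d C [^] (p - 1) = (if C = N' then \<zero> else \<one>)" if C: "C \<in> ?X" for C
  proof -
    obtain g where g: "g \<in> N" "C = g <#\<^bsub>G\<^esub> N'" using C by blast
    have gc: "g \<in> carrier G" using g Nc by blast
    have "d C = w \<ominus> (w \<oplus> ?e (f g))" unfolding d_def g(2) coset_act_eq[OF N' gc wF] w(2)[OF g(1)] ..
    also have "\<dots> = \<ominus> ?e (f g)" using w(1) ec[of "f g"] by algebra
    also have "\<dots> = ?e (- f g)" by (simp add: ring.add.int_pow_neg)
    finally have d: "d C = ?e (- f g)" .
    show ?thesis
    proof (cases "f g = 0")
      case True
      then have "g \<in> N'" using K g by simp
      then have "C = N'" using g(2) grp.coset_join3[OF gc N'] by simp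
      \<comment> \<open>Needed because the zeroth power of zero is one.\<close>
      moreover have "p - 1 \<noteq> 0" using prime_gt_1_nat[OF p] by simp
      ultimately show ?thesis using d True by (simp add: ring.of_int_zero ring.nat_pow_zero)
    next
      case False
      have "C \<noteq> N'"
      proof
        assume "C = N'"
        moreover have "g \<in> C" unfolding g(2) by (rule grp.lcos_self[OF gc N'])
        ultimately show False using K False by simp
      qed
      moreover have "\<not> int p dvd - f g" using f[OF g(1)] False by (auto dest: zdvd_imp_le)
      ultimately show ?thesis unfolding d using ring.of_int_fermat[OF p char, of "- f g"] by simp
    qed
  qed
  have N'X: "N' \<in> ?X"
  proof -
    have "\<one>\<^bsub>G\<^esub> <#\<^bsub>G\<^esub> N' = N'" by (rule grp.lcos_mult_one[OF N'c])
    then show ?thesis using N.one_closed by (metis image_eqI)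
  qed
  have x1: "coset_act N' x = x"
    using coset_act_eq[OF N' grp.one_closed x] grp.lcos_mult_one[OF N'c] c(1) by simp
  have S0: "S 0 \<one> = (\<Oplus>C\<in>?X. coset_act C x)"
    unfolding S_def using cc[OF _ x] c(1) by (intro ring.finsum_cong') auto
  \<comment> \<open>In the trace of \<open>x\<close>, the weight 1 is split into
    \<open>d C ^ (p - 1)\<close> and the indicator of the coset \<open>N'\<close>, whose only
    summand is \<open>x\<close>.\<close>
  have "S 0 \<one> = (\<Oplus>C\<in>?X. coset_act C (\<one> \<otimes> x) \<otimes> d C [^] (p - 1) \<oplus> (if N' = C then x else \<zero>))"
    unfolding S0 using cc[OF _ x] c(1) x1 d0 by (intro ring.finsum_cong') auto
  also have "\<dots> = S (p - 1) \<one> \<oplus> (\<Oplus>C\<in>?X. if N' = C then x else \<zero>)"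
    unfolding S_def using cc[OF _ x] c(1) dc by (intro ring.finsum_addf) auto
  also have "(\<Oplus>C\<in>?X. if N' = C then x else \<zero>) = x"
    using ring.finsum_singleton[OF N'X fin, of "\<lambda>_. x"] c(1) by simp
  finally have S0x: "S 0 \<one> = S (p - 1) \<one> \<oplus> x" .
  have "S (p - 1) \<one> \<in> carrier R" unfolding S_def using cc[OF _ x] c(1) dc by (intro ring.finsum_closed) auto
  then have "x = (S (p - 1) \<one> \<oplus> x) \<ominus> S (p - 1) \<one>" using c(1) by algebra
  then have "x = S 0 \<one> \<ominus> S (p - 1) \<one>" unfolding S0x .
  then have "x \<in> J" using J_minus[OF SJ[OF oneF] SJ[OF oneF]] by simp
  then show "\<exists>y\<in>Fx N'. \<exists>z\<in>Fx N'. x = a1 \<otimes> y \<oplus> a2 \<otimes> z" unfolding J_def by blast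
qed

text \<open>Only the bireflections in \<open>P\<close> are known to lie in \<open>H\<close>, so the
  \<open>p\<close>-element of the inertia group is conjugated into \<open>P\<close> and
  \<open>Q\<close> is translated along with it. Normality keeps the conjugate outside of
  \<open>H\<close>, and the translation preserves the height.\<close>

lemma prime_height_over_trace_image:
  assumes H: "H \<lhd> G" and P: "sylow_subgroup p P G"
    and reg: "\<And>g n. g \<in> carrier G \<Longrightarrow> g [^]\<^bsub>G\<^esub> (n::nat) = \<one>\<^bsub>G\<^esub> \<Longrightarrow> \<not> p dvd n \<Longrightarrow> g \<in> H"
    and bi: "\<And>g. g \<in> P \<Longrightarrow> bireflection G R \<phi> g \<Longrightarrow> g \<in> H"
    and Q: "primeideal Q R" and I: "trace_image G R \<phi> H \<subseteq> Q"
  shows "2 < prime_height R Q"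
proof -
  interpret H: normal H G by fact
  have Qc: "Q \<subseteq> carrier R" by (rule primeideal_subset[OF Q])
  have T: "subgroup (inertia Q) G" by (rule subgroup_inertia[OF primeideal.axioms(1)[OF Q]])
  have TH: "\<not> inertia Q \<subseteq> H" by (rule inertia_not_subset[OF p char H.is_subgroup Q I])
  obtain g k where g: "g \<in> inertia Q" "g \<notin> H" "g [^]\<^bsub>G\<^esub> (p ^ k :: nat) = \<one>\<^bsub>G\<^esub>"
    by (rule grp.exists_p_element_notin[OF finite_carrier p H.is_subgroup T TH reg])
  have gc: "g \<in> carrier G" by (rule inertiaD(1)[OF g(1)])
  obtain x where x: "x \<in> carrier G" "inv\<^bsub>G\<^esub> x \<otimes>\<^bsub>G\<^esub> g \<otimes>\<^bsub>G\<^esub> x \<in> P"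
    by (rule grp.conj_into_sylow[OF finite_carrier p P gc g(3)])
  let ?x = "inv\<^bsub>G\<^esub> x"
  let ?h = "?x \<otimes>\<^bsub>G\<^esub> g \<otimes>\<^bsub>G\<^esub> inv\<^bsub>G\<^esub> ?x"
  have xc: "?x \<in> carrier G" using x(1) by simp
  have hP: "?h \<in> P" using x by simp
  have "?h \<notin> H"
  proof
    assume "?h \<in> H"
    then have "x \<otimes>\<^bsub>G\<^esub> ?h \<otimes>\<^bsub>G\<^esub> inv\<^bsub>G\<^esub> x \<in> H" by (rule H.inv_op_closed2[OF x(1)])
    moreover have "x \<otimes>\<^bsub>G\<^esub> ?h \<otimes>\<^bsub>G\<^esub> inv\<^bsub>G\<^esub> x = (x \<otimes>\<^bsub>G\<^esub> ?x) \<otimes>\<^bsub>G\<^esub> g \<otimes>\<^bsub>G\<^esub> (x \<otimes>\<^bsub>G\<^esub> ?x)"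
      using x(1) gc by (simp only: grp.m_assoc grp.m_closed grp.inv_closed grp.inv_inv)
    ultimately show False using g(2) gc x(1) by simp
  qed
  then have nb: "\<not> bireflection G R \<phi> ?h" using bi[OF hP] by blast
  have "?h \<in> inertia (\<phi> ?x ` Q)" by (rule inertia_image[OF Qc xc g(1)])
  then have "2 < prime_height R (\<phi> ?x ` Q)"
    by (rule prime_height_gt_if_not_bireflection[OF primeideal_image[OF xc Q] _ nb])
  then show ?thesis by (simp add: prime_height_image[OF xc Qc])
qed

text \<open>Prime avoidance is applied to the maximal associated primes of both sequences at once,
  those of \<open>R\<close> being contracted to \<open>A\<close>, where \<open>I\<close> lives. None
  of them contains \<open>I\<close>, since by unmixedness they have height at most 2 in their own
  ring. The two sequences may differ, which is used for the third element.\<close>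

lemma exists_regular_element:
  assumes CMR: "cohen_macaulay R" and CMA: "cohen_macaulay A" and I: "ideal I A"
    and hR: "\<And>Q. primeideal Q R \<Longrightarrow> I \<subseteq> Q \<Longrightarrow> 2 < prime_height R Q"
    and hA: "\<And>q. primeideal q A \<Longrightarrow> I \<subseteq> q \<Longrightarrow> 2 < prime_height A q"
    and as: "cring.weakly_regular A as" "length as \<le> 2"
    and bs: "ring.weakly_regular bs" "length bs \<le> 2"
  obtains a where "a \<in> I" "cring.weakly_regular A (as @ [a])" "ring.weakly_regular (bs @ [a])"
proof -
  have A: "cring A" "noetherian_ring A" and NR: "noetherian_ring R"
    using CMA CMR by (simp_all add: cohen_macaulay_def)
  interpret A: cring A by (rule A(1))
  interpret I: ideal I A by (rule I)
  let ?KA = "genideal A (set as)" and ?KR = "Idl (set bs)"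
  have KA: "ideal ?KA A" using as(1) by (intro A.genideal_ideal) (simp add: A.weakly_regular_def)
  have KR: "ideal ?KR R" using bs(1) by (intro ring.genideal_ideal) (simp add: ring.weakly_regular_def)
  let ?c = "\<lambda>Q. Q \<inter> Fx (carrier G)"
  let ?FA = "A.assoc_max ?KA" and ?FR = "?c ` ring.assoc_max ?KR"
  obtain a where a: "a \<in> I" "\<And>P. P \<in> ?FA \<union> ?FR \<Longrightarrow> a \<notin> P"
  proof (rule A.prime_avoidance[OF I, of "?FA \<union> ?FR"])
    show "finite (?FA \<union> ?FR)"
      using A.finite_assoc_max[OF A(2) KA] ring.finite_assoc_max[OF NR KR] by simp
    show "primeideal P A" if "P \<in> ?FA \<union> ?FR" for P
      using that A.primeideal_assoc_max[OF KA] primeideal_contract[OF A(1)] ring.primeideal_assoc_max[OF KR] by auto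
    show "\<not> I \<subseteq> P" if P: "P \<in> ?FA \<union> ?FR" for P
    proof
      assume IP: "I \<subseteq> P"
      from P show False
      proof
        assume PA: "P \<in> ?FA"
        have "prime_height A P \<le> 2" by (rule A.prime_height_assoc_max[OF CMA as PA])
        then show False using hA[OF A.primeideal_assoc_max[OF KA PA] IP] by simp
      next
        assume "P \<in> ?FR"
        then obtain Q where Q: "Q \<in> ring.assoc_max ?KR" "P = ?c Q" by blast
        have "prime_height R Q \<le> 2" by (rule ring.prime_height_assoc_max[OF CMR bs Q(1)])
        moreover have "I \<subseteq> Q" using IP Q(2) by blast
        ultimately show False using hR[OF ring.primeideal_assoc_max[OF KR Q(1)]] by simp
      qed
    qed
  qed blast
  have aF: "a \<in> Fx (carrier G)" using I.Icarr[OF a(1)] by simp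
  have ac: "a \<in> carrier R" by (rule FxD(1)[OF aF])
  show thesis
  proof (rule that[OF a(1)])
    show "A.weakly_regular (as @ [a])"
    proof (rule A.weakly_regular_snoc[OF as(1)])
      show "a \<in> carrier A" using aF by simp
      fix r assume r: "r \<in> carrier A" "a \<otimes>\<^bsub>A\<^esub> r \<in> ?KA"
      show "r \<in> ?KA"
      proof (rule ccontr)
        assume "r \<notin> ?KA"
        then obtain P where "P \<in> ?FA" "a \<in> P"
          using aF by (rule_tac A.assoc_max_covers[OF A(2) KA r(1) _ _ r(2)]) simp_all
        then show False using a(2) by blast
      qed
    qed
    show "ring.weakly_regular (bs @ [a])"
    proof (rule ring.weakly_regular_snoc[OF bs(1) ac])
      fix r assume r: "r \<in> carrier R" "a \<otimes> r \<in> ?KR"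
      show "r \<in> ?KR"
      proof (rule ccontr)
        assume "r \<notin> ?KR"
        then obtain P where P: "P \<in> ring.assoc_max ?KR" "a \<in> P"
          by (rule ring.assoc_max_covers[OF NR KR r(1) _ ac r(2)])
        then show False using a(2)[of "?c P"] aF by blast
      qed
    qed
  qed
qed

theorem trace_surjective:
  assumes H: "H \<lhd> G" and P: "sylow_subgroup p P G"
    and reg: "\<And>g n. g \<in> carrier G \<Longrightarrow> g [^]\<^bsub>G\<^esub> (n::nat) = \<one>\<^bsub>G\<^esub> \<Longrightarrow> \<not> p dvd n \<Longrightarrow> g \<in> H"
    and bi: "\<And>g. g \<in> P \<Longrightarrow> bireflection G R \<phi> g \<Longrightarrow> g \<in> H"
    and CMR: "cohen_macaulay R" and CMA: "cohen_macaulay A"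
  shows "trace_image G R \<phi> H = Fx (carrier G)"
proof (rule ccontr)
  interpret H: normal H G by fact
  note Hs = H.is_subgroup
  define I where "I = trace_image G R \<phi> H"
  assume "trace_image G R \<phi> H \<noteq> Fx (carrier G)"
  then have ne: "I \<noteq> carrier A" by (simp add: I_def)
  have A: "cring A" "noetherian_ring A" and NR: "noetherian_ring R"
    using CMA CMR by (simp_all add: cohen_macaulay_def)
  interpret A: cring A by (rule A(1))
  interpret NA: noetherian_ring A by (rule A(2))
  have I: "ideal I A" unfolding I_def by (rule ideal_trace_image[OF A(1) Hs])
  have IF: "I \<subseteq> Fx (carrier G)" unfolding I_def by (rule trace_image_subset[OF Hs])
  have hR: "2 < prime_height R Q" if "primeideal Q R" "I \<subseteq> Q" for Q
    using H P reg bi that unfolding I_def by (rule prime_height_over_trace_image)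
  have over: "\<exists>Q. primeideal Q R \<and> Q \<inter> Fx (carrier G) = q" if "primeideal q A" for q
    by (rule exists_lying_over[OF NR that]) blast
  have hA: "2 < prime_height A q" if q: "primeideal q A" "I \<subseteq> q" for q
  proof -
    obtain Q where Q: "primeideal Q R" "Q \<inter> Fx (carrier G) = q" using over[OF q(1)] by blast
    have "2 < prime_height R Q" using Q q(2) by (intro hR) auto
    also have "\<dots> \<le> prime_height A q" using prime_height_le_contract[OF A(1), of Q] Q(2) by simp
    finally show ?thesis .
  qed
  obtain a1 where a1: "a1 \<in> I" "A.weakly_regular ([] @ [a1])" "ring.weakly_regular ([] @ [a1])"
    by (rule exists_regular_element[OF CMR CMA I hR hA A.weakly_regular_Nil _ ring.weakly_regular_Nil]) auto
  obtain a2 where a2: "a2 \<in> I" "A.weakly_regular (([] @ [a1]) @ [a2])" "ring.weakly_regular (([] @ [a1]) @ [a2])"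
    by (rule exists_regular_element[OF CMR CMA I hR hA a1(2) _ a1(3)]) auto
  \<comment> \<open>Only regularity on \<open>A\<close> is wanted of \<open>a3\<close>, so the
    sequence on \<open>R\<close> starts again from the empty one.\<close>
  obtain a3 where a3: "a3 \<in> I" "A.weakly_regular ((([] @ [a1]) @ [a2]) @ [a3])"
    by (rule exists_regular_element[OF CMR CMA I hR hA a2(2) _ ring.weakly_regular_Nil]) auto
  have aF: "a1 \<in> Fx (carrier G)" "a2 \<in> Fx (carrier G)" "a3 \<in> Fx (carrier G)"
    using a1(1) a2(1) a3(1) IF by auto
  have reg12: "ring.weakly_regular [a1, a2]" using a2(3) by simp
  have regG: "regular_on a1 a2 a3 (carrier G)"
    unfolding regular_on_def using A.weakly_regularD3(2)[of a1 a2 a3 "[]"] a3(2) by simp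
  \<comment> \<open>\<open>Q\<close> lies over a maximal ideal of \<open>A\<close> that contains the
    proper ideal \<open>I\<close>.\<close>
  obtain Q where Q: "primeideal Q R" "I \<subseteq> Q"
  proof -
    let ?F = "{J. ideal J A \<and> J \<noteq> carrier A}"
    obtain M where M: "M \<in> ?F" "I \<subseteq> M" "\<And>J'. J' \<in> ?F \<Longrightarrow> M \<subseteq> J' \<Longrightarrow> J' = M"
      by (rule NA.exists_maximal_ideal_in_family[of ?F I]) (use I ne in auto)
    have "maximalideal M A"
      using M(1) M(3) by (intro maximalidealI) auto
    then have "primeideal M A" by (rule A.maximalideal_prime)
    then obtain Q where "primeideal Q R" "Q \<inter> Fx (carrier G) = M" using over by blast
    then show thesis using that M(2) by blast
  qed
  interpret Q: primeideal Q R by (rule Q(1))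
  define T where "T = inertia Q"
  have T: "subgroup T G" unfolding T_def by (rule subgroup_inertia[OF Q.is_ideal])
  have TH: "\<not> T \<subseteq> H"
    unfolding T_def by (rule inertia_not_subset[OF p char Hs Q(1)]) (use Q(2) in \<open>simp add: I_def\<close>)
  \<comment> \<open>Containing \<open>T\<close> forces \<open>N \<noteq> H\<close>, so that a
    nonzero homomorphism to the integers modulo \<open>p\<close> always exists.\<close>
  let ?good = "\<lambda>N. subgroup N G \<and> H \<subseteq> N \<and> T \<subseteq> N \<and> regular_on a1 a2 a3 N"
  have "?good (carrier G)"
    using grp.subgroup_self H.subset subgroup.subset[OF T] regG by blast
  then obtain N where N: "?good N" and min: "\<And>M. ?good M \<Longrightarrow> card N \<le> card M"
    using ex_has_least_nat[of ?good "carrier G" card] by auto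
  have Ns: "subgroup N G" and HN: "H \<subseteq> N" and TN: "T \<subseteq> N" and regN: "regular_on a1 a2 a3 N"
    using N by simp_all
  interpret N: subgroup N G by (rule Ns)
  let ?GN = "G\<lparr>carrier := N\<rparr>"
  interpret GN: group ?GN by (rule grp.subgroup_imp_group[OF Ns])
  have finN: "finite N" using N.subset finite_carrier by (rule finite_subset)
  obtain n where n: "order ?GN = p ^ n * card H"
  proof (rule GN.index_prime_power[OF _ p])
    show "finite (carrier ?GN)" using finN by simp
    show "subgroup H ?GN" by (rule grp.subgroup_incl[OF Hs Ns HN])
    show "g \<in> H" if "g \<in> carrier ?GN" "g [^]\<^bsub>?GN\<^esub> (k::nat) = \<one>\<^bsub>?GN\<^esub>" "\<not> p dvd k" for g k
      using that reg[of g k] N.subset by (auto simp: nat_pow_def)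
  qed blast
  obtain f :: "'g \<Rightarrow> int" where f: "\<And>g h. g \<in> N \<Longrightarrow> h \<in> N \<Longrightarrow> f (g \<otimes>\<^bsub>G\<^esub> h) = (f g + f h) mod int p"
    "\<And>h. h \<in> H \<Longrightarrow> f h = 0" "\<And>g. g \<in> N \<Longrightarrow> f g \<in> {0..<int p}" "\<exists>g\<in>N. f g \<noteq> 0"
  proof (rule GN.exists_hom_mod_p[OF _ p _ n])
    show "finite (carrier ?GN)" using finN by simp
    show "H \<lhd> ?GN" by (rule grp.normal_restrict_supergroup[OF Ns H HN])
    show "H \<noteq> carrier ?GN" using TH TN by auto
  qed auto
  obtain u1 where u1: "u1 \<in> carrier R" "\<And>n. n \<in> N \<Longrightarrow> \<phi> n u1 = u1 \<oplus> a1 \<otimes> [(f n)] \<cdot> \<one>"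
    by (rule trace_image_kills_hom[OF H Ns HN f(1,2) a1(1)[unfolded I_def]]) auto
  obtain u2 where u2: "u2 \<in> carrier R" "\<And>n. n \<in> N \<Longrightarrow> \<phi> n u2 = u2 \<oplus> a2 \<otimes> [(f n)] \<cdot> \<one>"
    by (rule trace_image_kills_hom[OF H Ns HN f(1,2) a2(1)[unfolded I_def]]) auto
  obtain u3 where u3: "u3 \<in> carrier R" "\<And>n. n \<in> N \<Longrightarrow> \<phi> n u3 = u3 \<oplus> a3 \<otimes> [(f n)] \<cdot> \<one>"
    by (rule trace_image_kills_hom[OF H Ns HN f(1,2) a3(1)[unfolded I_def]]) auto
  have ec: "[(f n)] \<cdot> \<one> \<in> carrier R" for n by (rule ring.of_int_closed[OF p char])
  obtain w where w: "w \<in> carrier R" "\<And>n. n \<in> N \<Longrightarrow> \<phi> n w = w \<oplus> [(f n)] \<cdot> \<one>"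
    by (rule cocycle_vanishes[OF N.subset aF reg12 regN ec u1 u2 u3]) auto
  define N' where "N' = {n \<in> N. f n = 0}"
  have N'N: "N' \<subseteq> N" by (simp add: N'_def)
  have N'c: "N' \<subseteq> carrier G" using N'N N.subset by blast
  have N's: "subgroup N' G"
  proof (rule grp.subgroupI[OF N'c])
    have one: "\<one>\<^bsub>G\<^esub> \<in> N'" using f(2)[OF H.one_closed] by (simp add: N'_def)
    then show "N' \<noteq> {}" by blast
    show "g \<otimes>\<^bsub>G\<^esub> h \<in> N'" if "g \<in> N'" "h \<in> N'" for g h
      using that f(1)[of g h] by (simp add: N'_def)
    show "inv\<^bsub>G\<^esub> g \<in> N'" if g: "g \<in> N'" for g
    proof -
      have gN: "g \<in> N" "f g = 0" "g \<in> carrier G" using g N'c by (auto simp: N'_def)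
      have "f (g \<otimes>\<^bsub>G\<^esub> inv\<^bsub>G\<^esub> g) = (f g + f (inv\<^bsub>G\<^esub> g)) mod int p"
        using gN(1) by (intro f(1)) auto
      moreover have "f (inv\<^bsub>G\<^esub> g) \<in> {0..<int p}" using gN(1) by (intro f(3)) auto
      ultimately have "f (inv\<^bsub>G\<^esub> g) = 0" using gN f(2)[OF H.one_closed] by simp
      then show ?thesis using gN(1) by (simp add: N'_def)
    qed
  qed
  have "?good N'"
  proof (intro conjI)
    show "subgroup N' G" by (rule N's)
    show "H \<subseteq> N'" using HN f(2) by (auto simp: N'_def)
    show "T \<subseteq> N'"
    proof
      fix t assume t: "t \<in> T"
      then have tN: "t \<in> N" using TN by blast
      \<comment> \<open>An inertia element moves \<open>w\<close> by an element of \<open>Q\<close>,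
        and the only element of the prime field in \<open>Q\<close> is zero.\<close>
      have "\<phi> t w \<ominus> w \<in> Q" using t w(1) inertiaD(2) by (simp add: T_def)
      moreover have "(w \<oplus> [(f t)] \<cdot> \<one>) \<ominus> w = [(f t)] \<cdot> \<one>" using w(1) ec[of t] by algebra
      ultimately have "[(f t)] \<cdot> \<one> \<in> Q" using w(2)[OF tN] by simp
      then have "int p dvd f t" using ring.of_int_notin_prime[OF p char Q(1)] by blast
      then have "f t = 0" using f(3)[OF tN] by (auto dest: zdvd_imp_le)
      then show "t \<in> N'" using tN by (simp add: N'_def)
    qed
    show "regular_on a1 a2 a3 N'"
      by (rule regular_on_kernel[OF Ns N's N'_def f(3) aF w regN])
  qed
  then have "card N \<le> card N'" by (rule min)
  then have "N' = N" using N'N finN by (simp add: card_seteq)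
  then show False using f(4) by (auto simp: N'_def)
qed

end

end

text \<open>By additivity \<open>\<iota>\<close> sends the residue of \<open>k\<close> to
  \<open>k\<close> times one; the cases \<open>k = p\<close> and \<open>k = 0\<close> have the same
  residue.\<close>

lemma (in ring) add_pow_eq_zero_if_residue_ring_hom:
  assumes p: "Factorial_Ring.prime (p::nat)" and \<iota>: "\<iota> \<in> ring_hom (residue_ring (int p)) R"
  shows "[p] \<cdot> \<one> = \<zero>"
proof -
  interpret Z: residues_prime p "residue_ring (int p)" by unfold_locales (use p in auto)
  have p1: "1 < int p" using prime_gt_1_nat[OF p] by simp
  have car: "int k mod int p \<in> carrier (residue_ring (int p))" for k
    using p1 by (simp add: residue_ring_def)
  have "\<iota> (int k mod int p) = [k] \<cdot> \<one>" for k
  proof (induction k)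
    case 0
    have "\<iota> \<zero>\<^bsub>residue_ring (int p)\<^esub> = \<zero>" by (rule ring_hom_zero[OF \<iota> Z.ring_axioms ring_axioms])
    then show ?case by (simp add: residue_ring_def)
  next
    case (Suc k)
    have "int (Suc k) mod int p = int k mod int p \<oplus>\<^bsub>residue_ring (int p)\<^esub> \<one>\<^bsub>residue_ring (int p)\<^esub>"
      using p1 by (simp add: residue_ring_def mod_simps add.commute)
    then have "\<iota> (int (Suc k) mod int p) = \<iota> (int k mod int p) \<oplus> \<one>"
      using ring_hom_add[OF \<iota> car Z.one_closed] ring_hom_one[OF \<iota>] by simp
    then show ?case using Suc by simp
  qed
  from this[of p] this[of 0] show ?thesis by simp
qed

theorem corollary5p3:
  fixes G :: "('g, 'm) monoid_scheme"
    and R :: "('a, 'n) ring_scheme"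
    and \<phi> :: "'g \<Rightarrow> 'a \<Rightarrow> 'a"
    and p :: nat
    and P H :: "'g set"
  assumes "ring_action G R \<phi>"
    and "finite (carrier G)"
    and "normalization_semidom_class.prime p"
    and "\<exists>\<iota> \<in> ring_hom (residue_ring (int p)) R. inj_on \<iota> (carrier (residue_ring (int p)))"
    and "noetherian_module (fixed_ring R \<phi> (carrier G)) (ring_as_module R)"
    and "sylow_subgroup p P G"
    and "cohen_macaulay R"
    and "cohen_macaulay (fixed_ring R \<phi> (carrier G))"
    and "H = generate G (p_regular_elements p G \<union> {g \<in> P. bireflection G R \<phi> g})"
  shows "fixed_points R \<phi> (carrier G) = trace_image G R \<phi> H"
proof -
  interpret ring_action G R \<phi> by fact
  interpret finite_ring_action G R \<phi> by unfold_locales fact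
  note p = assms(3)
  have char: "[p] \<cdot>\<^bsub>R\<^esub> \<one>\<^bsub>R\<^esub> = \<zero>\<^bsub>R\<^esub>"
    using assms(4) ring.add_pow_eq_zero_if_residue_ring_hom[OF p] by blast
  have reg: "g \<in> p_regular_elements p G"
    if "g \<in> carrier G" "g [^]\<^bsub>G\<^esub> (n::nat) = \<one>\<^bsub>G\<^esub>" "\<not> p dvd n" for g n
    using that by (auto simp: grp.p_regular_elements_iff[OF finite_carrier])
  have P: "subgroup P G" using assms(6) by (simp add: sylow_subgroup_def)
  have incl: "g \<in> H" if "g \<in> p_regular_elements p G \<union> {g \<in> P. bireflection G R \<phi> g}" for g
    unfolding assms(9) using that by (rule generate.incl)
  have "H \<lhd> G"
    by (rule normal_generate_bireflections[OF P p assms(6,9)])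
      (use reg grp.p_regular_elements_conj[OF finite_carrier] in auto)
  then show ?thesis
    by (intro trace_surjective[OF p char _ assms(6) _ _ assms(7,8), symmetric]) (use reg incl in auto)
qed

end
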